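(* Let $K^0$ be an abstract elementary class with amalgamation, $\kappa>\mathrm{LS}(K^0)$ a cardinal, $K$ the class of $\kappa$-saturated models of $K^0$ of size at least $\kappa$ (ordered by the ordering of $K^0$), and $\widehat K$ the $(<\kappa)$-Galois Morleyization of $K$, with vocabulary $\widehat\tau$. Then: (1) (a) Invariance: if $f:N\cong N'$ and $M\,\underset{N}{\downarrow}\,(A,B)$, then $f[M]\,\underset{N'}{\downarrow}\,(f[A],f[B])$. (b) Monotonicity: if $M\,\underset{N}{\downarrow}\,(A,B)$ and $M\le M'\le N_0\le N$ (all in $K$), $A_0\subseteq A$, $B_0\subseteq B$, $|M'|\subseteq B$, $A_0\cup B_0\subseteq|N_0|$, then $M'\,\underset{N_0}{\downarrow}\,(A_0,B_0)$. (c) Normality: if $M\,\underset{N}{\downarrow}\,(A,B)$ then $M\,\underset{N}{\downarrow}\,(A\cup|M|,B\cup|M|)$. (d) Disjointness: if $M\,\underset{N}{\downarrow}\,(A,B)$ then $A\cap B\subseteq|M|$. (e) Left and right existence: $M\,\underset{N}{\downarrow}\,(A,|M|)$ and $M\,\underset{N}{\downarrow}\,(|M|,B)$ whenever $M\le N$ in $K$ and $A,B\subseteq|N|$. (f) Left and right $(<\kappa)$-set-witness: $M\,\underset{N}{\downarrow}\,(A,B)$ iff $M\,\underset{N}{\downarrow}\,(A_0,B_0)$ for all $A_0\subseteq A$, $B_0\subseteq B$ of size $<\kappa$. (g) Strong left transitivity: if $M_0\,\underset{N}{\downarrow}\,(|M_1|,B)$ and $M_1\,\underset{N}{\downarrow}\,(A,B)$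 then $M_0\,\underset{N}{\downarrow}\,(A,B)$. (2) If $\widehat K$ does not have the syntactic order property of length $\kappa$, then: (a) Symmetry: $M\,\underset{N}{\downarrow}\,(A,B)$ iff $M\,\underset{N}{\downarrow}\,(B,A)$. (b) Strong right transitivity: if $M_0\,\underset{N}{\downarrow}\,(A,|M_1|)$ and $M_1\,\underset{N}{\downarrow}\,(A,B)$ then $M_0\,\underset{N}{\downarrow}\,(A,B)$. (c) Set local character: for every cardinal $\alpha$ and every $p\in\mathrm{gS}^\alpha(M)$ (with $M\in K$) there is $M_0\le M$ in $K$ with $\|M_0\|\le\mu_\alpha:=(\alpha+2)^{<\kappa_r}$ such that $p$ is a coheir over $M_0$. (d) Syntactic uniqueness: if $M_0\le M\le N_\ell$ ($\ell=1,2$) are in $K$, $|M_0|\subseteq B\subseteq|M|$, $q_\ell\in\mathrm{S}^{<\infty}_{\mathrm{qf}}(B;\widehat{N_\ell})$, $q_1\upharpoonright|M_0|=q_2\upharpoonright|M_0|$, and $q_\ell$ is a coheir over $|M_0|$ in $\widehat{N_\ell}$ for $\ell=1,2$, then $q_1=q_2$. (e) Syntactic stability: for every cardinal $\alpha$, $\widehat K$ is syntactically $\alpha$-stable in every $\lambda\ge\mathrm{LS}(K^0)$ with $\lambda^{\mu_\alpha}=\lambda$. (3) If $\widehat K$ does not have the syntactic order property of length $\kappa$ and $K^0$ is $(<\kappa)$-tame and $(<\kappa)$-short for types of length less than $\alpha$, then: (a) Uniqueness: if $M_0\le M$ are in $K$ and $p,q\in\mathrm{gS}^{<\alpha}(M)$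 are coheirs over $M_0$ with $p\upharpoonright M_0=q\upharpoonright M_0$, then $p=q$. (b) Stability: for every cardinal $\beta<\alpha$, $K^0$ is $\beta$-stable in every $\lambda\ge\mathrm{LS}(K^0)$ with $\lambda^{\mu_\beta}=\lambda$.
   Context: $K^0$ is an abstract elementary class in the sense of Shelah with strong substructure relation $\le$ and Löwenheim–Skolem number $\mathrm{LS}(K^0)$; amalgamation: whenever $M_0\le M_1$, $M_0\le M_2$ there are $N$ and embeddings $f_\ell:M_\ell\to N$ fixing $M_0$. A $K$-embedding $f:M\to N$ is an isomorphism of $M$ onto some $f[M]\le N$. Galois types (in a class $K$): $(\bar b_1,A_1,N_1)E_{\mathrm{at}}(\bar b_2,A_2,N_2)$ iff $A_1=A_2=:A$ and there are $N\in K$ and $K$-embeddings $f_\ell:N_\ell\to N$ fixing $A$ pointwise with $f_1(\bar b_1)=f_2(\bar b_2)$; $E$ is its transitive closure, $\mathrm{gtp}(\bar b/A;N)$ the $E$-class; $p^I\upharpoonright A_0=\mathrm{gtp}(\bar b\upharpoonright I/A_0;N)$. For $M$ in the class, $\mathrm{gS}^\alpha(M)$ (resp. $\mathrm{gS}^{<\alpha}(M)$) is the set of $\mathrm{gtp}(\bar b/M;N)$ with $M\le N$, $\ell(\bar b)=\alpha$ (resp. $<\alpha$). $M\in K^0$ is $\kappa$-saturated if for every $N\ge M$ in $K^0$ and $A\subseteq|M|$ with $|A|<\kappa$, every Galois type over $A$ of length $<\kappa$ realized in $N$ is realized in $M$. $K^0$ is $(<\kappa)$-tame and short for types of length $<\alpha$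 if for every $M\in K^0$ and $p\ne q$ in $\mathrm{gS}^{<\alpha}(M)$ of the same length $\gamma$ there are $A_0\subseteq|M|$ with $|A_0|<\kappa$ and $I\subseteq\gamma$ with $|I|<\kappa$ such that $p^I\upharpoonright A_0\ne q^I\upharpoonright A_0$ (the tameness and shortness conditions for this family of types). $K^0$ is $\beta$-stable in $\lambda$ if for every $N\in K^0$, $A\subseteq|N|$ with $|A|\le\lambda$, there are at most $\lambda$ Galois types $\mathrm{gtp}(\bar b/A;N)$ with $\ell(\bar b)\le\beta$. The $(<\kappa)$-Galois Morleyization of $K$: $\widehat\tau$ is $\tau(K)$ plus a relation $R_p$ of arity $\ell(p)$ for each Galois type $p$ over $\emptyset$ of length $<\kappa$ (computed in $K$); $\widehat N$ interprets $R_p(\bar a)$ as $\mathrm{gtp}_K(\bar a/\emptyset;N)=p$. $\mathrm{tp}_{\mathrm{qf}}(\bar c/C;\widehat N)$ is the set of $\phi(\bar x;\bar e)$ with $\phi$ quantifier-free $\mathbb{L}_{\kappa,\kappa}(\widehat\tau)$, $\bar e$ from $C$, and $\widehat N\models\phi[\bar c,\bar e]$; $\mathrm{S}^{<\infty}_{\mathrm{qf}}(C;\widehat N)$ is the set of these for all sequences $\bar c$ from $N$; for such $q$ and $D\subseteq C$, $q\upharpoonright D$ is the set of formulas of $q$ with parameters in $D$. $\widehat K$ is syntactically $\alpha$-stable in $\lambda$ if for all $\widehat N\in\widehat K$ and $C\subseteq|N|$ with $|C|\le\lambda$ there are at most $\lambda$ types $\mathrm{tp}_{\mathrm{qf}}(\bar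 c/C;\widehat N)$ with $\ell(\bar c)\le\alpha$. A set $q$ of formulas over $\widehat N$ is a coheir over $A$ in $\widehat N$ if for every $\phi(\bar x)\in q$ there is $\bar e\in{}^{<\kappa}A$ with $\widehat N\models\phi[\bar e]$. Notation: $M\,\underset{N}{\downarrow}\,(A,B)$ means $M,N\in K$, $M\le N$, $A,B\subseteq|N|$, and $\mathrm{tp}_{\mathrm{qf}}(A/|M|\cup B;\widehat N)$ is a coheir over $|M|$ in $\widehat N$ ($A$ enumerated arbitrarily); also "$\mathrm{gtp}(A/B;N)$ is a coheir over $M$" means $M\,\underset{N}{\downarrow}\,(A,B)$. $\widehat K$ has the syntactic order property of length $\kappa$ if there are $\widehat M\in\widehat K$, a cardinal $\gamma<\kappa$, $\langle\bar a_i:i<\kappa\rangle$ in $\widehat M$ with $\ell(\bar a_i)=\gamma$, and a quantifier-free $\mathbb{L}_{\kappa,\kappa}(\widehat\tau)$-formula $\phi(\bar x,\bar y)$ with $\widehat M\models\phi[\bar a_i,\bar a_j]$ iff $i<j$. $\kappa_r$ denotes the least regular cardinal $\ge\kappa$.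
   Formalization: Strong left and right transitivity, (1)(g) and (2)(b), are stated with the added hypothesis M_0 ≤ M_1, without which they fail (Q-vector spaces with M_0 ∩ M_1 = 0); classes of models are taken inside a Grothendieck universe. *)

theory Defs
  imports Main "HOL-Library.FuncSet"
begin

unbundle cardinal_syntax

text \<open>
  Proper classes of structures are rendered by a Grothendieck universe: \<open>'u\<close> is a well-ordered
  type whose order type is a strongly inaccessible cardinal. ``Sets'' are the subsets of \<open>'u\<close> of
  cardinality less than that of \<open>'u\<close>; an element \<open>x :: 'u\<close> is an ordinal, identified with
  its initial segment \<open>{..<x}\<close>. Cardinals are initial ordinals, and the cardinality of a set
  \<open>A\<close> is compared with a cardinal \<open>\<kappa>\<close> by comparing \<open>|A|\<close> with \<open>|{..<\<kappa>}|\<close>.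
\<close>

definition inaccessible_universe :: "'u::wellorder itself \<Rightarrow> bool" where
  "inaccessible_universe _ \<longleftrightarrow>
     natLeq <o |UNIV :: 'u set| \<and>
     regularCard |UNIV :: 'u set| \<and>
     (\<forall>x::'u. |Pow {..<x}| <o |UNIV :: 'u set| )"

definition is_cardinal :: "'u::wellorder \<Rightarrow> bool" where
  "is_cardinal x \<longleftrightarrow> (\<forall>y<x. |{..<y}| <o |{..<x}| )"

definition limit_ordinal :: "'u::wellorder \<Rightarrow> bool" where
  "limit_ordinal \<delta> \<longleftrightarrow> {..<\<delta>} \<noteq> {} \<and> (\<forall>i<\<delta>. \<exists>j<\<delta>. i < j)"

definition least_regular :: "'u::wellorder \<Rightarrow> 'u" where
  "least_regular \<kappa> = (LEAST r. \<kappa> \<le> r \<and> is_cardinal r \<and> infinite {..<r} \<and> regularCard |{..<r}| )"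

text \<open>\<open>weak_power r k\<close> is the cardinal \<open>r\<close> to the power \<open><k\<close>, the supremum of the powers of
  \<open>r\<close> with exponent below \<open>k\<close>.\<close>

definition weak_power :: "'a rel \<Rightarrow> 'u::wellorder \<Rightarrow> 'u" where
  "weak_power r k = (LEAST z. \<forall>x<k. r ^c |{..<x}| \<le>o |{..<z}| )"

definition mu :: "'u::wellorder \<Rightarrow> 'u \<Rightarrow> 'u" where
  "mu \<kappa> \<alpha> = weak_power ( |{..<\<alpha>}| +c ctwo) (least_regular \<kappa>)"


subsection \<open>Structures\<close>

text \<open>A sequence is a partial function on ordinals; its domain is the index set. Arities are
  ordinals, so that the same notion of structure serves for finitary and infinitary vocabularies.\<close>

definition seqs :: "'u::wellorder \<Rightarrow> 'a set \<Rightarrow> ('u \<rightharpoonup> 'a) set" where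
  "seqs \<gamma> A = {b. dom b = {..<\<gamma>} \<and> ran b \<subseteq> A}"

definition mapseq :: "('a \<Rightarrow> 'b) \<Rightarrow> ('u \<rightharpoonup> 'a) \<Rightarrow> ('u \<rightharpoonup> 'b)" where
  "mapseq f b = (\<lambda>i. map_option f (b i))"

record ('s, 'u) vocab =
  rel_ar :: "'s \<rightharpoonup> 'u"
  fun_ar :: "'s \<rightharpoonup> 'u"

record ('s, 'u) struct =
  univ :: "'u set"
  rel :: "'s \<Rightarrow> ('u \<rightharpoonup> 'u) set"
  func :: "'s \<Rightarrow> ('u \<rightharpoonup> 'u) \<Rightarrow> 'u"

definition tuples :: "('s \<rightharpoonup> 'u::wellorder) \<Rightarrow> 's \<Rightarrow> 'u set \<Rightarrow> ('u \<rightharpoonup> 'u) set" where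
  "tuples ar s A = (case ar s of None \<Rightarrow> {} | Some n \<Rightarrow> seqs n A)"

definition is_struct :: "('s, 'u::wellorder) vocab \<Rightarrow> ('s, 'u) struct \<Rightarrow> bool" where
  "is_struct V M \<longleftrightarrow>
     univ M \<noteq> {} \<and> |univ M| <o |UNIV :: 'u set| \<and>
     (\<forall>s. rel M s \<subseteq> tuples (rel_ar V) s (univ M)) \<and>
     (\<forall>s. func M s \<in> tuples (fun_ar V) s (univ M) \<rightarrow>\<^sub>E univ M)"

definition substruct :: "('s, 'u::wellorder) vocab \<Rightarrow> ('s, 'u) struct \<Rightarrow> ('s, 'u) struct \<Rightarrow> bool" where
  "substruct V M N \<longleftrightarrow>
     is_struct V M \<and> is_struct V N \<and> univ M \<subseteq> univ N \<and>
     (\<forall>s. rel M s = rel N s \<inter> tuples (rel_ar V) s (univ M)) \<and>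
     (\<forall>s. \<forall>xs \<in> tuples (fun_ar V) s (univ M). func M s xs = func N s xs)"

definition iso ::
  "('s, 'u::wellorder) vocab \<Rightarrow> ('u \<Rightarrow> 'u) \<Rightarrow> ('s, 'u) struct \<Rightarrow> ('s, 'u) struct \<Rightarrow> bool" where
  "iso V f M N \<longleftrightarrow>
     is_struct V M \<and> is_struct V N \<and> bij_betw f (univ M) (univ N) \<and>
     (\<forall>s. \<forall>xs \<in> tuples (rel_ar V) s (univ M). xs \<in> rel M s \<longleftrightarrow> mapseq f xs \<in> rel N s) \<and>
     (\<forall>s. \<forall>xs \<in> tuples (fun_ar V) s (univ M). f (func M s xs) = func N s (mapseq f xs))"

definition image_struct ::
  "('s, 'u::wellorder) vocab \<Rightarrow> ('u \<Rightarrow> 'u) \<Rightarrow> ('s, 'u) struct \<Rightarrow> ('s, 'u) struct" where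
  "image_struct V f M =
     \<lparr>univ = f ` univ M,
      rel = (\<lambda>s. mapseq f ` rel M s),
      func = (\<lambda>s. \<lambda>ys \<in> tuples (fun_ar V) s (f ` univ M).
                f (func M s (mapseq (inv_into (univ M) f) ys)))\<rparr>"


subsection \<open>Abstract elementary classes\<close>

record ('s, 'u) aclass =
  voc :: "('s, 'u) vocab"
  mods :: "('s, 'u) struct set"
  leq :: "('s, 'u) struct \<Rightarrow> ('s, 'u) struct \<Rightarrow> bool"

definition embedding ::
  "('s, 'u::wellorder) aclass \<Rightarrow> ('u \<Rightarrow> 'u) \<Rightarrow> ('s, 'u) struct \<Rightarrow> ('s, 'u) struct \<Rightarrow> bool" where
  "embedding K f M N \<longleftrightarrow>
     M \<in> mods K \<and> N \<in> mods K \<and>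
     iso (voc K) f M (image_struct (voc K) f M) \<and> leq K (image_struct (voc K) f M) N"

definition LS_property :: "('s, 'u::wellorder) aclass \<Rightarrow> 'u \<Rightarrow> bool" where
  "LS_property K l \<longleftrightarrow>
     is_cardinal l \<and>
     |dom (rel_ar (voc K)) <+> dom (fun_ar (voc K))| +c natLeq \<le>o |{..<l}| \<and>
     (\<forall>M \<in> mods K. \<forall>A \<subseteq> univ M.
        \<exists>M0. leq K M0 M \<and> A \<subseteq> univ M0 \<and> |univ M0| \<le>o |A| +c |{..<l}| )"

definition LS :: "('s, 'u::wellorder) aclass \<Rightarrow> 'u" where
  "LS K = (LEAST l. LS_property K l)"

text \<open>In the chain axiom, the structure \<open>U\<close> is the union of the chain: arities are finite, so
  \<open>U\<close> is determined by its universe and by having every \<open>M i\<close> as a substructure.\<close>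

definition aec :: "('s, 'u::wellorder) aclass \<Rightarrow> bool" where
  "aec K \<longleftrightarrow>
     (\<forall>n \<in> ran (rel_ar (voc K)) \<union> ran (fun_ar (voc K)). finite {..<n}) \<and>
     (\<forall>M \<in> mods K. is_struct (voc K) M) \<and>
     (\<forall>M N. leq K M N \<longrightarrow> M \<in> mods K \<and> N \<in> mods K) \<and>
     (\<forall>M \<in> mods K. leq K M M) \<and>
     (\<forall>M N P. leq K M N \<and> leq K N P \<longrightarrow> leq K M P) \<and>
     (\<forall>M N. leq K M N \<and> leq K N M \<longrightarrow> M = N) \<and>
     (\<forall>f M M'. M \<in> mods K \<and> iso (voc K) f M M' \<longrightarrow> M' \<in> mods K) \<and>
     (\<forall>f M N N'. leq K M N \<and> iso (voc K) f N N' \<longrightarrow> leq K (image_struct (voc K) f M) N') \<and>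
     (\<forall>M N. leq K M N \<longrightarrow> substruct (voc K) M N) \<and>
     (\<forall>M0 M1 M2. substruct (voc K) M0 M1 \<and> leq K M0 M2 \<and> leq K M1 M2 \<longrightarrow> leq K M0 M1) \<and>
     (\<forall>(\<delta>::'u) M. limit_ordinal \<delta> \<and> (\<forall>i j. i < j \<and> j < \<delta> \<longrightarrow> leq K (M i) (M j)) \<longrightarrow>
        (\<exists>U \<in> mods K. univ U = (\<Union>i<\<delta>. univ (M i)) \<and>
           (\<forall>i<\<delta>. leq K (M i) U) \<and>
           (\<forall>N \<in> mods K. (\<forall>i<\<delta>. leq K (M i) N) \<longrightarrow> leq K U N))) \<and>
     (\<exists>l. LS_property K l)"

definition amalgamation :: "('s, 'u::wellorder) aclass \<Rightarrow> bool" where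
  "amalgamation K \<longleftrightarrow>
     (\<forall>M0 M1 M2. leq K M0 M1 \<and> leq K M0 M2 \<longrightarrow>
        (\<exists>N f1 f2. embedding K f1 M1 N \<and> embedding K f2 M2 N \<and>
           (\<forall>x \<in> univ M0. f1 x = x \<and> f2 x = x)))"


subsection \<open>Galois types\<close>

type_synonym ('s, 'u) gtype = "(('u \<rightharpoonup> 'u) \<times> 'u set \<times> ('s, 'u) struct) set"

definition E_at ::
  "('s, 'u::wellorder) aclass \<Rightarrow> (('u \<rightharpoonup> 'u) \<times> 'u set \<times> ('s, 'u) struct) rel" where
  "E_at K =
     {((b1, A1, N1), (b2, A2, N2)) | b1 A1 N1 b2 A2 N2.
        A1 = A2 \<and> A1 \<subseteq> univ N1 \<and> A2 \<subseteq> univ N2 \<and> ran b1 \<subseteq> univ N1 \<and> ran b2 \<subseteq> univ N2 \<and>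
        (\<exists>N f1 f2. embedding K f1 N1 N \<and> embedding K f2 N2 N \<and>
           (\<forall>x \<in> A1. f1 x = x \<and> f2 x = x) \<and> mapseq f1 b1 = mapseq f2 b2)}"

definition gtp ::
  "('s, 'u::wellorder) aclass \<Rightarrow> ('u \<rightharpoonup> 'u) \<Rightarrow> 'u set \<Rightarrow> ('s, 'u) struct \<Rightarrow> ('s, 'u) gtype" where
  "gtp K b A N = (E_at K)\<^sup>+ `` {(b, A, N)}"

definition gS :: "('s, 'u::wellorder) aclass \<Rightarrow> 'u \<Rightarrow> ('s, 'u) struct \<Rightarrow> ('s, 'u) gtype set" where
  "gS K \<alpha> M = {gtp K b (univ M) N | b N. leq K M N \<and> b \<in> seqs \<alpha> (univ N)}"

definition gS_less :: "('s, 'u::wellorder) aclass \<Rightarrow> 'u \<Rightarrow> ('s, 'u) struct \<Rightarrow> ('s, 'u) gtype set" where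
  "gS_less K \<alpha> M = (\<Union>\<gamma><\<alpha>. gS K \<gamma> M)"

text \<open>The restriction of a type to a set of indices \<open>I\<close> and a set of parameters \<open>A0\<close>; all members
  of the union coincide when \<open>p\<close> is a Galois type over a superset of \<open>A0\<close>.\<close>

definition gtp_restrict ::
  "('s, 'u::wellorder) aclass \<Rightarrow> 'u set \<Rightarrow> 'u set \<Rightarrow> ('s, 'u) gtype \<Rightarrow> ('s, 'u) gtype" where
  "gtp_restrict K I A0 p = (\<Union>(b, A, N) \<in> p. gtp K (b |` I) A0 N)"

definition saturated :: "'u::wellorder \<Rightarrow> ('s, 'u) aclass \<Rightarrow> ('s, 'u) struct \<Rightarrow> bool" where
  "saturated \<kappa> K M \<longleftrightarrow>
     M \<in> mods K \<and>
     (\<forall>N A \<gamma>. leq K M N \<and> A \<subseteq> univ M \<and> |A| <o |{..<\<kappa>}| \<and> \<gamma> < \<kappa> \<longrightarrow>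
        (\<forall>b \<in> seqs \<gamma> (univ N). \<exists>c \<in> seqs \<gamma> (univ M). gtp K c A M = gtp K b A N))"

definition saturated_class :: "'u::wellorder \<Rightarrow> ('s, 'u) aclass \<Rightarrow> ('s, 'u) aclass" where
  "saturated_class \<kappa> K =
     (let S = {M \<in> mods K. saturated \<kappa> K M \<and> |{..<\<kappa>}| \<le>o |univ M| }
      in \<lparr>voc = voc K, mods = S, leq = (\<lambda>M N. M \<in> S \<and> N \<in> S \<and> leq K M N)\<rparr>)"

definition tame_and_short :: "'u::wellorder \<Rightarrow> 'u \<Rightarrow> ('s, 'u) aclass \<Rightarrow> bool" where
  "tame_and_short \<kappa> \<alpha> K \<longleftrightarrow>
     (\<forall>M \<in> mods K. \<forall>\<gamma><\<alpha>. \<forall>p \<in> gS K \<gamma> M. \<forall>q \<in> gS K \<gamma> M. p \<noteq> q \<longrightarrow>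
        (\<exists>A0 I. A0 \<subseteq> univ M \<and> |A0| <o |{..<\<kappa>}| \<and> I \<subseteq> {..<\<gamma>} \<and> |I| <o |{..<\<kappa>}| \<and>
           gtp_restrict K I A0 p \<noteq> gtp_restrict K I A0 q))"

definition galois_stable :: "('s, 'u::wellorder) aclass \<Rightarrow> 'u \<Rightarrow> 'u \<Rightarrow> bool" where
  "galois_stable K \<beta> l \<longleftrightarrow>
     (\<forall>N \<in> mods K. \<forall>A \<subseteq> univ N. |A| \<le>o |{..<l}| \<longrightarrow>
        |{gtp K b A N | b. \<exists>\<gamma>\<le>\<beta>. b \<in> seqs \<gamma> (univ N)}| \<le>o |{..<l}| )"


subsection \<open>Quantifier-free infinitary formulas\<close>

datatype (dead 's, dead 'u, tvars: 'v) tm =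
  Var 'v
| App 's "'u \<Rightarrow> ('s, 'u, 'v) tm option"

datatype (dead 's, dead 'u, fvars: 'v) fm =
  Equ "('s, 'u, 'v) tm" "('s, 'u, 'v) tm"
| Rel 's "'u \<Rightarrow> ('s, 'u, 'v) tm option"
| Neg "('s, 'u, 'v) fm"
| Conj "'u \<Rightarrow> ('s, 'u, 'v) fm option"

inductive wf_tm :: "('s, 'u::wellorder) vocab \<Rightarrow> ('s, 'u, 'v) tm \<Rightarrow> bool" for V where
  "wf_tm V (Var x)"
| "fun_ar V s = Some n \<Longrightarrow> dom ts = {..<n} \<Longrightarrow> (\<And>i t. ts i = Some t \<Longrightarrow> wf_tm V t) \<Longrightarrow>
     wf_tm V (App s ts)"

inductive wf_fm :: "'u::wellorder \<Rightarrow> ('s, 'u) vocab \<Rightarrow> ('s, 'u, 'v) fm \<Rightarrow> bool" for \<kappa> V where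
  "wf_tm V t \<Longrightarrow> wf_tm V u \<Longrightarrow> wf_fm \<kappa> V (Equ t u)"
| "rel_ar V s = Some n \<Longrightarrow> dom ts = {..<n} \<Longrightarrow> (\<And>i t. ts i = Some t \<Longrightarrow> wf_tm V t) \<Longrightarrow>
     wf_fm \<kappa> V (Rel s ts)"
| "wf_fm \<kappa> V \<phi> \<Longrightarrow> wf_fm \<kappa> V (Neg \<phi>)"
| "|dom F| <o |{..<\<kappa>}| \<Longrightarrow> (\<And>i \<phi>. F i = Some \<phi> \<Longrightarrow> wf_fm \<kappa> V \<phi>) \<Longrightarrow> wf_fm \<kappa> V (Conj F)"

text \<open>As usual, formulas of the infinitary logic have fewer than \<open>\<kappa>\<close> free variables; this is a
  restriction only when \<open>\<kappa>\<close> is singular.\<close>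

definition qf_formula :: "'u::wellorder \<Rightarrow> ('s, 'u) vocab \<Rightarrow> ('s, 'u, 'v) fm \<Rightarrow> bool" where
  "qf_formula \<kappa> V \<phi> \<longleftrightarrow> wf_fm \<kappa> V \<phi> \<and> |fvars \<phi>| <o |{..<\<kappa>}|"

primrec tval :: "('s, 'u) struct \<Rightarrow> ('v \<Rightarrow> 'u) \<Rightarrow> ('s, 'u, 'v) tm \<Rightarrow> 'u" where
  "tval M v (Var x) = v x"
| "tval M v (App s ts) = func M s (\<lambda>i. map_option (tval M v) (ts i))"

primrec sat :: "('s, 'u) struct \<Rightarrow> ('v \<Rightarrow> 'u) \<Rightarrow> ('s, 'u, 'v) fm \<Rightarrow> bool" where
  "sat M v (Equ t u) \<longleftrightarrow> tval M v t = tval M v u"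
| "sat M v (Rel s ts) \<longleftrightarrow> mapseq (tval M v) ts \<in> rel M s"
| "sat M v (Neg \<phi>) \<longleftrightarrow> \<not> sat M v \<phi>"
| "sat M v (Conj F) \<longleftrightarrow> (\<forall>b \<in> ran (\<lambda>i. map_option (sat M v) (F i)). b)"

text \<open>In a formula with parameters, the variable \<open>Inl i\<close> stands for the \<open>i\<close>-th entry of the
  sequence and \<open>Inr e\<close> is the parameter \<open>e\<close>.\<close>

type_synonym ('s, 'u) pfm = "('s, 'u, 'u + 'u) fm"

definition asg :: "('u \<rightharpoonup> 'u) \<Rightarrow> 'u + 'u \<Rightarrow> 'u" where
  "asg c = case_sum (\<lambda>i. the (c i)) (\<lambda>e. e)"

definition tp_qf ::
  "'u::wellorder \<Rightarrow> ('s, 'u) vocab \<Rightarrow> ('u \<rightharpoonup> 'u) \<Rightarrow> 'u set \<Rightarrow> ('s, 'u) struct \<Rightarrow> ('s, 'u) pfm set" where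
  "tp_qf \<kappa> V c C M =
     {\<phi>. qf_formula \<kappa> V \<phi> \<and> fvars \<phi> \<subseteq> Inl ` dom c \<union> Inr ` C \<and> sat M (asg c) \<phi>}"

definition S_qf ::
  "'u::wellorder \<Rightarrow> ('s, 'u) vocab \<Rightarrow> 'u set \<Rightarrow> ('s, 'u) struct \<Rightarrow> ('s, 'u) pfm set set" where
  "S_qf \<kappa> V C M = {tp_qf \<kappa> V c C M | c. \<exists>\<gamma>. c \<in> seqs \<gamma> (univ M)}"

definition qf_restrict :: "('s, 'u) pfm set \<Rightarrow> 'u set \<Rightarrow> ('s, 'u) pfm set" where
  "qf_restrict q D = {\<phi> \<in> q. fvars \<phi> \<subseteq> range Inl \<union> Inr ` D}"

definition coheir :: "('s, 'u) struct \<Rightarrow> 'u set \<Rightarrow> ('s, 'u) pfm set \<Rightarrow> bool" where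
  "coheir M A q \<longleftrightarrow>
     (\<forall>\<phi> \<in> q. \<exists>e. dom e = {i. Inl i \<in> fvars \<phi>} \<and> ran e \<subseteq> A \<and> sat M (asg e) \<phi>)"


subsection \<open>The Galois Morleyization and coheir independence\<close>

definition gtypes_empty :: "('s, 'u::wellorder) aclass \<Rightarrow> 'u \<Rightarrow> ('s, 'u) gtype set" where
  "gtypes_empty K \<gamma> = {gtp K b {} N | b N. N \<in> mods K \<and> b \<in> seqs \<gamma> (univ N)}"

definition hat_voc ::
  "'u::wellorder \<Rightarrow> ('s, 'u) aclass \<Rightarrow> ('s + ('s, 'u) gtype, 'u) vocab" where
  "hat_voc \<kappa> K =
     \<lparr>rel_ar = case_sum (rel_ar (voc K))
        (\<lambda>p. if \<exists>\<gamma><\<kappa>. p \<in> gtypes_empty K \<gamma> then Some (THE \<gamma>. p \<in> gtypes_empty K \<gamma>) else None),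
      fun_ar = case_sum (fun_ar (voc K)) (\<lambda>p. None)\<rparr>"

definition hat ::
  "'u::wellorder \<Rightarrow> ('s, 'u) aclass \<Rightarrow> ('s, 'u) struct \<Rightarrow> ('s + ('s, 'u) gtype, 'u) struct" where
  "hat \<kappa> K N =
     \<lparr>univ = univ N,
      rel = case_sum (rel N) (\<lambda>p. {a. \<exists>\<gamma><\<kappa>. a \<in> seqs \<gamma> (univ N) \<and> gtp K a {} N = p}),
      func = case_sum (func N) (\<lambda>p xs. undefined)\<rparr>"

definition syntactically_stable :: "'u::wellorder \<Rightarrow> ('s, 'u) aclass \<Rightarrow> 'u \<Rightarrow> 'u \<Rightarrow> bool" where
  "syntactically_stable \<kappa> K \<alpha> l \<longleftrightarrow>
     (\<forall>N \<in> mods K. \<forall>C \<subseteq> univ N. |C| \<le>o |{..<l}| \<longrightarrow>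
        |{tp_qf \<kappa> (hat_voc \<kappa> K) c C (hat \<kappa> K N) | c. \<exists>\<gamma>\<le>\<alpha>. c \<in> seqs \<gamma> (univ N)}| \<le>o |{..<l}| )"

text \<open>In the order property, \<open>Inl i\<close> and \<open>Inr i\<close> are the variables \<open>x\<^sub>i\<close> and \<open>y\<^sub>i\<close> of
  \<open>\<phi>(x, y)\<close>.\<close>

definition syntactic_order_property :: "'u::wellorder \<Rightarrow> ('s, 'u) aclass \<Rightarrow> bool" where
  "syntactic_order_property \<kappa> K \<longleftrightarrow>
     (\<exists>M \<in> mods K. \<exists>\<gamma><\<kappa>. is_cardinal \<gamma> \<and>
        (\<exists>a :: 'u \<Rightarrow> 'u \<rightharpoonup> 'u. \<exists>\<phi> :: ('s + ('s, 'u) gtype, 'u, 'u + 'u) fm.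
           (\<forall>i<\<kappa>. a i \<in> seqs \<gamma> (univ M)) \<and>
           qf_formula \<kappa> (hat_voc \<kappa> K) \<phi> \<and> fvars \<phi> \<subseteq> Inl ` {..<\<gamma>} \<union> Inr ` {..<\<gamma>} \<and>
           (\<forall>i<\<kappa>. \<forall>j<\<kappa>.
              sat (hat \<kappa> K M) (case_sum (\<lambda>k. the (a i k)) (\<lambda>k. the (a j k))) \<phi> \<longleftrightarrow> i < j)))"

definition indep ::
  "'u::wellorder \<Rightarrow> ('s, 'u) aclass \<Rightarrow> ('s, 'u) struct \<Rightarrow> ('s, 'u) struct \<Rightarrow> 'u set \<Rightarrow> 'u set \<Rightarrow> bool" where
  "indep \<kappa> K M N A B \<longleftrightarrow>
     M \<in> mods K \<and> N \<in> mods K \<and> leq K M N \<and> A \<subseteq> univ N \<and> B \<subseteq> univ N \<and>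
     (\<exists>\<gamma>. \<exists>a \<in> seqs \<gamma> (univ N). ran a = A \<and>
        coheir (hat \<kappa> K N) (univ M) (tp_qf \<kappa> (hat_voc \<kappa> K) a (univ M \<union> B) (hat \<kappa> K N)))"

definition gtp_coheir :: "'u::wellorder \<Rightarrow> ('s, 'u) aclass \<Rightarrow> ('s, 'u) struct \<Rightarrow> ('s, 'u) gtype \<Rightarrow> bool" where
  "gtp_coheir \<kappa> K M p \<longleftrightarrow> (\<exists>(b, B, N) \<in> p. indep \<kappa> K M N (ran b) B)"

end

theory Submission
  imports Defs
begin

text \<open>
  Two sequences have the same Galois type iff they are identified by embeddings into a common model
  (the relation \<open>same\<close> below). Since every model of \<open>K0\<close> has a \<open>\<kappa>\<close>-saturated extension, types computed
  in \<open>K\<close> and in \<open>K0\<close> agree, and for fewer than \<open>\<kappa>\<close> elements the Galois type and the quantifier-free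
  type in the Morleyization carry the same information. Part (1) is then direct from the definition
  of coheir and saturation. For part (2), a failure of symmetry or of uniqueness lets one choose in
  the base model, by transfinite recursion, a sequence of length \<open>\<kappa>\<close> ordered by a quantifier-free
  formula. Local character follows from symmetry: a submodel of size \<open>\<mu>\<^sub>\<alpha>\<close> closed under realizing all
  small types over itself and the given sequence \<open>a\<close> makes the type of the big model over \<open>a\<close> a
  coheir. Stability counts the pairs consisting of such a submodel and a type over it.
\<close>

subsection \<open>Cardinals in the universe\<close>

text \<open>The obstacle is that \<kappa> may be singular. A chain of length \<kappa> need not catch
  a set of fewer than \<kappa> elements at one stage, so chains have length
  \<open>\<kappa>\<^sub>r\<close>; and few formulas with few variables each may have too many
  together, so conjunctions are formed only of instances of a single formula. The constant
  \<open>\<mu>\<^sub>\<alpha>\<close> has the closure that local character needs: it bounds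
  \<alpha>, \<open>\<kappa>\<^sub>r\<close> and 2^x for x < \<kappa>, hence the number of small
  types over a small set, and its powers with exponent below \<open>\<kappa>\<^sub>r\<close> do not
  exceed it. A second obstacle is that the extensions of a model are too many for a recursion to run
  through. Types are therefore coded by tuples in models whose universe lies in a fixed set X; there
  are at most 2^|X| codes. In part (2), building an order in the base model needs two kinds of
  imitation. One comes from the coheir assumption; the other from left existence in the proof of
  symmetry, and from symmetry itself in the proof of uniqueness.\<close>

lemma card_of_lessThan_mono: "x \<le> y \<Longrightarrow> |{..<x}| \<le>o |{..<y::'u::wellorder}|"
  by (rule card_of_mono1) auto

lemma not_ordLess_ordLeq_card: "\<not> |A| <o |B| \<longleftrightarrow> |B| \<le>o |A|"
  using not_ordLess_iff_ordLeq[OF card_of_Well_order card_of_Well_order] .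

lemma is_cardinal_less_iff:
  assumes "is_cardinal x" shows "|{..<y}| <o |{..<x}| \<longleftrightarrow> y < x"
  using assms card_of_lessThan_mono[of x y] unfolding is_cardinal_def
  by (meson linorder_not_le not_ordLess_ordLeq)

text \<open>The least x with \<open>|A| \<le>o |{..<x}|\<close> works. Minimality only says that
  \<open>|{..<y}| <o |A|\<close> for y < x; the missing bound on \<open>{..<x}\<close> itself is an
  argument about order types.\<close>

lemma ex_cardinal_below:
  fixes z :: "'u::wellorder" and A :: "'a set"
  assumes "|A| \<le>o |{..<z}|"
  shows "\<exists>x\<le>z. is_cardinal x \<and> |{..<x}| =o |A|"
proof -
  define x :: 'u where "x = (LEAST x. |A| \<le>o |{..<x}| )"
  have Ax: "|A| \<le>o |{..<x}|" unfolding x_def using assms by (rule LeastI)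
  have xz: "x \<le> z" unfolding x_def using assms by (rule Least_le)
  have less: "|{..<y}| <o |A|" if "y < x" for y
    using not_less_Least[of y "\<lambda>x. |A| \<le>o |{..<x}|"] that not_ordLess_ordLeq_card x_def by blast
  \<comment> \<open>\<open>R x\<close> is the ordinal x as a library well-order on
    \<open>{..<x}\<close>. Were \<open>|A|\<close> strictly below it, \<open>|A|\<close> would be
    isomorphic to a proper initial segment \<open>R y\<close> with y < x, against
    minimality.\<close>
  define R where "R y = {(a, b). a \<le> b \<and> a < y \<and> b < y}" for y :: 'u
  have FR: "Field (R y) = {..<y}" for y by (auto simp: Field_def R_def)
  have wo: "Well_order (R y)" for y
    unfolding well_order_on_def linear_order_on_def partial_order_on_def preorder_on_def FR
  proof (intro conjI)
    show "refl_on {..<y} (R y)" "trans (R y)" "antisym (R y)" "total_on {..<y} (R y)"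
      "R y \<subseteq> {..<y} \<times> {..<y}"
      by (auto simp: refl_on_def trans_def antisym_def total_on_def R_def)
    have "R y - Id \<subseteq> {(a, b). a < b}" by (auto simp: R_def)
    thus "wf (R y - Id)" using wf wf_subset by blast
  qed
  have "\<not> |A| <o R x"
  proof
    assume "|A| <o R x"
    then obtain y where y: "y < x" "|A| =o Restr (R x) (underS (R x) y)"
      using ordLess_iff_ordIso_Restr[OF wo card_of_Well_order] FR by (metis lessThan_iff)
    have "Restr (R x) (underS (R x) y) = R y" using y by (auto simp: R_def underS_def)
    with y have "|Field |A| | =o |Field (R y)|" by (metis card_of_cong)
    hence "|A| =o |{..<y}|" by (simp add: FR Field_card_of)
    thus False using less[OF y(1)] not_ordLess_ordIso ordIso_symmetric by blast
  qed
  hence "R x \<le>o |A|" using wo card_of_Well_order not_ordLess_iff_ordLeq by blast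
  moreover have "|{..<x}| \<le>o R x" using card_of_least[of "{..<x}" "R x"] wo FR by metis
  ultimately have "|{..<x}| \<le>o |A|" using ordLeq_transitive by blast
  hence iso: "|{..<x}| =o |A|" using Ax by (simp add: ordIso_iff_ordLeq)
  have "is_cardinal x" unfolding is_cardinal_def
    using less iso ordLess_ordIso_trans ordIso_symmetric by blast
  thus ?thesis using iso xz by blast
qed

lemma small_cardinal:
  assumes "is_cardinal (x::'u::wellorder)" "|A| <o |{..<x}|"
  shows "\<exists>y<x. is_cardinal y \<and> |{..<y}| =o |A|"
proof -
  obtain y :: 'u where y: "is_cardinal y" "|{..<y}| =o |A|"
    using ex_cardinal_below[OF ordLess_imp_ordLeq[OF assms(2)]] by blast
  hence "|{..<y}| <o |{..<x}|" using assms(2) ordIso_ordLess_trans by blast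
  thus ?thesis using y is_cardinal_less_iff[OF assms(1)] by blast
qed

text \<open>A largest element i of \<open>{..<x}\<close> would make it the union of
  \<open>{..<i}\<close> and \<open>{i}\<close>, both smaller than the infinite cardinal x.\<close>

lemma infinite_cardinal_limit:
  assumes "is_cardinal (x::'u::wellorder)" "infinite {..<x}"
  shows "limit_ordinal x"
proof -
  have "\<exists>j<x. i < j" if "i < x" for i
  proof (rule ccontr)
    assume *: "\<not> (\<exists>j<x. i < j)"
    have "{..<x} = {..<i} \<union> {i}" using * that by (auto dest: linorder_neqE)
    moreover have "|{..<i} \<union> {i}| <o |{..<x}|"
    proof (rule card_of_Un_ordLess_infinite[OF assms(2)])
      show "|{..<i}| <o |{..<x}|" using assms(1) that by (simp add: is_cardinal_less_iff)
      show "|{i}| <o |{..<x}|" using assms(2)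
        by (meson card_of_ordLeq_finite finite.emptyI finite.insertI not_ordLess_ordLeq_card)
    qed
    ultimately show False using ordLess_irreflexive by metis
  qed
  moreover have "{..<x} \<noteq> {}" using assms(2) by auto
  ultimately show ?thesis unfolding limit_ordinal_def by blast
qed

lemma regular_stable:
  assumes "infinite A" "regularCard |A|" shows "stable |A|"
  using assms regularCard_stable[OF card_of_Card_order] by (simp add: Field_card_of)

text \<open>If the values were cofinal, \<open>{..<r}\<close> would be a union of fewer than r
  initial segments, each smaller than r. This is how a small subset of the union of a chain is found
  below one stage.\<close>

lemma regular_bounded:
  fixes r :: "'u::wellorder"
  assumes "is_cardinal r" "infinite {..<r}" "regularCard |{..<r}|" "|C| <o |{..<r}|" "f ` C \<subseteq> {..<r}"
  shows "\<exists>x<r. \<forall>c\<in>C. f c < x"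
proof (rule ccontr)
  assume *: "\<not> ?thesis"
  have "{..<r} = (\<Union>c\<in>C. {..<f c} \<union> {f c})"
  proof (intro set_eqI iffI)
    fix x assume "x \<in> {..<r}"
    then obtain c where "c \<in> C" "x \<le> f c" using * by (metis lessThan_iff not_le)
    thus "x \<in> (\<Union>c\<in>C. {..<f c} \<union> {f c})" by (auto simp: order.strict_iff_order)
  next
    fix x assume "x \<in> (\<Union>c\<in>C. {..<f c} \<union> {f c})"
    then obtain c where "c \<in> C" "x \<le> f c" by auto
    thus "x \<in> {..<r}" using assms(5) by force
  qed
  moreover have "|\<Union>c\<in>C. {..<f c} \<union> {f c}| <o |{..<r}|"
  proof (rule stable_UNION[OF regular_stable[OF assms(2,3)] assms(4)], rule card_of_Un_ordLess_infinite[OF assms(2)])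
    fix c assume "c \<in> C"
    thus "|{..<f c}| <o |{..<r}|" using assms(1,5) by (auto simp: is_cardinal_less_iff)
    show "|{f c}| <o |{..<r}|" using assms(2)
      by (meson card_of_ordLeq_finite finite.emptyI finite.insertI not_ordLess_ordLeq_card)
  qed
  ultimately show False using ordLess_irreflexive by metis
qed

section \<open>Sizes of function spaces, powersets, unions and products\<close>

lemma card_Func_mono: "|A| \<le>o |B| \<Longrightarrow> |Func X A| \<le>o |Func X B|"
  using cexp_mono1[of "|A|" "|B|" "|X|"] by (simp add: cexp_def Field_card_of card_of_card_order_on)

lemma card_Func_cong: "|X| =o |Y| \<Longrightarrow> |Func X A| =o |Func Y A|"
  using cexp_cong2[of "|X|" "|Y|" "|A|"] by (simp add: cexp_def Field_card_of card_of_card_order_on)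

lemma card_Func_Pow: "|Func A B| \<le>o |Pow (A \<times> B)|"
proof (rule card_of_ordLeqI)
  show "inj_on (\<lambda>f. {(a, f a) |a. a \<in> A}) (Func A B)"
    by (rule inj_onI) (auto simp: Func_def fun_eq_iff set_eq_iff, metis)
qed (auto simp: Func_def)

lemma card_Pow_mono: "|A| \<le>o |B| \<Longrightarrow> |Pow A| \<le>o |Pow B|"
  by (metis card_of_ordLeq inj_on_image_Pow image_Pow_mono)

lemma card_Pow_cong: "|A| =o |B| \<Longrightarrow> |Pow A| =o |Pow B|"
  by (simp add: ordIso_iff_ordLeq card_Pow_mono)

lemma Cinfinite_card_of: "infinite C \<Longrightarrow> Cinfinite |C|"
  by (simp add: cinfinite_def Field_card_of card_of_card_order_on)

lemma card_Un_leq: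
  assumes "infinite C" "|A| \<le>o |C|" "|B| \<le>o |C|" shows "|A \<union> B| \<le>o |C|"
  using Un_Cinfinite_bound[OF assms(2,3) Cinfinite_card_of[OF assms(1)]] .

lemma card_UNION_leq:
  assumes "infinite C" "|I| \<le>o |C|" "\<And>i. i \<in> I \<Longrightarrow> |F i| \<le>o |C|" shows "|\<Union>i\<in>I. F i| \<le>o |C|"
  using UNION_Cinfinite_bound[OF assms(2) _ Cinfinite_card_of[OF assms(1)]] assms(3) by blast

lemma card_Times_leq:
  assumes "infinite C" "|A| \<le>o |C|" "|B| \<le>o |C|" shows "|A \<times> B| \<le>o |C|"
  using card_of_Times_ordLeq_infinite_Field[OF _ assms(2,3) card_of_Card_order] assms(1)
  by (simp add: Field_card_of)

lemma card_finite_less: "infinite C \<Longrightarrow> finite A \<Longrightarrow> |A| <o |C|"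
  by (meson card_of_ordLeq_finite not_ordLess_ordLeq_card)

text \<open>The product has the size of its larger factor as soon as that one is infinite. Hence
  products of small sets stay small even for singular \<kappa>.\<close>

lemma card_Times_less:
  assumes "infinite C" "|A| <o |C|" "|B| <o |C|" shows "|A \<times> B| <o |C|"
proof (cases "finite A \<and> finite B")
  case True
  thus ?thesis using assms card_finite_less[of C "A \<times> B"] by simp
next
  case False
  show ?thesis
  proof (cases "|A| \<le>o |B|")
    case True
    hence "infinite B" using False card_of_ordLeq_finite[OF True] by auto
    hence "|A \<times> B| \<le>o |B|" using card_Times_leq[OF _ True card_of_mono1[OF subset_refl]] by simp
    thus ?thesis using assms(3) ordLeq_ordLess_trans by blast
  next
    case f: False
    hence BA: "|B| \<le>o |A|" using not_ordLess_ordLeq_card ordLess_imp_ordLeq by blast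
    hence "infinite A" using False card_of_ordLeq_finite[OF BA] by auto
    hence "|A \<times> B| \<le>o |A|" using card_Times_leq[OF _ card_of_mono1[OF subset_refl] BA] by simp
    thus ?thesis using assms(2) ordLeq_ordLess_trans by blast
  qed
qed

section \<open>Small sets in the inaccessible universe\<close>

locale inaccessible =
  fixes U :: "'u::wellorder itself"
  assumes inaccessible: "inaccessible_universe U"
begin

lemma infinite_universe: "infinite (UNIV :: 'u set)"
  using inaccessible unfolding inaccessible_universe_def
  by (metis infinite_iff_natLeq_ordLeq ordLess_imp_ordLeq)

lemma stable_universe: "stable |UNIV :: 'u set|"
  using inaccessible infinite_universe unfolding inaccessible_universe_def
  by (blast intro: regular_stable)

lemma small_lessThan: "|{..<x::'u}| <o |UNIV :: 'u set|"
  using inaccessible unfolding inaccessible_universe_def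
  by (meson card_of_Pow ordLess_transitive)

lemma small_mono: "|A| \<le>o |B| \<Longrightarrow> |B| <o |UNIV :: 'u set| \<Longrightarrow> |A| <o |UNIV :: 'u set|"
  by (rule ordLeq_ordLess_trans)

lemma small_subset: "A \<subseteq> B \<Longrightarrow> |B| <o |UNIV :: 'u set| \<Longrightarrow> |A| <o |UNIV :: 'u set|"
  by (rule small_mono[OF card_of_mono1])

lemma small_Un: "|A| <o |UNIV :: 'u set| \<Longrightarrow> |B| <o |UNIV :: 'u set| \<Longrightarrow> |A \<union> B| <o |UNIV :: 'u set|"
  by (rule card_of_Un_ordLess_infinite[OF infinite_universe])

lemma small_finite: "finite A \<Longrightarrow> |A| <o |UNIV :: 'u set|"
  by (rule card_finite_less[OF infinite_universe])

lemma small_UNION: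
  assumes "|A| <o |UNIV :: 'u set|" "\<And>a. a \<in> A \<Longrightarrow> |F a| <o |UNIV :: 'u set|"
  shows "|\<Union>a\<in>A. F a| <o |UNIV :: 'u set|"
  using stable_UNION[OF stable_universe assms] .

lemma small_Sigma:
  assumes "|A| <o |UNIV :: 'u set|" "\<And>a. a \<in> A \<Longrightarrow> |F a| <o |UNIV :: 'u set|"
  shows "|SIGMA a:A. F a| <o |UNIV :: 'u set|"
  using stable_elim[OF stable_universe assms] .

lemma small_bounded:
  assumes "|B| <o |UNIV :: 'u set|" shows "\<exists>z. B \<subseteq> {..<z::'u}"
proof (rule ccontr)
  assume *: "\<not> ?thesis"
  hence "(UNIV :: 'u set) = (\<Union>c\<in>B. {..<c} \<union> {c})"
  proof (intro set_eqI iffI)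
    fix x :: 'u
    have "\<not> B \<subseteq> {..<x}" using * by blast
    then obtain c where "c \<in> B" "x \<le> c" by (metis lessThan_iff not_le subsetI)
    thus "x \<in> (\<Union>c\<in>B. {..<c} \<union> {c})" by (auto simp: order.strict_iff_order)
  qed simp
  moreover have "|\<Union>c\<in>B. {..<c} \<union> {c}| <o |UNIV :: 'u set|"
    by (rule small_UNION[OF assms], rule small_Un, rule small_lessThan, rule small_finite) simp
  ultimately show False using ordLess_irreflexive by metis
qed

text \<open>A small set of any type is first copied to a subset of \<open>'u\<close>, which is
  bounded by regularity of the universe. Sets of types and index sets can thus be enumerated by
  ordinals in transfinite constructions.\<close>

lemma small_ordinal:
  assumes "|A| <o |UNIV :: 'u set|" shows "\<exists>x::'u. is_cardinal x \<and> |{..<x}| =o |A|"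
proof -
  obtain B :: "'u set" where B: "|A| =o |B|"
    using internalize_card_of_ordLeq2[of A "UNIV::'u set"] assms ordLess_imp_ordLeq by blast
  hence "|B| <o |UNIV :: 'u set|" using assms ordIso_ordLess_trans ordIso_symmetric by blast
  then obtain z where "B \<subseteq> {..<z::'u}" using small_bounded by blast
  hence "|A| \<le>o |{..<z}|" using B card_of_mono1 ordIso_ordLeq_trans by blast
  thus ?thesis using ex_cardinal_below by blast
qed

lemma small_Pow: "|A| <o |UNIV :: 'u set| \<Longrightarrow> |Pow A| <o |UNIV :: 'u set|"
proof -
  assume "|A| <o |UNIV :: 'u set|"
  then obtain x :: 'u where x: "|{..<x}| =o |A|" using small_ordinal by blast
  have "|Pow {..<x}| <o |UNIV :: 'u set|" using inaccessible unfolding inaccessible_universe_def by blast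
  thus ?thesis using card_Pow_cong[OF x] ordIso_ordLess_trans ordIso_symmetric by blast
qed

lemma small_Times: "|A| <o |UNIV :: 'u set| \<Longrightarrow> |B| <o |UNIV :: 'u set| \<Longrightarrow> |A \<times> B| <o |UNIV :: 'u set|"
  using small_Sigma[of A "\<lambda>_. B"] by blast

lemma small_Func:
  assumes "|A| <o |UNIV :: 'u set|" "|B| <o |UNIV :: 'u set|" shows "|Func A B| <o |UNIV :: 'u set|"
proof -
  have "|A \<times> B| <o |UNIV :: 'u set|" using assms by (rule small_Times)
  hence "|Pow (A \<times> B)| <o |UNIV :: 'u set|" by (rule small_Pow)
  thus ?thesis by (rule ordLeq_ordLess_trans[OF card_Func_Pow])
qed

text \<open>The \<open>LEAST\<close> in \<open>least_regular\<close> needs a witness. The successor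
  cardinal of k is regular, and being at most \<open>|Pow {..<k}|\<close> it is represented in the
  universe.\<close>

lemma least_regular_props:
  fixes k :: 'u
  assumes "is_cardinal k" "infinite {..<k}"
  shows "k \<le> least_regular k" "is_cardinal (least_regular k)" "infinite {..<least_regular k}"
    "regularCard |{..<least_regular k}|"
proof -
  let ?P = "\<lambda>r. k \<le> r \<and> is_cardinal r \<and> infinite {..<r} \<and> regularCard |{..<r}|"
  let ?S = "cardSuc |{..<k}|"
  have C: "Cinfinite |{..<k}|" using assms Cinfinite_card_of by blast
  have "?S \<le>o |Pow {..<k}|"
    by (rule cardSuc_least) (auto simp: card_of_Card_order card_of_Pow)
  hence "|Field ?S| \<le>o |Pow {..<k}|" using card_of_mono2 Field_card_of by metis
  hence "|Field ?S| <o |UNIV :: 'u set|" using small_mono small_Pow small_lessThan by blast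
  then obtain r :: 'u where r: "is_cardinal r" "|{..<r}| =o |Field ?S|" using small_ordinal by blast
  have iso: "|{..<r}| =o ?S"
    using r(2) card_of_Field_ordIso[OF cardSuc_Card_order[OF card_of_Card_order]] ordIso_transitive by blast
  have SC: "Cinfinite ?S" using Cinfinite_cardSuc C by blast
  have "Cinfinite |{..<r}|" using iso SC Cinfinite_cong ordIso_symmetric by blast
  hence inf: "infinite {..<r}" by (simp add: cinfinite_def Field_card_of)
  have "regularCard |{..<r}|"
    using regularCard_ordIso[OF ordIso_symmetric[OF iso] SC regularCard_cardSuc[OF C]] .
  moreover have "k < r"
    using cardSuc_greater[of "|{..<k}|"] ordLess_ordIso_trans[OF _ ordIso_symmetric[OF iso]]
      is_cardinal_less_iff[OF r(1)] card_of_Card_order by blast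
  ultimately have "?P r" using r(1) inf by auto
  hence "?P (least_regular k)" unfolding least_regular_def by (rule LeastI)
  thus "k \<le> least_regular k" "is_cardinal (least_regular k)" "infinite {..<least_regular k}"
    "regularCard |{..<least_regular k}|" by auto
qed

end

subsection \<open>Structures, embeddings and Galois types\<close>

lemma mapseq_mapseq [simp]: "mapseq f (mapseq g b) = mapseq (f \<circ> g) b"
  by (simp add: mapseq_def option.map_comp)

lemma dom_mapseq [simp]: "dom (mapseq f b) = dom b"
  by (auto simp: mapseq_def)

lemma ran_mapseq [simp]: "ran (mapseq f b) = f ` ran b"
  by (force simp: mapseq_def ran_def)

lemma mapseq_cong: "(\<And>x. x \<in> ran b \<Longrightarrow> f x = g x) \<Longrightarrow> mapseq f b = mapseq g b"
  unfolding mapseq_def by (intro ext option.map_cong) (auto intro: ranI)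

lemma mapseq_ident: "(\<And>x. x \<in> ran b \<Longrightarrow> f x = x) \<Longrightarrow> mapseq f b = b"
  using mapseq_cong[of b f id] by (simp add: mapseq_def option.map_id)

lemma mapseq_seqs: "b \<in> seqs \<gamma> A \<Longrightarrow> f ` A \<subseteq> B \<Longrightarrow> mapseq f b \<in> seqs \<gamma> B"
  by (simp add: seqs_def) blast

lemma seqs_mono: "b \<in> seqs \<gamma> A \<Longrightarrow> A \<subseteq> B \<Longrightarrow> b \<in> seqs \<gamma> B"
  by (auto simp: seqs_def)

lemma tuples_ran: "xs \<in> tuples ar s A \<Longrightarrow> ran xs \<subseteq> A"
  by (auto simp: tuples_def seqs_def split: option.splits)

lemma tuples_mapseq: "xs \<in> tuples ar s A \<Longrightarrow> f ` A \<subseteq> B \<Longrightarrow> mapseq f xs \<in> tuples ar s B"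
  by (auto simp: tuples_def mapseq_seqs split: option.splits)

lemma tuples_mono: "A \<subseteq> B \<Longrightarrow> tuples ar s A \<subseteq> tuples ar s B"
  by (auto simp: tuples_def seqs_mono split: option.splits)

lemma mapseq_inj_tuples:
  assumes "inj_on f A" "xs \<in> tuples ar s A" "ys \<in> tuples ar s A" "mapseq f xs = mapseq f ys"
  shows "xs = ys"
proof -
  have "xs = mapseq (inv_into A f) (mapseq f xs)" "ys = mapseq (inv_into A f) (mapseq f ys)"
    using tuples_ran[OF assms(2)] tuples_ran[OF assms(3)] assms(1)
    by (simp_all only: mapseq_mapseq) (rule mapseq_ident[symmetric], force)+
  thus ?thesis using assms(4) by metis
qed

lemma mapseq_inv_tuples:
  assumes "ys \<in> tuples ar s (f ` A)"
  shows "mapseq (inv_into A f) ys \<in> tuples ar s A" "mapseq f (mapseq (inv_into A f) ys) = ys"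
proof -
  show "mapseq (inv_into A f) ys \<in> tuples ar s A"
    using assms by (rule tuples_mapseq) (auto intro: inv_into_into)
  show "mapseq f (mapseq (inv_into A f) ys) = ys"
    using tuples_ran[OF assms] f_inv_into_f[of _ f A] unfolding mapseq_mapseq
    by (intro mapseq_ident) force
qed

lemma is_struct_image:
  fixes M :: "('s, 'b::wellorder) struct"
  assumes "is_struct V M" "inj_on f (univ M)"
  shows "is_struct V (image_struct V f M)"
  unfolding is_struct_def
proof (intro conjI allI)
  show "univ (image_struct V f M) \<noteq> {}" using assms by (simp add: is_struct_def image_struct_def)
  show "|univ (image_struct V f M)| <o |UNIV :: 'b set|"
    using assms(1) unfolding is_struct_def image_struct_def
    by (auto intro: ordLeq_ordLess_trans[OF card_of_image])
  fix s
  have R: "rel M s \<subseteq> tuples (rel_ar V) s (univ M)"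
    and F: "func M s \<in> tuples (fun_ar V) s (univ M) \<rightarrow>\<^sub>E univ M"
    using assms(1) by (auto simp: is_struct_def)
  show "rel (image_struct V f M) s \<subseteq> tuples (rel_ar V) s (univ (image_struct V f M))"
    using R by (auto simp: image_struct_def intro: tuples_mapseq)
  show "func (image_struct V f M) s \<in> tuples (fun_ar V) s (univ (image_struct V f M)) \<rightarrow>\<^sub>E univ (image_struct V f M)"
    using F by (auto simp: image_struct_def mapseq_inv_tuples PiE_def)
qed

lemma iso_image_struct:
  assumes "is_struct V M" "inj_on f (univ M)"
  shows "iso V f M (image_struct V f M)"
  unfolding iso_def
proof (intro conjI allI ballI)
  show "is_struct V M" "is_struct V (image_struct V f M)" using assms is_struct_image by auto
  show "bij_betw f (univ M) (univ (image_struct V f M))"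
    using assms by (simp add: image_struct_def bij_betw_def)
next
  fix s xs assume xs: "xs \<in> tuples (rel_ar V) s (univ M)"
  have R: "rel M s \<subseteq> tuples (rel_ar V) s (univ M)" using assms(1) by (auto simp: is_struct_def)
  show "xs \<in> rel M s \<longleftrightarrow> mapseq f xs \<in> rel (image_struct V f M) s"
  proof
    assume "mapseq f xs \<in> rel (image_struct V f M) s"
    then obtain ys where ys: "ys \<in> rel M s" "mapseq f xs = mapseq f ys" by (auto simp: image_struct_def)
    hence "xs = ys" using mapseq_inj_tuples[OF assms(2) xs] R by blast
    thus "xs \<in> rel M s" using ys by simp
  qed (simp add: image_struct_def)
next
  fix s xs assume xs: "xs \<in> tuples (fun_ar V) s (univ M)"
  have "mapseq f xs \<in> tuples (fun_ar V) s (f ` univ M)" using xs by (rule tuples_mapseq) simp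
  moreover have "mapseq (inv_into (univ M) f) (mapseq f xs) = xs"
    using tuples_ran[OF xs] assms(2) by (auto intro!: mapseq_ident)
  ultimately show "f (func M s xs) = func (image_struct V f M) s (mapseq f xs)"
    by (simp add: image_struct_def)
qed

text \<open>Relations contain only tuples of their arity and functions are extensional, so agreement
  on the universe is equality of records: an isomorphism determines its target literally.\<close>

lemma iso_imp_image_struct:
  assumes "iso V f M N" shows "image_struct V f M = N"
proof -
  have b: "univ N = f ` univ M" "inj_on f (univ M)" using assms by (auto simp: iso_def bij_betw_def)
  have sM: "is_struct V M" and sN: "is_struct V N" using assms by (auto simp: iso_def)
  have "univ (image_struct V f M) = univ N" by (simp add: image_struct_def b)
  moreover have "rel (image_struct V f M) s = rel N s" for s
  proof
    have R: "rel M s \<subseteq> tuples (rel_ar V) s (univ M)" using sM by (auto simp: is_struct_def)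
    show "rel (image_struct V f M) s \<subseteq> rel N s"
      using assms R by (auto simp: image_struct_def iso_def)
    show "rel N s \<subseteq> rel (image_struct V f M) s"
    proof
      fix ys assume ys: "ys \<in> rel N s"
      hence t: "ys \<in> tuples (rel_ar V) s (f ` univ M)" using sN by (auto simp: is_struct_def b)
      let ?xs = "mapseq (inv_into (univ M) f) ys"
      have "?xs \<in> rel M s" using mapseq_inv_tuples[OF t] assms ys unfolding iso_def by metis
      thus "ys \<in> rel (image_struct V f M) s"
        using mapseq_inv_tuples(2)[OF t] by (auto simp: image_struct_def intro: rev_image_eqI)
    qed
  qed
  moreover have "func (image_struct V f M) s = func N s" for s
  proof (rule extensionalityI)
    show "func (image_struct V f M) s \<in> extensional (tuples (fun_ar V) s (f ` univ M))"
      by (simp add: image_struct_def)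
    show "func N s \<in> extensional (tuples (fun_ar V) s (f ` univ M))"
      using sN by (auto simp: is_struct_def b PiE_def)
    fix ys assume t: "ys \<in> tuples (fun_ar V) s (f ` univ M)"
    thus "func (image_struct V f M) s ys = func N s ys"
      using mapseq_inv_tuples[OF t] assms unfolding iso_def image_struct_def by simp
  qed
  ultimately show ?thesis by (intro struct.equality) auto
qed

lemma iso_comp:
  assumes "iso V f M N" "iso V g N P" shows "iso V (g \<circ> f) M P"
  unfolding iso_def
proof (intro conjI allI ballI)
  show "is_struct V M" "is_struct V P" using assms by (auto simp: iso_def)
  show "bij_betw (g \<circ> f) (univ M) (univ P)" using assms by (auto simp: iso_def intro: bij_betw_trans)
  have fN: "f ` univ M \<subseteq> univ N" using assms by (auto simp: iso_def bij_betw_def)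
  fix s xs
  show "(g \<circ> f) (func M s xs) = func P s (mapseq (g \<circ> f) xs)" if "xs \<in> tuples (fun_ar V) s (univ M)"
    using that tuples_mapseq[OF that fN] assms by (auto simp: iso_def simp flip: mapseq_mapseq)
  show "xs \<in> rel M s \<longleftrightarrow> mapseq (g \<circ> f) xs \<in> rel P s" if "xs \<in> tuples (rel_ar V) s (univ M)"
    using that tuples_mapseq[OF that fN] assms by (auto simp: iso_def simp flip: mapseq_mapseq)
qed

lemma iso_ident:
  assumes "is_struct V M" "\<And>x. x \<in> univ M \<Longrightarrow> f x = x" shows "iso V f M M"
  unfolding iso_def
proof (intro conjI allI ballI)
  show "is_struct V M" "is_struct V M" using assms by auto
  show "bij_betw f (univ M) (univ M)" using assms(2) by (auto simp: bij_betw_def inj_on_def)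
  have m: "mapseq f xs = xs" if "xs \<in> tuples ar s (univ M)" for ar s xs
    using tuples_ran[OF that] assms(2) by (intro mapseq_ident) blast
  fix s xs
  show "f (func M s xs) = func M s (mapseq f xs)" if xs: "xs \<in> tuples (fun_ar V) s (univ M)"
  proof -
    have "func M s xs \<in> univ M" using assms(1) xs unfolding is_struct_def PiE_def by blast
    thus ?thesis using m[OF xs] assms(2) by simp
  qed
  show "xs \<in> rel M s \<longleftrightarrow> mapseq f xs \<in> rel M s" if "xs \<in> tuples (rel_ar V) s (univ M)"
    using m[OF that] by simp
qed

lemma univ_image_struct [simp]: "univ (image_struct V f M) = f ` univ M"
  by (simp add: image_struct_def)

text \<open>Both sides are targets of the isomorphism \<open>g \<circ> f\<close> defined on M, which
  determines its target.\<close>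

lemma image_struct_comp:
  assumes "is_struct V M" "inj_on f (univ M)" "inj_on g (f ` univ M)"
  shows "image_struct V g (image_struct V f M) = image_struct V (g \<circ> f) M"
proof -
  have "iso V g (image_struct V f M) (image_struct V g (image_struct V f M))"
    using assms is_struct_image by (intro iso_image_struct) auto
  from iso_comp[OF iso_image_struct[OF assms(1,2)] this] show ?thesis
    by (rule iso_imp_image_struct[symmetric])
qed

lemma image_struct_ident:
  assumes "is_struct V M" "\<And>x. x \<in> univ M \<Longrightarrow> f x = x" shows "image_struct V f M = M"
  using iso_imp_image_struct iso_ident assms by blast

lemma iso_inverse:
  assumes "iso V f M N" shows "iso V (inv_into (univ M) f) N M"
proof -
  let ?g = "inv_into (univ M) f"
  have s: "is_struct V M" "is_struct V N" and b: "bij_betw f (univ M) (univ N)"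
    using assms by (auto simp: iso_def)
  have inj: "inj_on f (univ M)" "univ N = f ` univ M" "inj_on ?g (univ N)"
    using b bij_betw_inv_into by (auto simp: bij_betw_def)
  have "image_struct V ?g N = image_struct V (?g \<circ> f) M"
    using image_struct_comp[OF s(1) inj(1)] iso_imp_image_struct[OF assms] inj by simp
  also have "\<dots> = M" using inj(1) by (intro image_struct_ident[OF s(1)]) simp
  finally show ?thesis using iso_image_struct[OF s(2) inj(3)] by simp
qed

text \<open>The index set is arbitrary, so that one relation serves sequences, sequences with
  parameters and the variables of a formula. The embeddings need not fix anything: a parameter is an
  index at which both tuples take the same value.\<close>

definition same :: "('s, 'u::wellorder) aclass \<Rightarrow> 'i set \<Rightarrow> ('i \<Rightarrow> 'u) \<Rightarrow> ('s, 'u) struct \<Rightarrow> ('i \<Rightarrow> 'u) \<Rightarrow> ('s, 'u) struct \<Rightarrow> bool" where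
  "same K I b1 N1 b2 N2 \<longleftrightarrow>
     (\<exists>N f1 f2. embedding K f1 N1 N \<and> embedding K f2 N2 N \<and> (\<forall>i\<in>I. f1 (b1 i) = f2 (b2 i)))"

lemma same_sym: "same K I b1 N1 b2 N2 \<Longrightarrow> same K I b2 N2 b1 N1"
  unfolding same_def by metis

lemma same_reindex: "same K I b1 N1 b2 N2 \<Longrightarrow> h ` J \<subseteq> I \<Longrightarrow> same K J (b1 \<circ> h) N1 (b2 \<circ> h) N2"
  unfolding same_def by (metis comp_apply image_subset_iff)

lemma same_mono: "same K I b1 N1 b2 N2 \<Longrightarrow> J \<subseteq> I \<Longrightarrow> same K J b1 N1 b2 N2"
  using same_reindex[of K I b1 N1 b2 N2 id J] by simp

lemma same_cong:
  assumes "same K I b1 N1 b2 N2" "\<And>i. i \<in> I \<Longrightarrow> b1 i = c1 i" "\<And>i. i \<in> I \<Longrightarrow> b2 i = c2 i"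
  shows "same K I c1 N1 c2 N2"
  using assms unfolding same_def by metis

section \<open>Embeddings in an abstract elementary class\<close>

locale aec_class = inaccessible U for U :: "'u::wellorder itself" +
  fixes K0 :: "('s, 'u) aclass"
  assumes aec: "aec K0"
begin

lemmas mods_struct = aec[unfolded aec_def, THEN conjunct2, THEN conjunct1, rule_format]
lemmas leq_refl = aec[unfolded aec_def, THEN conjunct2, THEN conjunct2, THEN conjunct2, THEN conjunct1, rule_format]
lemmas leq_substruct = aec[unfolded aec_def, THEN conjunct2, THEN conjunct2, THEN conjunct2, THEN conjunct2, THEN conjunct2, THEN conjunct2, THEN conjunct2, THEN conjunct2, THEN conjunct1, rule_format]
lemmas ex_LS = aec[unfolded aec_def, THEN conjunct2, THEN conjunct2, THEN conjunct2, THEN conjunct2, THEN conjunct2, THEN conjunct2, THEN conjunct2, THEN conjunct2, THEN conjunct2, THEN conjunct2, THEN conjunct2, rule_format]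

lemma leq_mods: "leq K0 M N \<Longrightarrow> M \<in> mods K0" "leq K0 M N \<Longrightarrow> N \<in> mods K0"
  using aec[unfolded aec_def, THEN conjunct2, THEN conjunct2, THEN conjunct1, rule_format] by blast+

lemma leq_trans: "leq K0 M N \<Longrightarrow> leq K0 N P \<Longrightarrow> leq K0 M P"
  using aec[unfolded aec_def, THEN conjunct2, THEN conjunct2, THEN conjunct2, THEN conjunct2, THEN conjunct1, rule_format] by blast

lemma mods_iso: "M \<in> mods K0 \<Longrightarrow> iso (voc K0) f M M' \<Longrightarrow> M' \<in> mods K0"
  using aec[unfolded aec_def, THEN conjunct2, THEN conjunct2, THEN conjunct2, THEN conjunct2, THEN conjunct2, THEN conjunct2, THEN conjunct1, rule_format] by blast

lemma leq_iso: "leq K0 M N \<Longrightarrow> iso (voc K0) f N N' \<Longrightarrow> leq K0 (image_struct (voc K0) f M) N'"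
  using aec[unfolded aec_def, THEN conjunct2, THEN conjunct2, THEN conjunct2, THEN conjunct2, THEN conjunct2, THEN conjunct2, THEN conjunct2, THEN conjunct1, rule_format] by blast

lemma coherence: "substruct (voc K0) M0 M1 \<Longrightarrow> leq K0 M0 M2 \<Longrightarrow> leq K0 M1 M2 \<Longrightarrow> leq K0 M0 M1"
  using aec[unfolded aec_def, THEN conjunct2, THEN conjunct2, THEN conjunct2, THEN conjunct2, THEN conjunct2, THEN conjunct2, THEN conjunct2, THEN conjunct2, THEN conjunct2, THEN conjunct1, rule_format] by blast

lemma chain_union:
  assumes "limit_ordinal (\<delta>::'u)" "\<And>i j. i < j \<Longrightarrow> j < \<delta> \<Longrightarrow> leq K0 (M i) (M j)"
  obtains W where "W \<in> mods K0" "univ W = (\<Union>i<\<delta>. univ (M i))" "\<And>i. i < \<delta> \<Longrightarrow> leq K0 (M i) W"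
    "\<And>N. N \<in> mods K0 \<Longrightarrow> (\<And>i. i < \<delta> \<Longrightarrow> leq K0 (M i) N) \<Longrightarrow> leq K0 W N"
proof -
  have "limit_ordinal \<delta> \<and> (\<forall>i j. i < j \<and> j < \<delta> \<longrightarrow> leq K0 (M i) (M j))"
    using assms by blast
  from aec[unfolded aec_def, THEN conjunct2, THEN conjunct2, THEN conjunct2, THEN conjunct2, THEN conjunct2, THEN conjunct2, THEN conjunct2, THEN conjunct2, THEN conjunct2, THEN conjunct2, THEN conjunct1, THEN spec, THEN spec, THEN mp, OF this]
  obtain W where W: "W \<in> mods K0" "univ W = (\<Union>i<\<delta>. univ (M i))" "\<forall>i<\<delta>. leq K0 (M i) W"
    "\<forall>N\<in>mods K0. (\<forall>i<\<delta>. leq K0 (M i) N) \<longrightarrow> leq K0 W N" by (elim bexE conjE)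
  show thesis
  proof (rule that[OF W(1,2)])
    show "leq K0 (M i) W" if "i < \<delta>" for i using W(3) that by blast
    show "leq K0 W N" if "N \<in> mods K0" "\<And>i. i < \<delta> \<Longrightarrow> leq K0 (M i) N" for N using W(4) that by blast
  qed
qed

lemma leq_univ: "leq K0 M N \<Longrightarrow> univ M \<subseteq> univ N"
  using leq_substruct unfolding substruct_def by blast

text \<open>Reading relations and functions off N shows that M0 is a substructure of M1; coherence
  does the rest.\<close>

lemma leq_of_subset:
  assumes "leq K0 M0 N" "leq K0 M1 N" "univ M0 \<subseteq> univ M1" shows "leq K0 M0 M1"
proof (rule coherence[OF _ assms(1,2)])
  let ?V = "voc K0"
  have s: "substruct ?V M0 N" "substruct ?V M1 N" using assms leq_substruct by auto
  have t: "tuples ar s (univ M0) \<subseteq> tuples ar s (univ M1)" for ar s using assms(3) by (rule tuples_mono)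
  show "substruct ?V M0 M1"
    unfolding substruct_def
  proof (intro conjI allI ballI)
    show "is_struct ?V M0" "is_struct ?V M1" "univ M0 \<subseteq> univ M1"
      using s assms(3) by (auto simp: substruct_def)
    fix s' xs
    show "rel M0 s' = rel M1 s' \<inter> tuples (rel_ar ?V) s' (univ M0)"
    proof -
      have "rel M0 s' = rel N s' \<inter> tuples (rel_ar ?V) s' (univ M0)"
        "rel M1 s' = rel N s' \<inter> tuples (rel_ar ?V) s' (univ M1)" using s by (simp_all add: substruct_def)
      thus ?thesis using t[of "rel_ar ?V" s'] by blast
    qed
    show "func M0 s' xs = func M1 s' xs" if "xs \<in> tuples (fun_ar ?V) s' (univ M0)"
      using s that subsetD[OF t that] by (simp add: substruct_def)
  qed
qed

lemma univ_small: "M \<in> mods K0 \<Longrightarrow> |univ M| <o |UNIV :: 'u set|"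
  using mods_struct unfolding is_struct_def by blast

lemma univ_nonempty: "M \<in> mods K0 \<Longrightarrow> univ M \<noteq> {}"
  using mods_struct unfolding is_struct_def by blast

lemma embedding_iff:
  "embedding K0 f M N \<longleftrightarrow> M \<in> mods K0 \<and> inj_on f (univ M) \<and> leq K0 (image_struct (voc K0) f M) N"
proof
  assume "embedding K0 f M N"
  thus "M \<in> mods K0 \<and> inj_on f (univ M) \<and> leq K0 (image_struct (voc K0) f M) N"
    by (auto simp: embedding_def iso_def bij_betw_def)
next
  assume "M \<in> mods K0 \<and> inj_on f (univ M) \<and> leq K0 (image_struct (voc K0) f M) N"
  thus "embedding K0 f M N" using iso_image_struct mods_struct leq_mods by (auto simp: embedding_def)
qed

lemma embedding_mods: "embedding K0 f M N \<Longrightarrow> M \<in> mods K0" "embedding K0 f M N \<Longrightarrow> N \<in> mods K0"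
  by (auto simp: embedding_def)

lemma embedding_univ: "embedding K0 f M N \<Longrightarrow> f ` univ M \<subseteq> univ N"
  using leq_univ[of "image_struct (voc K0) f M" N] by (simp add: embedding_iff)

lemma embedding_inj: "embedding K0 f M N \<Longrightarrow> inj_on f (univ M)"
  by (simp add: embedding_iff)

lemma embedding_leq:
  assumes "leq K0 M N" "\<And>x. x \<in> univ M \<Longrightarrow> f x = x" shows "embedding K0 f M N"
  using assms image_struct_ident[OF mods_struct[OF leq_mods(1)[OF assms(1)]], of f] leq_mods
  by (auto simp: embedding_iff inj_on_def)

lemma embedding_comp:
  assumes "embedding K0 f M N" "embedding K0 g N P" shows "embedding K0 (g \<circ> f) M P"
proof -
  let ?V = "voc K0"
  have M: "M \<in> mods K0" "inj_on f (univ M)" "leq K0 (image_struct ?V f M) N"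
    and N: "N \<in> mods K0" "inj_on g (univ N)" "leq K0 (image_struct ?V g N) P"
    using assms by (auto simp: embedding_iff)
  have i: "inj_on g (f ` univ M)" using N(2) embedding_univ[OF assms(1)] by (rule inj_on_subset)
  have "leq K0 (image_struct ?V g (image_struct ?V f M)) (image_struct ?V g N)"
    using leq_iso[OF M(3) iso_image_struct[OF mods_struct[OF N(1)] N(2)]] .
  hence "leq K0 (image_struct ?V (g \<circ> f) M) P"
    using image_struct_comp[OF mods_struct[OF M(1)] M(2) i] leq_trans[OF _ N(3)] by simp
  thus ?thesis using M i by (simp add: embedding_iff comp_inj_on)
qed

lemma embedding_iso:
  assumes "M \<in> mods K0" "iso (voc K0) f M N" shows "embedding K0 f M N"
  using assms iso_imp_image_struct[OF assms(2)] mods_iso[OF assms] leq_refl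
  by (auto simp: embedding_iff iso_def bij_betw_def)

lemma embedding_image:
  assumes "M \<in> mods K0" "inj_on f (univ M)" shows "embedding K0 f M (image_struct (voc K0) f M)"
  using assms iso_image_struct mods_struct embedding_iso by blast

text \<open>Removing D and the image of A from the universe leaves a set that is not small, so the
  elements of X outside A can be sent injectively to fresh elements.\<close>

lemma ex_injection_extending:
  fixes f :: "'u \<Rightarrow> 'u"
  assumes "|X| <o |UNIV :: 'u set|" "A \<subseteq> X" "inj_on f A" "|A| <o |UNIV :: 'u set|" "|D| <o |UNIV :: 'u set|"
  shows "\<exists>g. inj_on g X \<and> (\<forall>x\<in>A. g x = f x) \<and> (\<forall>x\<in>X - A. g x \<notin> D)"
proof -
  have fA: "|f ` A \<union> D| <o |UNIV :: 'u set|"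
    using small_Un[OF small_mono[OF card_of_image assms(4)] assms(5)] .
  let ?R = "UNIV - (f ` A \<union> D)"
  have "|X| \<le>o |?R|"
  proof (rule ccontr)
    assume "\<not> |X| \<le>o |?R|"
    hence "|?R| <o |X|" using not_ordLess_ordLeq_card by blast
    hence "|?R| <o |UNIV :: 'u set|" using assms(1) ordLess_transitive by blast
    hence "|?R \<union> (f ` A \<union> D)| <o |UNIV :: 'u set|" using fA small_Un by blast
    moreover have "?R \<union> (f ` A \<union> D) = UNIV" by auto
    ultimately show False using ordLess_irreflexive by metis
  qed
  then obtain h where h: "inj_on h X" "h ` X \<subseteq> ?R" using card_of_ordLeq by metis
  let ?g = "\<lambda>x. if x \<in> A then f x else h x"
  have "h x \<notin> f ` A \<union> D" if "x \<in> X" for x using h(2) that by blast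
  hence "inj_on ?g X" using h(1) assms(2,3) unfolding inj_on_def
    by (smt (verit) UnI1 image_eqI subsetD)
  moreover have "\<forall>x\<in>X - A. ?g x \<notin> D" using h by auto
  ultimately show ?thesis by (intro exI[of _ ?g]) auto
qed

text \<open>The target is replaced by an isomorphic copy in which each f x with x in A is renamed to
  x. In this way embeddings that merely agree on A can be made to fix A.\<close>

lemma embedding_undo:
  assumes "embedding K0 f M N" "A \<subseteq> univ M"
  obtains g N' where "embedding K0 g N N'" "\<And>x. x \<in> A \<Longrightarrow> g (f x) = x" 
proof -
  have i: "inj_on f (univ M)" "f ` A \<subseteq> univ N" "N \<in> mods K0" "M \<in> mods K0"
    using embedding_univ[OF assms(1)] embedding_inj[OF assms(1)] embedding_mods[OF assms(1)] assms(2) by auto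
  have iA: "inj_on f A" using i(1) assms(2) by (rule inj_on_subset)
  have "|A| <o |UNIV :: 'u set|" using small_subset[OF assms(2) univ_small[OF i(4)]] .
  hence fA: "|f ` A| <o |UNIV :: 'u set|" by (rule small_mono[OF card_of_image])
  obtain g where g: "inj_on g (univ N)" "\<forall>x\<in>f ` A. g x = inv_into A f x"
    using ex_injection_extending[OF univ_small[OF i(3)] i(2) inj_on_inv_into[OF subset_refl] fA, of "{}"]
      small_finite[of "{}::'u set"] by auto
  have "\<And>x. x \<in> A \<Longrightarrow> g (f x) = x" using g(2) iA by simp
  with that[OF embedding_image[OF i(3) g(1)]] show thesis .
qed

text \<open>Up to renaming the target, every embedding is an inclusion. This is how amalgamation,
  stated for inclusions, reaches embeddings.\<close>

lemma embedding_extend: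
  assumes "embedding K0 f M N"
  obtains g N' where "embedding K0 g N N'" "leq K0 M N'" "\<And>x. x \<in> univ M \<Longrightarrow> g (f x) = x"
proof -
  obtain g N' where g: "embedding K0 g N N'" "\<And>x. x \<in> univ M \<Longrightarrow> g (f x) = x"
    using embedding_undo[OF assms subset_refl] by blast
  have "leq K0 (image_struct (voc K0) (g \<circ> f) M) N'"
    using embedding_comp[OF assms g(1)] by (simp add: embedding_iff)
  moreover have "image_struct (voc K0) (g \<circ> f) M = M"
    using g(2) assms mods_struct embedding_mods by (intro image_struct_ident) auto
  ultimately show thesis using that[OF g(1) _ g(2)] by simp
qed

lemma same_mods: "same K0 I b1 N1 b2 N2 \<Longrightarrow> N1 \<in> mods K0" "same K0 I b1 N1 b2 N2 \<Longrightarrow> N2 \<in> mods K0"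
  unfolding same_def using embedding_mods by blast+

lemma same_embedding:
  assumes "embedding K0 f M N" "\<And>i. i \<in> I \<Longrightarrow> c i = f (b i)" shows "same K0 I b M c N"
  using assms embedding_leq[OF leq_refl[OF embedding_mods(2)[OF assms(1)]], of id]
  unfolding same_def by fastforce

lemma same_leq: "leq K0 M N \<Longrightarrow> same K0 I b M b N"
  using same_embedding[OF embedding_leq[of M N id], of I b b] by auto

end

section \<open>Amalgamation and transitivity of \<open>same\<close>\<close>

locale aec_amalg = aec_class U K0 for U :: "'u::wellorder itself" and K0 :: "('s, 'u) aclass" +
  assumes amalgamation: "amalgamation K0"
begin

lemma amalgamate:
  assumes "embedding K0 f1 M M1" "embedding K0 f2 M M2"
  shows "\<exists>N g1 g2. embedding K0 g1 M1 N \<and> embedding K0 g2 M2 N \<and> (\<forall>x\<in>univ M. g1 (f1 x) = g2 (f2 x))"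
proof -
  obtain h1 N1 where 1: "embedding K0 h1 M1 N1" "leq K0 M N1" "\<And>x. x \<in> univ M \<Longrightarrow> h1 (f1 x) = x"
    using embedding_extend[OF assms(1)] by blast
  obtain h2 N2 where 2: "embedding K0 h2 M2 N2" "leq K0 M N2" "\<And>x. x \<in> univ M \<Longrightarrow> h2 (f2 x) = x"
    using embedding_extend[OF assms(2)] by blast
  obtain N k1 k2 where 3: "embedding K0 k1 N1 N" "embedding K0 k2 N2 N" "\<forall>x\<in>univ M. k1 x = x \<and> k2 x = x"
    using amalgamation 1(2) 2(2) unfolding amalgamation_def by blast
  have "\<forall>x\<in>univ M. (k1 \<circ> h1) (f1 x) = (k2 \<circ> h2) (f2 x)" using 1(3) 2(3) 3(3) by simp
  thus ?thesis using embedding_comp[OF 1(1) 3(1)] embedding_comp[OF 2(1) 3(2)] by metis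
qed

text \<open>The two common extensions of the middle model are amalgamated over that model. The
  middle tuple has to lie in N2, since only images of elements of N2 are identified by the
  amalgam.\<close>

lemma same_trans:
  assumes "same K0 I b1 N1 b2 N2" "same K0 I b2 N2 b3 N3" "b2 ` I \<subseteq> univ N2"
  shows "same K0 I b1 N1 b3 N3"
proof -
  obtain P f1 f2 where 1: "embedding K0 f1 N1 P" "embedding K0 f2 N2 P" "\<forall>i\<in>I. f1 (b1 i) = f2 (b2 i)"
    using assms(1) unfolding same_def by blast
  obtain Q g2 g3 where 2: "embedding K0 g2 N2 Q" "embedding K0 g3 N3 Q" "\<forall>i\<in>I. g2 (b2 i) = g3 (b3 i)"
    using assms(2) unfolding same_def by blast
  obtain N h1 h2 where 3: "embedding K0 h1 P N" "embedding K0 h2 Q N" "\<forall>x\<in>univ N2. h1 (f2 x) = h2 (g2 x)"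
    using amalgamate[OF 1(2) 2(1)] by metis
  have "\<forall>i\<in>I. (h1 \<circ> f1) (b1 i) = (h2 \<circ> g3) (b3 i)"
  proof
    fix i assume "i \<in> I"
    hence "b2 i \<in> univ N2" using assms(3) by auto
    thus "(h1 \<circ> f1) (b1 i) = (h2 \<circ> g3) (b3 i)" using 3(3) 1(3) 2(3) \<open>i \<in> I\<close> by simp
  qed
  thus ?thesis unfolding same_def using embedding_comp[OF 1(1) 3(1)] embedding_comp[OF 2(2) 3(2)] by metis
qed

end

subsection \<open>Counting types\<close>

lemma E_at_sym: "sym (E_at K)"
proof (rule symI)
  fix x y assume "(x, y) \<in> E_at K"
  thus "(y, x) \<in> E_at K" unfolding E_at_def by simp metis
qed

text \<open>\<open>Inl i\<close> stands for the i-th entry of a sequence and \<open>Inr e\<close>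
  for the parameter e, as in formulas with parameters. As \<open>asg b\<close> maps
  \<open>Inr e\<close> to e, \<open>same\<close> on this set makes the two embeddings agree on
  A.\<close>

definition idx :: "'u set \<Rightarrow> 'u set \<Rightarrow> ('u + 'u) set" where
  "idx I A = Inl ` I \<union> Inr ` A"

lemma asg_simps [simp]: "asg c (Inl i) = the (c i)" "asg c (Inr e) = e"
  by (simp_all add: asg_def)

lemma asg_idx: "ran b \<subseteq> X \<Longrightarrow> A \<subseteq> X \<Longrightarrow> asg b ` idx (dom b) A \<subseteq> X"
  by (force simp: idx_def ran_def)

lemma the_mapseq: "i \<in> dom b \<Longrightarrow> the (mapseq f b i) = f (the (b i))"
  by (auto simp: mapseq_def)

context aec_amalg begin

text \<open>From right to left, the given embeddings agree on A without fixing it; undoing the first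
  one on A makes both compositions the identity there.\<close>

lemma E_at_iff:
  "((b1, A, N1), (b2, A', N2)) \<in> E_at K0 \<longleftrightarrow>
     A = A' \<and> A \<subseteq> univ N1 \<and> A \<subseteq> univ N2 \<and> ran b1 \<subseteq> univ N1 \<and> ran b2 \<subseteq> univ N2 \<and>
     dom b1 = dom b2 \<and> same K0 (idx (dom b1) A) (asg b1) N1 (asg b2) N2"
  (is "?L \<longleftrightarrow> ?R")
proof
  assume ?L
  then obtain N f1 f2 where *: "A = A'" "A \<subseteq> univ N1" "A \<subseteq> univ N2" "ran b1 \<subseteq> univ N1" "ran b2 \<subseteq> univ N2"
    "embedding K0 f1 N1 N" "embedding K0 f2 N2 N" "\<forall>x\<in>A. f1 x = x \<and> f2 x = x" "mapseq f1 b1 = mapseq f2 b2"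
    unfolding E_at_def by auto
  have d: "dom b1 = dom b2" using *(9) dom_mapseq by metis
  have "f1 (the (b1 i)) = f2 (the (b2 i))" if "i \<in> dom b1" for i
    using the_mapseq[of i b1 f1] the_mapseq[of i b2 f2] that d *(9) by simp
  hence "\<forall>i\<in>idx (dom b1) A. f1 (asg b1 i) = f2 (asg b2 i)" using *(8) by (force simp: idx_def)
  thus ?R using * d unfolding same_def by metis
next
  assume R: ?R
  then obtain N f1 f2 where *: "embedding K0 f1 N1 N" "embedding K0 f2 N2 N"
    "\<forall>i\<in>idx (dom b1) A. f1 (asg b1 i) = f2 (asg b2 i)" unfolding same_def by metis
  have A: "A \<subseteq> univ N1" using R by blast
  obtain g N' where g: "embedding K0 g N N'" "\<And>x. x \<in> A \<Longrightarrow> g (f1 x) = x"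
    using embedding_undo[OF *(1) A] by metis
  have "f1 x = f2 x" if "x \<in> A" for x using *(3)[rule_format, of "Inr x"] that by (simp add: idx_def)
  hence fix': "\<forall>x\<in>A. (g \<circ> f1) x = x \<and> (g \<circ> f2) x = x" using g(2) by simp
  have "mapseq (g \<circ> f1) b1 i = mapseq (g \<circ> f2) b2 i" for i
  proof (cases "i \<in> dom b1")
    case True
    then obtain x y where "b1 i = Some x" "b2 i = Some y" using R by blast
    moreover have "f1 (asg b1 (Inl i)) = f2 (asg b2 (Inl i))" using *(3) True unfolding idx_def by blast
    ultimately show ?thesis by (simp add: mapseq_def)
  next
    case False
    hence "b1 i = None" "b2 i = None" using R by auto
    thus ?thesis by (simp add: mapseq_def)
  qed
  hence "mapseq (g \<circ> f1) b1 = mapseq (g \<circ> f2) b2" by blast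
  hence "\<exists>N f1 f2. embedding K0 f1 N1 N \<and> embedding K0 f2 N2 N \<and>
           (\<forall>x \<in> A. f1 x = x \<and> f2 x = x) \<and> mapseq f1 b1 = mapseq f2 b2"
    using embedding_comp[OF *(1) g(1)] embedding_comp[OF *(2) g(1)] fix' by metis
  moreover have r: "A' = A" "A \<subseteq> univ N1" "A \<subseteq> univ N2" "ran b1 \<subseteq> univ N1" "ran b2 \<subseteq> univ N2"
    using R by (elim conjE; simp)+
  ultimately show ?L unfolding E_at_def r(1) by simp
qed

lemma E_at_trans: "trans (E_at K0)"
proof (rule transI)
  fix x y z assume xy: "(x, y) \<in> E_at K0" and yz: "(y, z) \<in> E_at K0"
  obtain b1 A1 N1 b2 A2 N2 b3 A3 N3 where [simp]: "x = (b1, A1, N1)" "y = (b2, A2, N2)" "z = (b3, A3, N3)"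
    by (metis prod_cases3)
  have 1: "A1 = A2" "A1 \<subseteq> univ N1" "A2 \<subseteq> univ N2" "ran b1 \<subseteq> univ N1" "ran b2 \<subseteq> univ N2" "dom b1 = dom b2"
    "same K0 (idx (dom b1) A1) (asg b1) N1 (asg b2) N2" using xy by (auto simp: E_at_iff)
  have 2: "A2 = A3" "A3 \<subseteq> univ N3" "ran b3 \<subseteq> univ N3" "dom b2 = dom b3"
    "same K0 (idx (dom b2) A2) (asg b2) N2 (asg b3) N3" using yz by (auto simp: E_at_iff)
  have "same K0 (idx (dom b1) A1) (asg b1) N1 (asg b3) N3"
    using same_trans[OF 1(7)] 2(5) asg_idx[OF 1(5,3)] 1(1,6) by simp
  thus "(x, z) \<in> E_at K0" using 1 2 by (simp add: E_at_iff)
qed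

text \<open>Amalgamation makes \<open>E_at K0\<close> transitive, so passing to the transitive
  closure adds nothing.\<close>

lemma gtp_K0: "gtp K0 b A N = E_at K0 `` {(b, A, N)}"
  unfolding gtp_def by (simp add: trancl_id E_at_trans)

lemma same_refl: "N \<in> mods K0 \<Longrightarrow> same K0 I b N b N"
  using same_leq leq_refl by blast

lemma E_at_refl:
  "N \<in> mods K0 \<Longrightarrow> A \<subseteq> univ N \<Longrightarrow> ran b \<subseteq> univ N \<Longrightarrow> ((b, A, N), (b, A, N)) \<in> E_at K0"
  by (simp add: E_at_iff same_refl)

lemma gtp_eq_iff:
  assumes "N1 \<in> mods K0" "A \<subseteq> univ N1" "ran b1 \<subseteq> univ N1" "N2 \<in> mods K0" "A \<subseteq> univ N2" "ran b2 \<subseteq> univ N2"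
  shows "gtp K0 b1 A N1 = gtp K0 b2 A N2 \<longleftrightarrow>
    dom b1 = dom b2 \<and> same K0 (idx (dom b1) A) (asg b1) N1 (asg b2) N2"
proof
  assume "gtp K0 b1 A N1 = gtp K0 b2 A N2"
  hence "((b1, A, N1), (b2, A, N2)) \<in> E_at K0" using E_at_refl[OF assms(4-6)] by (auto simp: gtp_K0)
  thus "dom b1 = dom b2 \<and> same K0 (idx (dom b1) A) (asg b1) N1 (asg b2) N2" unfolding E_at_iff by metis
next
  assume "dom b1 = dom b2 \<and> same K0 (idx (dom b1) A) (asg b1) N1 (asg b2) N2"
  hence *: "((b1, A, N1), (b2, A, N2)) \<in> E_at K0" using assms unfolding E_at_iff by metis
  hence "((b2, A, N2), (b1, A, N1)) \<in> E_at K0" using E_at_sym by (metis symD)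
  with * show "gtp K0 b1 A N1 = gtp K0 b2 A N2" unfolding gtp_K0 using E_at_trans
    by (auto dest: transD)
qed

end

section \<open>The Loewenheim-Skolem number and codes for types\<close>

context aec_class begin

abbreviation ls :: "'u set" where "ls \<equiv> {..<LS K0}"

lemma LS_property_LS: "LS_property K0 (LS K0)"
  unfolding LS_def using ex_LS by (rule LeastI_ex)

lemma infinite_ls: "infinite ls"
proof -
  have "natLeq \<le>o |dom (rel_ar (voc K0)) <+> dom (fun_ar (voc K0))| +c natLeq"
    by (rule ordLeq_csum2) (rule natLeq_Card_order)
  moreover have "|dom (rel_ar (voc K0)) <+> dom (fun_ar (voc K0))| +c natLeq \<le>o |ls|"
    using LS_property_LS unfolding LS_property_def by blast
  ultimately have "natLeq \<le>o |ls|" by (rule ordLeq_transitive)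
  thus ?thesis using infinite_iff_natLeq_ordLeq by blast
qed

lemma card_voc: "|dom (rel_ar (voc K0))| \<le>o |ls|" "|dom (fun_ar (voc K0))| \<le>o |ls|"
proof -
  let ?P = "dom (rel_ar (voc K0)) <+> dom (fun_ar (voc K0))"
  have "|?P| +c natLeq \<le>o |ls|" using LS_property_LS unfolding LS_property_def by blast
  moreover have "|?P| \<le>o |?P| +c natLeq" by (rule ordLeq_csum1) (rule card_of_Card_order)
  ultimately have P: "|?P| \<le>o |ls|" using ordLeq_transitive by metis
  show "|dom (rel_ar (voc K0))| \<le>o |ls|" by (rule ordLeq_transitive[OF card_of_Plus1 P])
  show "|dom (fun_ar (voc K0))| \<le>o |ls|" by (rule ordLeq_transitive[OF card_of_Plus2 P])
qed

lemma downward_LS: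
  fixes X :: "'x set"
  assumes "M \<in> mods K0" "A \<subseteq> univ M" "|A| \<le>o |X|" "|ls| \<le>o |X|"
  shows "\<exists>M0. leq K0 M0 M \<and> A \<subseteq> univ M0 \<and> |univ M0| \<le>o |X|"
proof -
  obtain M0 where M0: "leq K0 M0 M" "A \<subseteq> univ M0" "|univ M0| \<le>o |A| +c |ls|"
    using LS_property_LS assms(1,2) unfolding LS_property_def by blast
  have "infinite X" using infinite_ls card_of_ordLeq_infinite[OF assms(4)] by blast
  hence "|A| +c |ls| \<le>o |X|"
    by (intro csum_cinfinite_bound assms Cinfinite_card_of card_of_Card_order)
  hence "|univ M0| \<le>o |X|" using M0(3) ordLeq_transitive by metis
  thus ?thesis using M0 by blast
qed

lemma card_Func_finite:
  fixes F :: "'f set"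
  assumes "finite F" "infinite X" shows "|Func F X| \<le>o |X|"
  using assms(1)
proof induction
  case empty
  have "Func ({} :: 'f set) X = {\<lambda>_. undefined}" by (auto simp: Func_def)
  hence "finite (Func ({} :: 'f set) X)" by simp
  thus ?case by (intro ordLess_imp_ordLeq card_finite_less assms(2))
next
  case (insert a F)
  have "|Func (insert a F) X| \<le>o |Func F X \<times> X|"
  proof (rule card_of_ordLeqI)
    show "inj_on (\<lambda>f. (f(a := undefined), f a)) (Func (insert a F) X)"
    proof (rule inj_onI)
      fix f g assume "(f(a := undefined), f a) = (g(a := undefined), g a)"
      thus "f = g" by (metis Pair_inject fun_upd_triv fun_upd_upd)
    qed
  qed (use insert in \<open>auto simp: Func_def\<close>)
  moreover have "|Func F X \<times> X| \<le>o |X|"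
    by (rule card_Times_leq[OF assms(2) insert.IH card_of_mono1[OF subset_refl]])
  ultimately show ?case using ordLeq_transitive by metis
qed

lemma card_seqs: "|seqs \<gamma> X| \<le>o |Func {..<\<gamma>} X|"
proof (rule card_of_ordLeqI)
  show "inj_on (\<lambda>b i. if i < \<gamma> then the (b i) else undefined) (seqs \<gamma> X)"
  proof (rule inj_onI)
    fix b c assume b: "b \<in> seqs \<gamma> X" and c: "c \<in> seqs \<gamma> X"
      and e: "(\<lambda>i. if i < \<gamma> then the (b i) else undefined) = (\<lambda>i. if i < \<gamma> then the (c i) else undefined)"
    show "b = c"
    proof
      fix i show "b i = c i"
      proof (cases "i < \<gamma>")
        case True
        hence "the (b i) = the (c i)" using fun_cong[OF e, of i] by simp
        moreover have "i \<in> dom b" "i \<in> dom c" using b c True by (auto simp: seqs_def)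
        ultimately show ?thesis by auto
      next
        case False
        hence "i \<notin> dom b" "i \<notin> dom c" using b c by (auto simp: seqs_def)
        thus ?thesis by (simp add: domIff)
      qed
    qed
  qed
next
  fix b assume b: "b \<in> seqs \<gamma> X"
  have "the (b i) \<in> X" if "i < \<gamma>" for i
  proof -
    have "i \<in> dom b" using b that by (simp add: seqs_def)
    then obtain x where "b i = Some x" by blast
    thus ?thesis using b by (auto simp: seqs_def intro: ranI)
  qed
  thus "(\<lambda>i. if i < \<gamma> then the (b i) else undefined) \<in> Func {..<\<gamma>} X" by (auto simp: Func_def)
qed

lemma card_tuples:
  assumes "ar = rel_ar (voc K0) \<or> ar = fun_ar (voc K0)" "infinite X"
  shows "|tuples ar s X| \<le>o |X|"
proof (cases "ar s")
  case None
  thus ?thesis by (simp add: tuples_def card_of_empty)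
next
  case (Some n)
  hence "finite {..<n}" using assms(1) aec[unfolded aec_def, THEN conjunct1] by (auto intro: ranI)
  hence "|Func {..<n} X| \<le>o |X|" using card_Func_finite assms(2) by blast
  thus ?thesis using Some ordLeq_transitive[OF card_seqs] by (simp add: tuples_def)
qed

definition structs_on :: "'u set \<Rightarrow> ('s, 'u) struct set" where
  "structs_on X = {M. is_struct (voc K0) M \<and> univ M \<subseteq> X}"

text \<open>A structure is coded by its universe, the disjoint sum of its relations and the graph of
  its functions. Arities are finite and there are at most \<open>LS K0\<close> symbols, so all three
  are subsets of sets of size at most |X|.\<close>

lemma card_structs_on:
  assumes "|ls| \<le>o |X|" shows "|structs_on X| \<le>o |Pow X|"
proof -
  let ?V = "voc K0"
  let ?S1 = "dom (rel_ar ?V)" and ?S2 = "dom (fun_ar ?V)"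
  have X: "infinite X" using infinite_ls card_of_ordLeq_infinite[OF assms] by blast
  let ?T1 = "SIGMA s:?S1. tuples (rel_ar ?V) s X" and ?T2 = "(SIGMA s:?S2. tuples (fun_ar ?V) s X) \<times> X"
  let ?c = "\<lambda>M. (univ M, SIGMA s:?S1. rel M s,
     {((s, xs), func M s xs) |s xs. s \<in> ?S2 \<and> xs \<in> tuples (fun_ar ?V) s (univ M)})"
  have "|structs_on X| \<le>o |Pow X \<times> Pow ?T1 \<times> Pow ?T2|"
  proof (rule card_of_ordLeqI)
    show "inj_on ?c (structs_on X)"
    proof (rule inj_onI)
      fix M N assume M: "M \<in> structs_on X" and N: "N \<in> structs_on X" and e: "?c M = ?c N"
      note e' = e[unfolded prod.inject]
      have u: "univ M = univ N" using e'[THEN conjunct1] .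
      have r: "(SIGMA s:?S1. rel M s) = (SIGMA s:?S1. rel N s)"
        using e'[THEN conjunct2, THEN conjunct1] .
      have f: "{((s, xs), func M s xs) |s xs. s \<in> ?S2 \<and> xs \<in> tuples (fun_ar ?V) s (univ M)} =
         {((s, xs), func N s xs) |s xs. s \<in> ?S2 \<and> xs \<in> tuples (fun_ar ?V) s (univ N)}"
        using e'[THEN conjunct2, THEN conjunct2] .
      have "rel M s = rel N s" for s
      proof (cases "s \<in> ?S1")
        case True
        have "rel M s = (SIGMA s:?S1. rel M s) `` {s}" "rel N s = (SIGMA s:?S1. rel N s) `` {s}"
          using True by auto
        thus ?thesis using r by simp
      next
        case False
        hence "tuples (rel_ar ?V) s Y = {}" for Y :: "'u set" by (simp add: tuples_def domIff)
        thus ?thesis using M N unfolding structs_on_def is_struct_def by blast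
      qed
      moreover have "func M s = func N s" for s
      proof (rule extensionalityI[of _ "tuples (fun_ar ?V) s (univ M)"])
        show "func M s \<in> extensional (tuples (fun_ar ?V) s (univ M))"
          using M by (auto simp: structs_on_def is_struct_def PiE_def)
        show "func N s \<in> extensional (tuples (fun_ar ?V) s (univ M))"
          using N unfolding u by (auto simp: structs_on_def is_struct_def PiE_def)
        fix xs assume xs: "xs \<in> tuples (fun_ar ?V) s (univ M)"
        hence "s \<in> ?S2" by (auto simp: tuples_def split: option.splits)
        hence "((s, xs), func M s xs) \<in> {((s, xs), func M s xs) |s xs. s \<in> ?S2 \<and> xs \<in> tuples (fun_ar ?V) s (univ M)}"
          using xs by blast
        thus "func M s xs = func N s xs" unfolding f by blast
      qed
      ultimately show "M = N" using u by (intro struct.equality) auto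
    qed
  next
    fix M assume "M \<in> structs_on X"
    hence u: "univ M \<subseteq> X" and r: "\<And>s. rel M s \<subseteq> tuples (rel_ar ?V) s (univ M)"
      and f: "\<And>s xs. xs \<in> tuples (fun_ar ?V) s (univ M) \<Longrightarrow> func M s xs \<in> univ M"
      by (auto simp: structs_on_def is_struct_def PiE_def)
    have t: "tuples ar s (univ M) \<subseteq> tuples ar s X" for ar :: "'s \<rightharpoonup> 'u" and s using u by (rule tuples_mono)
    have "(SIGMA s:?S1. rel M s) \<subseteq> ?T1" using r t by (intro Sigma_mono) blast+
    moreover have "{((s, xs), func M s xs) |s xs. s \<in> ?S2 \<and> xs \<in> tuples (fun_ar ?V) s (univ M)} \<subseteq> ?T2"
    proof
      fix y assume "y \<in> {((s, xs), func M s xs) |s xs. s \<in> ?S2 \<and> xs \<in> tuples (fun_ar ?V) s (univ M)}"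
      then obtain s xs where y: "y = ((s, xs), func M s xs)" "s \<in> ?S2" and a: "xs \<in> tuples (fun_ar ?V) s (univ M)"
        by blast
      show "y \<in> ?T2" using y subsetD[OF t a] subsetD[OF u f[OF a]] by simp
    qed
    ultimately show "?c M \<in> Pow X \<times> Pow ?T1 \<times> Pow ?T2" using u by simp
  qed
  moreover have "|Pow X \<times> Pow ?T1 \<times> Pow ?T2| \<le>o |Pow X|"
  proof -
    have P: "infinite (Pow X)" using X by simp
    have S: "|?S1| \<le>o |X|" "|?S2| \<le>o |X|"
      using ordLeq_transitive[OF card_voc(1) assms] ordLeq_transitive[OF card_voc(2) assms] by auto
    have "|?T1| \<le>o |X|"
      by (rule card_of_Sigma_ordLeq_infinite[OF X S(1)], rule ballI, rule card_tuples[OF _ X]) simp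
    hence 1: "|Pow ?T1| \<le>o |Pow X|" by (rule card_Pow_mono)
    have "|SIGMA s:?S2. tuples (fun_ar ?V) s X| \<le>o |X|"
      by (rule card_of_Sigma_ordLeq_infinite[OF X S(2)], rule ballI, rule card_tuples[OF _ X]) simp
    hence "|?T2| \<le>o |X|" by (rule card_Times_leq[OF X _ card_of_mono1[OF subset_refl]])
    hence 2: "|Pow ?T2| \<le>o |Pow X|" by (rule card_Pow_mono)
    show ?thesis
      using card_Times_leq[OF P card_of_mono1[OF subset_refl] card_Times_leq[OF P 1 2]] .
  qed
  ultimately show ?thesis using ordLeq_transitive by metis
qed

text \<open>These are the codes for Galois types of I-tuples. Types range over all models, but the
  codes on a fixed X form a set of bounded size. \<open>Func\<close> makes the tuple undefined off
  I, so that irrelevant values do not inflate the count.\<close>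

definition reps :: "'i set \<Rightarrow> 'u set \<Rightarrow> (('i \<Rightarrow> 'u) \<times> ('s, 'u) struct) set" where
  "reps I X = {(b, N). N \<in> mods K0 \<and> univ N \<subseteq> X \<and> b \<in> Func I X \<and> b ` I \<subseteq> univ N}"

lemma card_reps:
  assumes "|ls| \<le>o |X|" "|I| \<le>o |X|" shows "|reps I X| \<le>o |Pow X|"
proof -
  have X: "infinite X" using infinite_ls card_of_ordLeq_infinite[OF assms(1)] by blast
  hence P: "infinite (Pow X)" by simp
  have "|I \<times> X| \<le>o |X|" by (rule card_Times_leq[OF X assms(2) card_of_mono1[OF subset_refl]])
  hence "|Pow (I \<times> X)| \<le>o |Pow X|" by (rule card_Pow_mono)
  hence "|Func I X| \<le>o |Pow X|" by (rule ordLeq_transitive[OF card_Func_Pow])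
  hence "|Func I X \<times> structs_on X| \<le>o |Pow X|" by (rule card_Times_leq[OF P _ card_structs_on[OF assms(1)]])
  moreover have "reps I X \<subseteq> Func I X \<times> structs_on X"
    unfolding reps_def structs_on_def using mods_struct by auto
  ultimately show ?thesis by (metis ordLeq_transitive card_of_mono1)
qed

end

context aec_amalg begin

text \<open>A strong submodel of size at most |X| around the tuple gives it the same type, and can
  be renamed into X.\<close>

lemma ex_rep:
  assumes "|ls| \<le>o |X|" "|I| \<le>o |X|" "N \<in> mods K0" "b ` I \<subseteq> univ N"
  shows "\<exists>(b', N') \<in> reps I X. same K0 I b N b' N'"
proof -
  have "|b ` I| \<le>o |X|" by (rule ordLeq_transitive[OF card_of_image assms(2)])
  then obtain N0 where N0: "leq K0 N0 N" "b ` I \<subseteq> univ N0" "|univ N0| \<le>o |X|"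
    using downward_LS[OF assms(3,4) _ assms(1)] by blast
  then obtain g where g: "inj_on g (univ N0)" "g ` univ N0 \<subseteq> X" using card_of_ordLeq by metis
  have e: "embedding K0 g N0 (image_struct (voc K0) g N0)"
    using embedding_image[OF leq_mods(1)[OF N0(1)] g(1)] .
  let ?b = "\<lambda>i. if i \<in> I then g (b i) else undefined"
  have "same K0 I b N0 ?b (image_struct (voc K0) g N0)" by (rule same_embedding[OF e]) simp
  hence s: "same K0 I b N ?b (image_struct (voc K0) g N0)"
    using same_trans[OF same_sym[OF same_leq[OF N0(1)]]] N0(2) by blast
  have bg: "g (b i) \<in> X \<and> g (b i) \<in> g ` univ N0" if "i \<in> I" for i using N0(2) g(2) that by auto
  have "(?b, image_struct (voc K0) g N0) \<in> reps I X"
    unfolding reps_def Func_def using embedding_mods(2)[OF e] g(2) bg by auto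
  thus ?thesis using s by blast
qed

text \<open>At zero M itself is a bound, at a limit the union of the chain, and at a successor the
  last stage.\<close>

lemma chain_upper_bound:
  fixes i :: 'u
  assumes "M \<in> mods K0" "\<And>j k. j < k \<Longrightarrow> k < i \<Longrightarrow> leq K0 (f j) (f k)" "\<And>j. j < i \<Longrightarrow> leq K0 M (f j)"
  shows "\<exists>Q. leq K0 M Q \<and> (\<forall>j<i. leq K0 (f j) Q)"
proof -
  consider "{..<i} = {}" | "limit_ordinal i" | j where "j < i" "\<And>k. k < i \<Longrightarrow> k \<le> j"
    unfolding limit_ordinal_def by (metis not_less)
  thus ?thesis
  proof cases
    case 1
    thus ?thesis using leq_refl[OF assms(1)] by auto
  next
    case 2
    obtain W where W: "\<And>j. j < i \<Longrightarrow> leq K0 (f j) W"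
      using chain_union[OF 2, of f] assms(2) by metis
    obtain j where "j < i" using 2 unfolding limit_ordinal_def by auto
    thus ?thesis using W leq_trans[OF assms(3)] by metis
  next
    case (3 j)
    have "leq K0 (f k) (f j)" if "k < i" for k
      using 3(2)[OF that] assms(2)[of k j] 3(1) leq_refl[OF leq_mods(2)[OF assms(3)[OF 3(1)]]] by (cases "k = j") auto
    thus ?thesis using assms(3)[OF 3(1)] by metis
  qed
qed

text \<open>Q is an upper bound of all stages before i, and S is a task about Q that stage i
  accomplishes. Keeping Q in the statement lets a task refer to everything built before.\<close>

lemma ex_chain:
  assumes "M \<in> mods K0" "\<And>(i::'u) Q. leq K0 M Q \<Longrightarrow> \<exists>R. leq K0 Q R \<and> S i Q R"
  shows "\<exists>f. \<forall>i. leq K0 M (f i) \<and> (\<forall>j<i. leq K0 (f j) (f i)) \<and>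
    (\<exists>Q. leq K0 M Q \<and> (\<forall>j<i. leq K0 (f j) Q) \<and> leq K0 Q (f i) \<and> S i Q (f i))"
proof -
  let ?P = "\<lambda>f i r. \<exists>Q. leq K0 M Q \<and> (\<forall>j<i. leq K0 (f j) Q) \<and> leq K0 Q r \<and> S i Q r"
  have "\<exists>f. \<forall>i. ?P f i (f i)"
  proof (rule dependent_wellorder_choice)
    fix r and f g :: "'u \<Rightarrow> ('s, 'u) struct" and i :: 'u assume "\<And>j. j < i \<Longrightarrow> f j = g j"
    thus "?P f i r = ?P g i r" by auto
  next
    fix i :: 'u and f :: "'u \<Rightarrow> ('s, 'u) struct" assume *: "\<And>j. j < i \<Longrightarrow> ?P f j (f j)"
    have 1: "leq K0 (f j) (f k)" if "j < k" "k < i" for j k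
      using *[OF that(2)] that(1) leq_trans by metis
    have 2: "leq K0 M (f j)" if "j < i" for j using *[OF that] leq_trans by metis
    obtain Q where "leq K0 M Q" "\<forall>j<i. leq K0 (f j) Q"
      using chain_upper_bound[of M i f] assms(1) 1 2 by metis
    thus "\<exists>r. ?P f i r" using assms(2)[of Q i] by metis
  qed
  then obtain f where f: "\<forall>i. ?P f i (f i)" by metis
  have "leq K0 M (f i) \<and> (\<forall>j<i. leq K0 (f j) (f i))" for i using f leq_trans by metis
  thus ?thesis using f by (intro exI[of _ f]) simp
qed

text \<open>P and Q are amalgamated over M and the result is renamed so as to extend Q. A type
  realized in P can then be realized in an extension of Q.\<close>

lemma extend_over:
  assumes "leq K0 M P" "leq K0 M Q"
  shows "\<exists>R g. leq K0 Q R \<and> embedding K0 g P R \<and> (\<forall>x\<in>univ M. g x = x)"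
proof -
  have e: "embedding K0 id M P" "embedding K0 id M Q" using assms embedding_leq[of M P id] embedding_leq[of M Q id] by auto
  obtain N g1 g2 where g: "embedding K0 g1 P N" "embedding K0 g2 Q N" "\<forall>x\<in>univ M. g1 (id x) = g2 (id x)"
    using amalgamate[OF e] by metis
  obtain h R where h: "embedding K0 h N R" "leq K0 Q R" "\<And>x. x \<in> univ Q \<Longrightarrow> h (g2 x) = x"
    using embedding_extend[OF g(2)] by metis
  have "\<forall>x\<in>univ M. (h \<circ> g1) x = x" using g(3) h(3) leq_univ[OF assms(2)] by auto
  thus ?thesis using h(2) embedding_comp[OF g(1) h(1)] by metis
qed

end

subsection \<open>Saturated extensions\<close>

context aec_amalg begin

text \<open>Every type over a small subset of \<open>M\<close> is coded by an element of \<open>reps\<close>, so only a set of types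
  has to be realized, one at each stage of a chain.\<close>

lemma realize_all_types:
  fixes \<kappa> :: 'u
  assumes M: "M \<in> mods K0" and LS: "|ls| \<le>o |{..<\<kappa>}|"
  shows "\<exists>M'. leq K0 M M' \<and> (\<forall>P A \<gamma> b. leq K0 M P \<and> A \<subseteq> univ M \<and> |A| \<le>o |{..<\<kappa>}| \<and> \<gamma> < \<kappa> \<and> b \<in> seqs \<gamma> (univ P) \<longrightarrow>
     (\<exists>c \<in> seqs \<gamma> (univ M'). same K0 (idx {..<\<gamma>} A) (asg c) M' (asg b) P))"
proof -
  let ?X = "{..<\<kappa>}"
  have infX: "infinite ?X" using card_of_ordLeq_infinite[OF LS infinite_ls] .
  \<comment> \<open>A problem is a length, a parameter set and a code of a type. The codes live on
    \<open>{..<\<kappa>}\<close>, which is large enough for all index sets in question, so the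
    problems form a small set and can be enumerated by an ordinal \<delta>.\<close>
  define Prob where "Prob = (SIGMA \<gamma>:{..<\<kappa>}. SIGMA A:{A \<in> Pow (univ M). |A| \<le>o |{..<\<kappa>}| }. reps (idx {..<\<gamma>} A) ?X)"
  have idx_le: "|idx {..<\<gamma>} A| \<le>o |?X|" if "\<gamma> < \<kappa>" "|A| \<le>o |?X|" for \<gamma> A
    unfolding idx_def
  proof (rule card_Un_leq[OF infX])
    show "|Inl ` {..<\<gamma>}| \<le>o |?X|"
      using ordLeq_transitive[OF card_of_image card_of_lessThan_mono] that(1) by (metis order_less_imp_le)
    show "|Inr ` A| \<le>o |?X|" by (rule ordLeq_transitive[OF card_of_image that(2)])
  qed
  have "|Prob| <o |UNIV :: 'u set|"
    unfolding Prob_def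
  proof (intro small_Sigma)
    show "|{..<\<kappa>}| <o |UNIV :: 'u set|" by (rule small_lessThan)
    fix \<gamma> assume g: "\<gamma> \<in> {..<\<kappa>}"
    have "|Pow (univ M)| <o |UNIV :: 'u set|" by (rule small_Pow[OF univ_small[OF M]])
    thus "|{A \<in> Pow (univ M). |A| \<le>o |{..<\<kappa>}| }| <o |UNIV :: 'u set|"
      by (rule small_subset[rotated]) auto
    fix A assume A: "A \<in> {A \<in> Pow (univ M). |A| \<le>o |{..<\<kappa>}| }"
    have "|reps (idx {..<\<gamma>} A) ?X| \<le>o |Pow ?X|" using card_reps[OF LS idx_le] g A by simp
    thus "|reps (idx {..<\<gamma>} A) ?X| <o |UNIV :: 'u set|"
      by (rule small_mono) (rule small_Pow[OF small_lessThan])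
  qed
  then obtain \<delta> :: 'u where "|{..<\<delta>}| =o |Prob|" using small_ordinal by blast
  then obtain h where h: "bij_betw h {..<\<delta>} Prob" using card_of_ordIso by metis
  \<comment> \<open>Not every code describes a type realized in an extension of M; a code that does
    not counts as solved.\<close>
  define solved where "solved R p \<longleftrightarrow> (case p of (\<gamma>, A, b', N') \<Rightarrow>
     (\<exists>P b. leq K0 M P \<and> b \<in> seqs \<gamma> (univ P) \<and> same K0 (idx {..<\<gamma>} A) (asg b) P b' N') \<longrightarrow>
     (\<exists>c. c \<in> seqs \<gamma> (univ R) \<and> same K0 (idx {..<\<gamma>} A) (asg c) R b' N'))" for R p
  have step: "\<exists>R. leq K0 Q R \<and> (i < \<delta> \<longrightarrow> solved R (h i))" if Q: "leq K0 M Q" for i Q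
  proof (cases "i < \<delta>")
    case False
    thus ?thesis using leq_refl[OF leq_mods(2)[OF Q]] by blast
  next
    case True
    obtain \<gamma> A b' N' where p: "h i = (\<gamma>, A, b', N')" by (metis prod_cases4)
    have "h i \<in> Prob" using h True by (auto simp: bij_betw_def)
    hence A: "A \<subseteq> univ M" using p by (auto simp: Prob_def)
    show ?thesis
    proof (cases "\<exists>P b. leq K0 M P \<and> b \<in> seqs \<gamma> (univ P) \<and> same K0 (idx {..<\<gamma>} A) (asg b) P b' N'")
      case False
      hence "solved Q (h i)" unfolding solved_def p prod.case by blast
      thus ?thesis using leq_refl[OF leq_mods(2)[OF Q]] by blast
    next
      case True
      then obtain P b where b: "leq K0 M P" "b \<in> seqs \<gamma> (univ P)" "same K0 (idx {..<\<gamma>} A) (asg b) P b' N'" by blast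
      obtain R g where R: "leq K0 Q R" "embedding K0 g P R" "\<forall>x\<in>univ M. g x = x"
        using extend_over[OF b(1) Q] by metis
      have d: "dom b = {..<\<gamma>}" "ran b \<subseteq> univ P" using b(2) by (auto simp: seqs_def)
      have c: "mapseq g b \<in> seqs \<gamma> (univ R)" using mapseq_seqs[OF b(2) embedding_univ[OF R(2)]] .
      have eq: "asg (mapseq g b) i = g (asg b i)" if "i \<in> idx {..<\<gamma>} A" for i
        using that A R(3) the_mapseq[of _ b g] d(1) by (auto simp: idx_def)
      have Ap: "A \<subseteq> univ P" using A leq_univ[OF b(1)] by blast
      have "same K0 (idx {..<\<gamma>} A) (asg b) P (asg (mapseq g b)) R"
        by (rule same_embedding[OF R(2) eq])
      hence "same K0 (idx {..<\<gamma>} A) (asg (mapseq g b)) R b' N'"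
        using same_trans[OF same_sym b(3)] asg_idx[OF d(2) Ap] d(1) by simp
      hence "solved R (h i)" using c by (auto simp: solved_def p)
      thus ?thesis using R(1) by blast
    qed
  qed
  obtain f where f: "\<forall>i. leq K0 M (f i) \<and> (\<forall>j<i. leq K0 (f j) (f i)) \<and>
    (\<exists>Q. leq K0 M Q \<and> (\<forall>j<i. leq K0 (f j) Q) \<and> leq K0 Q (f i) \<and> (i < \<delta> \<longrightarrow> solved (f i) (h i)))"
    using ex_chain[OF M, of "\<lambda>i Q R. i < \<delta> \<longrightarrow> solved R (h i)"] step by metis
  let ?M = "f \<delta>"
  have "\<exists>c \<in> seqs \<gamma> (univ ?M). same K0 (idx {..<\<gamma>} A) (asg c) ?M (asg b) P"
    if P: "leq K0 M P" and A: "A \<subseteq> univ M" "|A| \<le>o |{..<\<kappa>}|" and g: "\<gamma> < \<kappa>" and b: "b \<in> seqs \<gamma> (univ P)" for P A \<gamma> b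
  proof -
    let ?I = "idx {..<\<gamma>} A"
    have d: "dom b = {..<\<gamma>}" "ran b \<subseteq> univ P" using b by (auto simp: seqs_def)
    have Ap: "A \<subseteq> univ P" using A(1) leq_univ[OF P] by blast
    have bi: "asg b ` ?I \<subseteq> univ P" using asg_idx[OF d(2) Ap] d(1) by simp
    obtain b' N' where rep: "(b', N') \<in> reps ?I ?X" "same K0 ?I (asg b) P b' N'"
      using ex_rep[OF LS idx_le[OF g A(2)] leq_mods(2)[OF P] bi] by blast
    have "(\<gamma>, A, b', N') \<in> Prob" using rep A g by (simp add: Prob_def)
    then obtain i where i: "i < \<delta>" "h i = (\<gamma>, A, b', N')"
      using bij_betw_imp_surj_on[OF h] by (metis imageE lessThan_iff)
    hence "solved (f i) (\<gamma>, A, b', N')" using f by metis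
    then obtain c where c: "c \<in> seqs \<gamma> (univ (f i))" "same K0 ?I (asg c) (f i) b' N'"
      using P b rep(2) by (auto simp: solved_def)
    have fi: "leq K0 (f i) ?M" using f i(1) by blast
    have dc: "dom c = {..<\<gamma>}" "ran c \<subseteq> univ (f i)" using c by (auto simp: seqs_def)
    have Ac: "A \<subseteq> univ (f i)" using A(1) leq_univ f by blast
    have ci: "asg c ` ?I \<subseteq> univ (f i)" using asg_idx[OF dc(2) Ac] dc(1) by simp
    have "b' ` ?I \<subseteq> univ N'" using rep(1) by (simp add: reps_def)
    hence "same K0 ?I (asg c) (f i) (asg b) P" using same_trans[OF c(2) same_sym[OF rep(2)]] by blast
    hence "same K0 ?I (asg c) ?M (asg b) P" using same_trans[OF same_sym[OF same_leq[OF fi]]] ci by blast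
    thus ?thesis using seqs_mono[OF c(1) leq_univ[OF fi]] by blast
  qed
  thus ?thesis using f by blast
qed

lemma saturated_iff:
  "saturated \<kappa> K0 M \<longleftrightarrow> M \<in> mods K0 \<and> (\<forall>N A \<gamma> b. leq K0 M N \<and> A \<subseteq> univ M \<and> |A| <o |{..<\<kappa>}| \<and> \<gamma> < \<kappa> \<and>
        b \<in> seqs \<gamma> (univ N) \<longrightarrow> (\<exists>c \<in> seqs \<gamma> (univ M). same K0 (idx {..<\<gamma>} A) (asg c) M (asg b) N))"
proof -
  have "gtp K0 c A M = gtp K0 b A N \<longleftrightarrow> same K0 (idx {..<\<gamma>} A) (asg c) M (asg b) N"
    if "leq K0 M N" "A \<subseteq> univ M" "c \<in> seqs \<gamma> (univ M)" "b \<in> seqs \<gamma> (univ N)" for N A \<gamma> b c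
  proof -
    have d: "dom c = {..<\<gamma>}" "ran c \<subseteq> univ M" "dom b = {..<\<gamma>}" "ran b \<subseteq> univ N" using that by (auto simp: seqs_def)
    have "A \<subseteq> univ N" using that leq_univ by blast
    thus ?thesis
      using gtp_eq_iff[OF leq_mods(1)[OF that(1)] that(2) d(2) leq_mods(2)[OF that(1)] _ d(4)] d(1,3) by simp
  qed
  thus ?thesis unfolding saturated_def by (meson)
qed

text \<open>Each stage realizes all types of length below \<kappa> over small sets of earlier
  elements. The chain has length \<open>\<kappa>\<^sub>r\<close> so that fewer than \<kappa>
  parameters from the union appear before some stage x, also when \<kappa> is singular.\<close>

lemma ex_saturated_extension:
  fixes \<kappa> :: 'u
  assumes M: "M \<in> mods K0" and \<kappa>: "is_cardinal \<kappa>" and LS: "|ls| \<le>o |{..<\<kappa>}|"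
  shows "\<exists>W. leq K0 M W \<and> saturated \<kappa> K0 W"
proof -
  let ?X = "{..<\<kappa>}"
  have infX: "infinite ?X" using card_of_ordLeq_infinite[OF LS infinite_ls] .
  let ?r = "least_regular \<kappa>"
  note r = least_regular_props[OF \<kappa> infX]
  have lim: "limit_ordinal ?r" by (rule infinite_cardinal_limit[OF r(2,3)])
  define S where "S Q M' \<longleftrightarrow> (\<forall>P A \<gamma> b. leq K0 Q P \<and> A \<subseteq> univ Q \<and> |A| \<le>o |{..<\<kappa>}| \<and> \<gamma> < \<kappa> \<and> b \<in> seqs \<gamma> (univ P) \<longrightarrow>
     (\<exists>c \<in> seqs \<gamma> (univ M'). same K0 (idx {..<\<gamma>} A) (asg c) M' (asg b) P))" for Q M'
  have step: "\<exists>R. leq K0 Q R \<and> S Q R" if "leq K0 M Q" for i :: 'u and Q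
    unfolding S_def by (rule realize_all_types[OF leq_mods(2)[OF that] LS])
  obtain f where f: "\<forall>i::'u. leq K0 M (f i) \<and> (\<forall>j<i. leq K0 (f j) (f i)) \<and>
    (\<exists>Q. leq K0 M Q \<and> (\<forall>j<i. leq K0 (f j) Q) \<and> leq K0 Q (f i) \<and> S Q (f i))"
    using ex_chain[OF M, of "\<lambda>i. S"] step by metis
  obtain W where W: "W \<in> mods K0" "univ W = (\<Union>i<?r. univ (f i))" "\<And>i. i < ?r \<Longrightarrow> leq K0 (f i) W"
    using chain_union[OF lim, of f] f by metis
  obtain i0 where "i0 < ?r" using lim by (auto simp: limit_ordinal_def)
  hence MW: "leq K0 M W" using W(3) f leq_trans by metis
  have "\<exists>c \<in> seqs \<gamma> (univ W). same K0 (idx {..<\<gamma>} A) (asg c) W (asg b) N"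
    if N: "leq K0 W N" and A: "A \<subseteq> univ W" "|A| <o |{..<\<kappa>}|" and g: "\<gamma> < \<kappa>" and b: "b \<in> seqs \<gamma> (univ N)" for N A \<gamma> b
  proof -
    have "\<forall>a\<in>A. \<exists>i<?r. a \<in> univ (f i)" using A(1) W(2) by blast
    then obtain st where st: "\<forall>a\<in>A. st a < ?r \<and> a \<in> univ (f (st a))" by metis
    have "|A| <o |{..<?r}|" by (rule ordLess_ordLeq_trans[OF A(2) card_of_lessThan_mono[OF r(1)]])
    then obtain x where x: "x < ?r" "\<forall>a\<in>A. st a < x"
      using regular_bounded[OF r(2,3,4), of A st] st by blast
    obtain Q where Q: "leq K0 M Q" "\<forall>j<x. leq K0 (f j) Q" "leq K0 Q (f x)" "S Q (f x)" using f by metis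
    have AQ: "A \<subseteq> univ Q" using st x(2) Q(2) leq_univ by (metis subsetD subsetI)
    have fW: "leq K0 (f x) W" using W(3) x(1) by blast
    \<comment> \<open>N extends the final model and therefore Q, so its types are among those
      realized at stage x.\<close>
    have "leq K0 Q N" using leq_trans[OF Q(3) leq_trans[OF fW N]] .
    then obtain c where c: "c \<in> seqs \<gamma> (univ (f x))" "same K0 (idx {..<\<gamma>} A) (asg c) (f x) (asg b) N"
      using Q(4) AQ ordLess_imp_ordLeq[OF A(2)] g b unfolding S_def by metis
    have dc: "dom c = {..<\<gamma>}" "ran c \<subseteq> univ (f x)" using c by (auto simp: seqs_def)
    have Ac: "A \<subseteq> univ (f x)" using AQ leq_univ[OF Q(3)] by blast
    have "asg c ` idx {..<\<gamma>} A \<subseteq> univ (f x)" using asg_idx[OF dc(2) Ac] dc(1) by simp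
    hence "same K0 (idx {..<\<gamma>} A) (asg c) W (asg b) N"
      using same_trans[OF same_sym[OF same_leq[OF fW]] c(2)] by blast
    thus ?thesis using seqs_mono[OF c(1) leq_univ[OF fW]] by blast
  qed
  hence "saturated \<kappa> K0 W" unfolding saturated_iff using W(1) by blast
  thus ?thesis using MW by blast
qed

end

subsection \<open>Infinitary formulas and the class of saturated models\<close>

lemma tval_map: "tval M v (map_tm f t) = tval M (v \<circ> f) t"
proof (induction t)
  case (App s ts)
  have "map_option (tval M v) ((map_option (map_tm f) \<circ> ts) i) = map_option (tval M (v \<circ> f)) (ts i)" for i
  proof (cases "ts i")
    case (Some t)
    hence "Some t \<in> range ts" by (metis rangeI)
    from App[OF this] Some show ?thesis by (simp add: comp_def)
  qed simp
  thus ?case by (simp add: comp_def)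
qed simp

lemma sat_map: "sat M v (map_fm f \<phi>) = sat M (v \<circ> f) \<phi>"
proof (induction \<phi>)
  case (Rel s ts)
  have "mapseq (tval M v) (map_option (map_tm f) \<circ> ts) = mapseq (tval M (v \<circ> f)) ts"
    by (rule ext) (simp add: mapseq_def option.map_comp comp_def tval_map)
  thus ?case by (simp add: comp_def)
next
  case (Conj F)
  have "map_option (sat M v) ((map_option (map_fm f) \<circ> F) i) = map_option (sat M (v \<circ> f)) (F i)" for i
  proof (cases "F i")
    case (Some t)
    hence "Some t \<in> range F" by (metis rangeI)
    from Conj[OF this] Some show ?thesis by (simp add: comp_def)
  qed simp
  thus ?case by (simp add: comp_def)
qed (simp_all add: tval_map comp_def)

lemma wf_tm_map: "wf_tm V t \<Longrightarrow> wf_tm V (map_tm f t)"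
proof (induction rule: wf_tm.induct)
  case (2 s n ts)
  show ?case unfolding tm.map
  proof (rule wf_tm.intros(2)[OF 2(1)])
    show "dom (map_option (map_tm f) \<circ> ts) = {..<n}" using 2(2) by (auto simp: dom_def)
  qed (use 2 in auto)
qed (auto intro: wf_tm.intros)

lemma wf_fm_map: "wf_fm \<kappa> V \<phi> \<Longrightarrow> wf_fm \<kappa> V (map_fm f \<phi>)"
proof (induction rule: wf_fm.induct)
  case (2 s n ts)
  show ?case unfolding fm.map
  proof (rule wf_fm.intros(2)[OF 2(1)])
    show "dom (map_option (map_tm f) \<circ> ts) = {..<n}" using 2(2) by (auto simp: dom_def)
  qed (use 2 in \<open>auto intro: wf_tm_map\<close>)
next
  case (4 F)
  have "dom (map_option (map_fm f) \<circ> F) = dom F" by (auto simp: dom_def)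
  with 4 show ?case unfolding fm.map by (intro wf_fm.intros(4)) auto
qed (auto intro: wf_fm.intros wf_tm_map)

lemma qf_formula_map: "qf_formula \<kappa> V \<phi> \<Longrightarrow> qf_formula \<kappa> V (map_fm f \<phi>)"
  unfolding qf_formula_def fm.set_map by (auto intro: wf_fm_map ordLeq_ordLess_trans[OF card_of_image])

lemma qf_formula_Neg: "qf_formula \<kappa> V \<phi> \<Longrightarrow> qf_formula \<kappa> V (Neg \<phi>)"
  unfolding qf_formula_def by (auto intro: wf_fm.intros)

lemma tval_cong: "(\<And>x. x \<in> tvars t \<Longrightarrow> v x = w x) \<Longrightarrow> tval M v t = tval M w t"
proof (induction t)
  case (App s ts)
  have "map_option (tval M v) (ts i) = map_option (tval M w) (ts i)" for i
  proof (cases "ts i")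
    case (Some t)
    have t: "Some t \<in> range ts" by (metis Some rangeI)
    have "v x = w x" if "x \<in> tvars t" for x using App(2) t that by force
    hence "tval M v t = tval M w t" using App(1)[OF t] by simp
    thus ?thesis using Some by simp
  qed simp
  thus ?case by simp
qed simp

lemma sat_cong: "(\<And>x. x \<in> fvars \<phi> \<Longrightarrow> v x = w x) \<Longrightarrow> sat M v \<phi> = sat M w \<phi>"
proof (induction \<phi>)
  case (Rel s ts)
  have "mapseq (tval M v) ts = mapseq (tval M w) ts"
  proof (rule mapseq_cong)
    fix t assume "t \<in> ran ts"
    then obtain i where "ts i = Some t" by (auto simp: ran_def)
    hence "Some t \<in> range ts" by (metis rangeI)
    thus "tval M v t = tval M w t" using Rel by (intro tval_cong) (force simp del: range_eqI)
  qed
  thus ?case by simp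
next
  case (Conj F)
  have "map_option (sat M v) (F i) = map_option (sat M w) (F i)" for i
  proof (cases "F i")
    case (Some t)
    have t: "Some t \<in> range F" by (metis Some rangeI)
    have "v x = w x" if "x \<in> fvars t" for x using Conj(2) t that by force
    hence "sat M v t = sat M w t" using Conj(1)[OF t] by simp
    thus ?thesis using Some by simp
  qed simp
  thus ?case by simp
next
  case (Equ t u)
  thus ?case using tval_cong[of t v w M] tval_cong[of u v w M] by simp
qed simp

text \<open>An injection of \<Phi> into the ordinals indexes the conjunction. Only well-formedness
  is claimed: for singular \<kappa> a union of few small sets of variables may be too large, so the
  bound on the variables is left to the place of use.\<close>

lemma ex_conjunction:
  fixes \<Phi> :: "('s, 'u::wellorder, 'v) fm set"
  assumes "|\<Phi>| <o |{..<\<kappa>::'u}|" "\<And>\<phi>. \<phi> \<in> \<Phi> \<Longrightarrow> wf_fm \<kappa> V \<phi>"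
  shows "\<exists>\<theta>. wf_fm \<kappa> V \<theta> \<and> fvars \<theta> = (\<Union>\<phi>\<in>\<Phi>. fvars \<phi>) \<and> (\<forall>M v. sat M v \<theta> \<longleftrightarrow> (\<forall>\<phi>\<in>\<Phi>. sat M v \<phi>))"
proof -
  obtain h :: "('s, 'u, 'v) fm \<Rightarrow> 'u" where h: "inj_on h \<Phi>"
    using ordLess_imp_ordLeq[OF assms(1)] unfolding card_of_ordLeq[symmetric] by blast
  define F where "F i = (if i \<in> h ` \<Phi> then Some (inv_into \<Phi> h i) else None)" for i
  have r: "F i = Some \<phi> \<longleftrightarrow> \<phi> \<in> \<Phi> \<and> h \<phi> = i" for i \<phi> using h by (auto simp: F_def f_inv_into_f inv_into_into inj_on_eq_iff)
  have d: "dom F = h ` \<Phi>" by (auto simp: dom_def F_def)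
  have "wf_fm \<kappa> V (Conj F)"
  proof (rule wf_fm.intros(4))
    show "|dom F| <o |{..<\<kappa>}|" unfolding d by (rule ordLeq_ordLess_trans[OF card_of_image assms(1)])
  qed (use r assms(2) in blast)
  moreover have "fvars (Conj F) = (\<Union>\<phi>\<in>\<Phi>. fvars \<phi>)"
  proof (intro set_eqI iffI)
    fix x assume "x \<in> fvars (Conj F)"
    then obtain i \<phi> where "F i = Some \<phi>" "x \<in> fvars \<phi>" by auto
    thus "x \<in> (\<Union>\<phi>\<in>\<Phi>. fvars \<phi>)" using r by blast
  next
    fix x assume "x \<in> (\<Union>\<phi>\<in>\<Phi>. fvars \<phi>)"
    then obtain \<phi> where p: "\<phi> \<in> \<Phi>" "x \<in> fvars \<phi>" by blast
    hence "Some \<phi> = F (h \<phi>)" using r by metis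
    hence "Some \<phi> \<in> range F" by blast
    thus "x \<in> fvars (Conj F)" unfolding fm.set using p(2) by fastforce
  qed
  moreover have "sat M v (Conj F) \<longleftrightarrow> (\<forall>\<phi>\<in>\<Phi>. sat M v \<phi>)" for M v
  proof -
    have "ran (\<lambda>i. map_option (sat M v) (F i)) = sat M v ` \<Phi>"
    proof (intro set_eqI iffI)
      fix b assume "b \<in> ran (\<lambda>i. map_option (sat M v) (F i))"
      then obtain i \<phi> where "F i = Some \<phi>" "b = sat M v \<phi>" unfolding ran_def by auto
      thus "b \<in> sat M v ` \<Phi>" using r by blast
    next
      fix b assume "b \<in> sat M v ` \<Phi>"
      then obtain \<phi> where p: "\<phi> \<in> \<Phi>" "b = sat M v \<phi>" by blast
      hence "F (h \<phi>) = Some \<phi>" using r by blast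
      thus "b \<in> ran (\<lambda>i. map_option (sat M v) (F i))" using p(2) by (intro ranI[of _ "h \<phi>"]) simp
    qed
    thus ?thesis by simp
  qed
  ultimately show ?thesis by blast
qed

lemma E_at_unfold:
  "((b1, A, N1), (b2, A', N2)) \<in> E_at K \<longleftrightarrow>
     A = A' \<and> A \<subseteq> univ N1 \<and> A' \<subseteq> univ N2 \<and> ran b1 \<subseteq> univ N1 \<and> ran b2 \<subseteq> univ N2 \<and>
     (\<exists>N f1 f2. embedding K f1 N1 N \<and> embedding K f2 N2 N \<and> (\<forall>x \<in> A. f1 x = x \<and> f2 x = x) \<and>
        mapseq f1 b1 = mapseq f2 b2)"
  by (cases "A = A'") (simp_all add: E_at_def)

section \<open>The class of saturated models\<close>

locale saturated_setup = aec_amalg U K0 for U :: "'u::wellorder itself" and K0 :: "('s, 'u) aclass" +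
  fixes \<kappa> :: 'u
  assumes cardinal_kappa: "is_cardinal \<kappa>" and LS_less: "LS K0 < \<kappa>"
begin

abbreviation K where "K \<equiv> saturated_class \<kappa> K0"
abbreviation V where "V \<equiv> hat_voc \<kappa> K"
abbreviation H where "H \<equiv> hat \<kappa> K"
abbreviation few :: "'a set \<Rightarrow> bool" where "few A \<equiv> |A| <o |{..<\<kappa>}|"
abbreviation indep' where "indep' \<equiv> indep \<kappa> K"
abbreviation qf where "qf \<equiv> qf_formula \<kappa> V"
abbreviation wfq where "wfq \<equiv> wf_fm \<kappa> V"
abbreviation tp where "tp \<equiv> tp_qf \<kappa> V"

lemma ls_le_kappa: "|ls| \<le>o |{..<\<kappa>}|"
  by (rule card_of_lessThan_mono) (use LS_less in simp)

lemma infinite_kappa: "infinite {..<\<kappa>}"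
  using card_of_ordLeq_infinite[OF ls_le_kappa infinite_ls] .

lemma voc_K [simp]: "voc K = voc K0"
  by (simp add: saturated_class_def Let_def)

lemma mods_K: "M \<in> mods K \<longleftrightarrow> saturated \<kappa> K0 M \<and> |{..<\<kappa>}| \<le>o |univ M|"
  by (auto simp: saturated_class_def Let_def saturated_def)

lemma mods_K_K0: "M \<in> mods K \<Longrightarrow> M \<in> mods K0"
  by (simp add: mods_K saturated_def)

lemma leq_K: "leq K M N \<longleftrightarrow> M \<in> mods K \<and> N \<in> mods K \<and> leq K0 M N"
  by (auto simp: saturated_class_def Let_def)

text \<open>A type over a subset of M' is pulled back along the inverse g to M, realized there by
  saturation and pushed forward by f. For this the extension N' is amalgamated with M along g, which
  embeds it in an extension R of M.\<close>

lemma mods_K_iso: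
  assumes "M \<in> mods K" "iso (voc K0) f M M'" shows "M' \<in> mods K"
proof -
  let ?g = "inv_into (univ M) f"
  have M: "M \<in> mods K0" and sat: "saturated \<kappa> K0 M" and big: "|{..<\<kappa>}| \<le>o |univ M|"
    using assms(1) mods_K mods_K_K0 by auto
  have M': "M' \<in> mods K0" using mods_iso[OF M assms(2)] .
  have b: "bij_betw f (univ M) (univ M')" using assms(2) by (simp add: iso_def)
  hence gf: "\<And>x. x \<in> univ M \<Longrightarrow> ?g (f x) = x" by (simp add: bij_betw_def)
  have g: "embedding K0 ?g M' M" using embedding_iso[OF M' iso_inverse[OF assms(2)]] .
  have "|univ M| =o |univ M'|" using b by (rule card_of_ordIsoI)
  hence big': "|{..<\<kappa>}| \<le>o |univ M'|" using big by (metis ordLeq_ordIso_trans)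
  have "\<exists>c \<in> seqs \<gamma> (univ M'). same K0 (idx {..<\<gamma>} A) (asg c) M' (asg b) N'"
    if N': "leq K0 M' N'" and A: "A \<subseteq> univ M'" "few A" and \<gamma>: "\<gamma> < \<kappa>" and b: "b \<in> seqs \<gamma> (univ N')" for N' A \<gamma> b
  proof -
    let ?I = "idx {..<\<gamma>} A"
    have e: "embedding K0 id M' N'" using embedding_leq[OF N', of id] by simp
    obtain N g1 g2 where N: "embedding K0 g1 N' N" "embedding K0 g2 M N" "\<forall>x\<in>univ M'. g1 (id x) = g2 (?g x)"
      using amalgamate[OF e g] by metis
    obtain k R where k: "embedding K0 k N R" "leq K0 M R" "\<And>x. x \<in> univ M \<Longrightarrow> k (g2 x) = x"
      using embedding_extend[OF N(2)] by metis
    let ?h = "k \<circ> g1"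
    have h: "embedding K0 ?h N' R" using embedding_comp[OF N(1) k(1)] .
    have hg: "?h x = ?g x" if "x \<in> univ M'" for x
      using N(3) k(3) that embedding_univ[OF g] by (auto simp: image_subset_iff)
    have A1: "?g ` A \<subseteq> univ M" using embedding_univ[OF g] A(1) by blast
    have cA1: "few (?g ` A)" by (rule ordLeq_ordLess_trans[OF card_of_image A(2)])
    have b1: "mapseq ?h b \<in> seqs \<gamma> (univ R)" by (rule mapseq_seqs[OF b embedding_univ[OF h]])
    obtain c where c: "c \<in> seqs \<gamma> (univ M)" "same K0 (idx {..<\<gamma>} (?g ` A)) (asg c) M (asg (mapseq ?h b)) R"
      using sat[unfolded saturated_iff] k(2) A1 cA1 \<gamma> b1 by metis
    \<comment> \<open>\<open>?k\<close> renames a parameter a to its copy g a, so that tuples with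
      parameters in A can be compared with tuples whose parameters are in the image of A.\<close>
    let ?c = "mapseq f c" and ?k = "map_sum id ?g"
    have c': "?c \<in> seqs \<gamma> (univ M')" using assms(2) by (intro mapseq_seqs[OF c(1)]) (simp add: iso_def bij_betw_def)
    have dc: "dom c = {..<\<gamma>}" "ran c \<subseteq> univ M" and db: "dom b = {..<\<gamma>}" "ran b \<subseteq> univ N'" using c(1) b by (auto simp: seqs_def)
    have cin: "the (c i) \<in> univ M" if "i < \<gamma>" for i
    proof -
      have "i \<in> dom c" using that dc by simp
      thus ?thesis using dc(2) by (force simp: ran_def)
    qed
    have s1: "same K0 ?I (asg c \<circ> ?k) M (asg (mapseq ?h b) \<circ> ?k) R"
      by (rule same_reindex[OF c(2)]) (auto simp: idx_def)
    have s2: "same K0 ?I (asg ?c) M' (asg c \<circ> ?k) M"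
    proof (rule same_embedding[OF g])
      fix i assume "i \<in> ?I"
      thus "(asg c \<circ> ?k) i = ?g (asg ?c i)"
        using gf cin the_mapseq[of _ c f] dc(1) by (auto simp: idx_def)
    qed
    have s3: "same K0 ?I (asg b) N' (asg (mapseq ?h b) \<circ> ?k) R"
    proof (rule same_embedding[OF h])
      fix i assume "i \<in> ?I"
      thus "(asg (mapseq ?h b) \<circ> ?k) i = ?h (asg b i)"
        using the_mapseq[of _ b ?h] db(1) hg A(1) by (auto simp: idx_def)
    qed
    have r1: "(asg c \<circ> ?k) ` ?I \<subseteq> univ M" using cin A1 by (auto simp: idx_def)
    have bin: "the (b i) \<in> univ N'" if "i < \<gamma>" for i
    proof -
      have "i \<in> dom b" using that db by simp
      thus ?thesis using db(2) by (force simp: ran_def)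
    qed
    have r2: "(asg (mapseq ?h b) \<circ> ?k) ` ?I \<subseteq> univ R"
    proof
      fix y assume "y \<in> (asg (mapseq ?h b) \<circ> ?k) ` ?I"
      then obtain i where i: "i \<in> ?I" "y = (asg (mapseq ?h b) \<circ> ?k) i" by blast
      show "y \<in> univ R"
      proof (cases i)
        case (Inl j)
        hence "j < \<gamma>" using i(1) by (auto simp: idx_def)
        hence "y = ?h (the (b j))" "the (b j) \<in> univ N'" using i(2) Inl the_mapseq[of j b ?h] db(1) bin by simp_all
        thus ?thesis using embedding_univ[OF h] by blast
      next
        case (Inr a)
        hence "y = ?g a" "a \<in> A" using i by (auto simp: idx_def)
        thus ?thesis using A1 leq_univ[OF k(2)] by blast
      qed
    qed
    have "same K0 ?I (asg ?c) M' (asg b) N'"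
      using same_trans[OF same_trans[OF s2 s1 r1] same_sym[OF s3] r2] .
    thus ?thesis using c' by blast
  qed
  hence "saturated \<kappa> K0 M'" unfolding saturated_iff using M' by blast
  thus ?thesis using big' by (simp add: mods_K)
qed

lemma embedding_K: "embedding K f M N \<longleftrightarrow> M \<in> mods K \<and> N \<in> mods K \<and> embedding K0 f M N"
proof
  assume "embedding K f M N"
  thus "M \<in> mods K \<and> N \<in> mods K \<and> embedding K0 f M N"
    unfolding embedding_def voc_K leq_K using mods_K_K0 by blast
next
  assume *: "M \<in> mods K \<and> N \<in> mods K \<and> embedding K0 f M N"
  hence "image_struct (voc K0) f M \<in> mods K" using mods_K_iso unfolding embedding_def by metis
  thus "embedding K f M N" using * unfolding embedding_def voc_K leq_K by blast
qed

lemma ex_K_extension: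
  assumes "N \<in> mods K0" "|{..<\<kappa>}| \<le>o |univ N|" shows "\<exists>N'. N' \<in> mods K \<and> leq K0 N N'"
proof -
  obtain W where W: "leq K0 N W" "saturated \<kappa> K0 W"
    using ex_saturated_extension[OF assms(1) cardinal_kappa ls_le_kappa] by blast
  have "|{..<\<kappa>}| \<le>o |univ W|" by (rule ordLeq_transitive[OF assms(2) card_of_mono1[OF leq_univ[OF W(1)]]])
  thus ?thesis using W mods_K by blast
qed

text \<open>A common extension in K0 has a saturated extension. Its size is at least \<kappa>
  because N1 embeds in it, so that extension belongs to K.\<close>

lemma same_K:
  assumes "N1 \<in> mods K" "N2 \<in> mods K" shows "same K I b1 N1 b2 N2 \<longleftrightarrow> same K0 I b1 N1 b2 N2"
proof
  assume "same K I b1 N1 b2 N2"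
  thus "same K0 I b1 N1 b2 N2" unfolding same_def embedding_K by blast
next
  assume "same K0 I b1 N1 b2 N2"
  then obtain N f1 f2 where *: "embedding K0 f1 N1 N" "embedding K0 f2 N2 N" "\<forall>i\<in>I. f1 (b1 i) = f2 (b2 i)"
    unfolding same_def by blast
  have "|{..<\<kappa>}| \<le>o |univ N1|" using assms mods_K by blast
  moreover have "|univ N1| \<le>o |univ N|"
    using embedding_inj[OF *(1)] embedding_univ[OF *(1)] card_of_ordLeq by metis
  ultimately have "|{..<\<kappa>}| \<le>o |univ N|" by (rule ordLeq_transitive)
  then obtain N' where N': "N' \<in> mods K" "leq K0 N N'" using ex_K_extension embedding_mods(2)[OF *(1)] by blast
  have e: "embedding K0 id N N'" using embedding_leq[OF N'(2), of id] by simp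
  show "same K I b1 N1 b2 N2" unfolding same_def embedding_K
    using embedding_comp[OF *(1) e] embedding_comp[OF *(2) e] *(3) assms N'(1) by (metis id_comp)
qed

lemma E_at_K:
  "((b1, A, N1), (b2, A', N2)) \<in> E_at K \<longleftrightarrow> N1 \<in> mods K \<and> N2 \<in> mods K \<and> ((b1, A, N1), (b2, A', N2)) \<in> E_at K0"
  (is "?L \<longleftrightarrow> ?R")
proof
  assume ?L
  then obtain N f1 f2 where *: "embedding K f1 N1 N" "embedding K f2 N2 N"
     "\<forall>x \<in> A. f1 x = x \<and> f2 x = x" "mapseq f1 b1 = mapseq f2 b2"
    and v: "A = A'" "A \<subseteq> univ N1" "A' \<subseteq> univ N2" "ran b1 \<subseteq> univ N1" "ran b2 \<subseteq> univ N2"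
    unfolding E_at_unfold by metis
  have m: "N1 \<in> mods K" "N2 \<in> mods K" "embedding K0 f1 N1 N" "embedding K0 f2 N2 N"
    using *(1,2) by (simp_all add: embedding_K)
  hence "\<exists>N f1 f2. embedding K0 f1 N1 N \<and> embedding K0 f2 N2 N \<and> (\<forall>x \<in> A. f1 x = x \<and> f2 x = x) \<and> mapseq f1 b1 = mapseq f2 b2"
    using *(3,4) by blast
  thus ?R unfolding E_at_unfold using v m(1,2) by metis
next
  assume R: ?R
  then obtain N f1 f2 where *: "embedding K0 f1 N1 N" "embedding K0 f2 N2 N"
     "\<forall>x \<in> A. f1 x = x \<and> f2 x = x" "mapseq f1 b1 = mapseq f2 b2"
    and v: "A = A'" "A \<subseteq> univ N1" "A' \<subseteq> univ N2" "ran b1 \<subseteq> univ N1" "ran b2 \<subseteq> univ N2"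
    unfolding E_at_unfold by metis
  have "|{..<\<kappa>}| \<le>o |univ N1|" using R mods_K by blast
  moreover have "|univ N1| \<le>o |univ N|"
    using embedding_inj[OF *(1)] embedding_univ[OF *(1)] card_of_ordLeq by metis
  ultimately have "|{..<\<kappa>}| \<le>o |univ N|" by (rule ordLeq_transitive)
  then obtain N' where N': "N' \<in> mods K" "leq K0 N N'" using ex_K_extension embedding_mods(2)[OF *(1)] by blast
  have e: "embedding K0 id N N'" using embedding_leq[OF N'(2), of id] by simp
  have "embedding K f1 N1 N'" "embedding K f2 N2 N'" unfolding embedding_K
    using embedding_comp[OF *(1) e] embedding_comp[OF *(2) e] R N'(1) by (simp_all add: id_comp)
  hence "\<exists>N f1 f2. embedding K f1 N1 N \<and> embedding K f2 N2 N \<and> (\<forall>x \<in> A. f1 x = x \<and> f2 x = x) \<and> mapseq f1 b1 = mapseq f2 b2"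
    using *(3,4) by blast
  thus ?L unfolding E_at_unfold using v by metis
qed

lemma gtp_K: "gtp K b A N = E_at K `` {(b, A, N)}"
proof -
  have "trans (E_at K)"
  proof (rule transI)
    fix x y z assume xy: "(x, y) \<in> E_at K" and yz: "(y, z) \<in> E_at K"
    obtain b1 A1 N1 b2 A2 N2 b3 A3 N3 where [simp]: "x = (b1, A1, N1)" "y = (b2, A2, N2)" "z = (b3, A3, N3)"
      by (metis prod_cases3)
    show "(x, z) \<in> E_at K" using xy yz transD[OF E_at_trans, of x y z] by (simp add: E_at_K)
  qed
  thus ?thesis unfolding gtp_def by (simp add: trancl_id)
qed

lemma gtp_K_eq_iff:
  assumes "N1 \<in> mods K" "A \<subseteq> univ N1" "ran b1 \<subseteq> univ N1" "N2 \<in> mods K" "A \<subseteq> univ N2" "ran b2 \<subseteq> univ N2"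
  shows "gtp K b1 A N1 = gtp K b2 A N2 \<longleftrightarrow>
    dom b1 = dom b2 \<and> same K0 (idx (dom b1) A) (asg b1) N1 (asg b2) N2"
proof -
  have m: "N1 \<in> mods K0" "N2 \<in> mods K0" using assms mods_K_K0 by blast+
  have r: "((b2, A, N2), (b2, A, N2)) \<in> E_at K" using E_at_refl[OF m(2) assms(5,6)] assms(4) by (simp add: E_at_K)
  \<comment> \<open>A type computed in K consists of those members of the type computed in K0 whose
    model belongs to K.\<close>
  have g: "gtp K b A N = {(b', A', N') \<in> gtp K0 b A N. N' \<in> mods K}" if "N \<in> mods K" for b A N
    using that by (auto simp: gtp_K gtp_K0 E_at_K)
  show ?thesis
  proof
    assume "gtp K b1 A N1 = gtp K b2 A N2"
    hence "((b1, A, N1), (b2, A, N2)) \<in> E_at K" using r by (auto simp: gtp_K)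
    thus "dom b1 = dom b2 \<and> same K0 (idx (dom b1) A) (asg b1) N1 (asg b2) N2" unfolding E_at_K E_at_iff by metis
  next
    assume "dom b1 = dom b2 \<and> same K0 (idx (dom b1) A) (asg b1) N1 (asg b2) N2"
    hence "gtp K0 b1 A N1 = gtp K0 b2 A N2" using gtp_eq_iff[OF m(1) assms(2,3) m(2) assms(5,6)] by blast
    thus "gtp K b1 A N1 = gtp K b2 A N2" using g[OF assms(1)] g[OF assms(4)] by simp
  qed
qed

end

subsection \<open>Galois types versus quantifier-free types\<close>

context aec_class begin

lemma embedding_rel:
  assumes "embedding K0 f M N" "xs \<in> tuples (rel_ar (voc K0)) s (univ M)"
  shows "mapseq f xs \<in> rel N s \<longleftrightarrow> xs \<in> rel M s"
proof -
  let ?I = "image_struct (voc K0) f M"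
  have i: "iso (voc K0) f M ?I" and s: "substruct (voc K0) ?I N"
    using assms(1) leq_substruct by (auto simp: embedding_def)
  have t: "mapseq f xs \<in> tuples (rel_ar (voc K0)) s (univ ?I)"
    using assms(2) by (rule tuples_mapseq) simp
  have "rel ?I s = rel N s \<inter> tuples (rel_ar (voc K0)) s (univ ?I)" using s unfolding substruct_def by blast
  hence "mapseq f xs \<in> rel N s \<longleftrightarrow> mapseq f xs \<in> rel ?I s" using t by blast
  also have "\<dots> \<longleftrightarrow> xs \<in> rel M s" using i assms(2) unfolding iso_def by blast
  finally show ?thesis .
qed

lemma embedding_func:
  assumes "embedding K0 f M N" "xs \<in> tuples (fun_ar (voc K0)) s (univ M)"
  shows "func N s (mapseq f xs) = f (func M s xs)" "func M s xs \<in> univ M"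
proof -
  let ?I = "image_struct (voc K0) f M"
  have i: "iso (voc K0) f M ?I" and s: "substruct (voc K0) ?I N"
    using assms(1) leq_substruct by (auto simp: embedding_def)
  have t: "mapseq f xs \<in> tuples (fun_ar (voc K0)) s (univ ?I)"
    using assms(2) by (rule tuples_mapseq) simp
  have "func ?I s (mapseq f xs) = func N s (mapseq f xs)" using s t unfolding substruct_def by blast
  moreover have "f (func M s xs) = func ?I s (mapseq f xs)" using i assms(2) unfolding iso_def by blast
  ultimately show "func N s (mapseq f xs) = f (func M s xs)" by simp
  have "is_struct (voc K0) M" using i by (simp add: iso_def)
  thus "func M s xs \<in> univ M" using assms(2) unfolding is_struct_def PiE_def by blast
qed

end

context saturated_setup begin

lemma fun_ar_V [simp]: "fun_ar V = case_sum (fun_ar (voc K0)) (\<lambda>p. None)"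
  by (simp add: hat_voc_def)

lemma hat_simps [simp]: "univ (H N) = univ N" "rel (H N) (Inl s) = rel N s" "func (H N) (Inl s) = func N s"
  by (simp_all add: hat_def)

lemma rel_hat_Inr [simp]: "rel (H N) (Inr p) = {a. \<exists>\<gamma><\<kappa>. a \<in> seqs \<gamma> (univ N) \<and> gtp K a {} N = p}"
  by (simp add: hat_def)

lemma tval_embedding:
  assumes e: "embedding K0 f M N" and "wf_tm V t" "v ` tvars t \<subseteq> univ M"
  shows "tval (H N) (f \<circ> v) t = f (tval (H M) v t) \<and> tval (H M) v t \<in> univ M"
  using assms(2,3)
proof (induction rule: wf_tm.induct)
  case (2 s n ts)
  obtain s' where s: "s = Inl s'" "fun_ar (voc K0) s' = Some n" using 2(1) by (cases s) auto
  have IH: "tval (H N) (f \<circ> v) t = f (tval (H M) v t) \<and> tval (H M) v t \<in> univ M" if t: "t \<in> ran ts" for t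
  proof -
    obtain i where i: "ts i = Some t" using t by (auto simp: ran_def)
    have "tvars t \<subseteq> tvars (App s ts)" using i by (force intro: sym)
    hence "v ` tvars t \<subseteq> univ M" using 2(5) by blast
    thus ?thesis using 2(4)[OF i] by blast
  qed
  let ?xs = "mapseq (tval (H M) v) ts"
  have xs: "?xs \<in> tuples (fun_ar (voc K0)) s' (univ M)"
    using IH 2(2) s(2) by (auto simp: tuples_def seqs_def)
  have "mapseq (tval (H N) (f \<circ> v)) ts = mapseq f ?xs"
    unfolding mapseq_mapseq using IH by (intro mapseq_cong) simp
  moreover have "tval (H M) v (App s ts) = func M s' ?xs" by (simp add: s mapseq_def)
  moreover have "tval (H N) (f \<circ> v) (App s ts) = func N s' (mapseq (tval (H N) (f \<circ> v)) ts)"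
    by (simp add: s mapseq_def)
  ultimately show ?case using embedding_func[OF e xs] by metis
qed simp

lemma gtp_K_embedding:
  assumes "embedding K0 f M N" "M \<in> mods K" "N \<in> mods K" "ran a \<subseteq> univ M"
  shows "gtp K (mapseq f a) {} N = gtp K a {} M"
proof -
  have r: "ran (mapseq f a) \<subseteq> univ N" using embedding_univ[OF assms(1)] assms(4) by auto
  have "same K0 (idx (dom a) {}) (asg a) M (asg (mapseq f a)) N"
    by (rule same_embedding[OF assms(1)]) (auto simp: idx_def mapseq_def)
  thus ?thesis using gtp_K_eq_iff[OF assms(2) _ assms(4,3) _ r, of "{}"] by simp
qed

text \<open>The new relations are preserved because embeddings do not change Galois types over the
  empty set. Negations and infinite conjunctions follow, there being no quantifiers.\<close>

lemma sat_embedding: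
  assumes e: "embedding K0 f M N" "M \<in> mods K" "N \<in> mods K" and "wfq \<phi>" "v ` fvars \<phi> \<subseteq> univ M"
  shows "sat (H N) (f \<circ> v) \<phi> \<longleftrightarrow> sat (H M) v \<phi>"
  using assms(4,5)
proof (induction rule: wf_fm.induct)
  case (1 t u)
  have "v ` tvars t \<subseteq> univ M" "v ` tvars u \<subseteq> univ M" using 1(3) by auto
  thus ?case using tval_embedding[OF e(1) 1(1)] tval_embedding[OF e(1) 1(2)] inj_on_eq_iff[OF embedding_inj[OF e(1)]]
    unfolding sat.simps by metis
next
  case (2 s n ts)
  have IH: "tval (H N) (f \<circ> v) t = f (tval (H M) v t) \<and> tval (H M) v t \<in> univ M" if t: "t \<in> ran ts" for t
  proof -
    obtain i where i: "ts i = Some t" using t by (auto simp: ran_def)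
    have "tvars t \<subseteq> fvars (Rel s ts)" using i by (force intro: sym)
    hence "v ` tvars t \<subseteq> univ M" using 2(4) by blast
    thus ?thesis using tval_embedding[OF e(1) 2(3)[OF i]] by blast
  qed
  let ?xs = "mapseq (tval (H M) v) ts"
  have m: "mapseq (tval (H N) (f \<circ> v)) ts = mapseq f ?xs"
    unfolding mapseq_mapseq using IH by (intro mapseq_cong) simp
  have r: "ran ?xs \<subseteq> univ M" using IH by auto
  show ?case
  proof (cases s)
    case (Inl s')
    have "rel_ar (voc K0) s' = Some n" using 2(1) Inl by (simp add: hat_voc_def)
    hence xs: "?xs \<in> tuples (rel_ar (voc K0)) s' (univ M)" using r 2(2) by (simp add: tuples_def seqs_def)
    show ?thesis unfolding Inl sat.simps m hat_simps by (rule embedding_rel[OF e(1) xs])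
  next
    case (Inr p)
    have "mapseq f ?xs \<in> seqs \<gamma> (univ N) \<longleftrightarrow> ?xs \<in> seqs \<gamma> (univ M)" for \<gamma>
      using r embedding_univ[OF e(1)] by (auto simp: seqs_def)
    thus ?thesis unfolding Inr sat.simps m rel_hat_Inr mem_Collect_eq gtp_K_embedding[OF e r] by simp
  qed
next
  case (4 F)
  have "sat (H N) (f \<circ> v) \<psi> \<longleftrightarrow> sat (H M) v \<psi>" if "F i = Some \<psi>" for i \<psi>
  proof -
    have "fvars \<psi> \<subseteq> fvars (Conj F)" using that by (force intro: sym)
    hence "v ` fvars \<psi> \<subseteq> univ M" using 4(4) by blast
    thus ?thesis using 4(3)[OF that] by blast
  qed
  hence "map_option (sat (H N) (f \<circ> v)) (F i) = map_option (sat (H M) v) (F i)" for i by (cases "F i") auto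
  thus ?case unfolding sat.simps by presburger
qed simp

lemma sat_leq:
  assumes "leq K M N" "wfq \<phi>" "v ` fvars \<phi> \<subseteq> univ M"
  shows "sat (H N) v \<phi> \<longleftrightarrow> sat (H M) v \<phi>"
  using sat_embedding[OF _ _ _ assms(2,3), of id N] embedding_leq[of M N id] assms(1) by (simp add: leq_K)

text \<open>Both sides are evaluated in a common extension, which is taken in K because only there
  embeddings are known to preserve formulas.\<close>

lemma sat_same:
  assumes "same K0 I b1 N1 b2 N2" "N1 \<in> mods K" "N2 \<in> mods K" "b1 ` I \<subseteq> univ N1" "b2 ` I \<subseteq> univ N2"
    "wfq \<phi>" "fvars \<phi> \<subseteq> I"
  shows "sat (H N1) b1 \<phi> \<longleftrightarrow> sat (H N2) b2 \<phi>"
proof -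
  have "same K I b1 N1 b2 N2" using assms(1) unfolding same_K[OF assms(2,3)] .
  then obtain N f1 f2 where e: "embedding K f1 N1 N" "embedding K f2 N2 N" "\<forall>i\<in>I. f1 (b1 i) = f2 (b2 i)"
    unfolding same_def by metis
  have N: "N \<in> mods K" and *: "embedding K0 f1 N1 N" "embedding K0 f2 N2 N" "\<forall>i\<in>I. f1 (b1 i) = f2 (b2 i)"
    using e by (auto simp: embedding_K)
  have "sat (H N1) b1 \<phi> \<longleftrightarrow> sat (H N) (f1 \<circ> b1) \<phi>"
    using sat_embedding[OF *(1) assms(2) N assms(6)] assms(4,7) by blast
  also have "\<dots> \<longleftrightarrow> sat (H N) (f2 \<circ> b2) \<phi>" using *(3) assms(7) by (intro sat_cong) auto
  also have "\<dots> \<longleftrightarrow> sat (H N2) b2 \<phi>"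
    using sat_embedding[OF *(2) assms(3) N assms(6)] assms(5,7) by blast
  finally show ?thesis .
qed

text \<open>A Galois type over the empty set determines the length of its realizations, so the
  \<open>THE\<close> in the vocabulary picks that length.\<close>

lemma rel_ar_type:
  assumes "\<gamma> < \<kappa>" "N \<in> mods K" "a \<in> seqs \<gamma> (univ N)"
  shows "rel_ar V (Inr (gtp K a {} N)) = Some \<gamma>"
proof -
  let ?p = "gtp K a {} N"
  have p: "?p \<in> gtypes_empty K \<gamma>" using assms by (auto simp: gtypes_empty_def)
  have u: "\<gamma>' = \<gamma>" if g: "?p \<in> gtypes_empty K \<gamma>'" for \<gamma>'
  proof -
    obtain b N' where b: "?p = gtp K b {} N'" "N' \<in> mods K" "b \<in> seqs \<gamma>' (univ N')"
      using g unfolding gtypes_empty_def by blast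
    have "ran a \<subseteq> univ N" "ran b \<subseteq> univ N'" using assms(3) b(3) by (auto simp: seqs_def)
    hence "dom a = dom b" using b(1) gtp_K_eq_iff[OF assms(2) _ _ b(2), of "{}" a b] by simp
    hence "{..<\<gamma>} = {..<\<gamma>'}" using assms(3) b(3) by (simp add: seqs_def)
    thus ?thesis by (metis lessThan_eq_iff)
  qed
  have "(THE \<gamma>. ?p \<in> gtypes_empty K \<gamma>) = \<gamma>" by (rule the_equality) (rule p, rule u)
  moreover have "\<exists>\<gamma><\<kappa>. ?p \<in> gtypes_empty K \<gamma>" using p assms(1) by blast
  ultimately show ?thesis by (simp add: hat_voc_def)
qed

text \<open>A small Galois type is isolated by the atomic formula naming it.\<close>

lemma same_of_sat:
  assumes "few I" "N1 \<in> mods K" "N2 \<in> mods K" "b1 ` I \<subseteq> univ N1" "b2 ` I \<subseteq> univ N2"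
    and imp: "\<And>\<phi>. qf \<phi> \<Longrightarrow> fvars \<phi> \<subseteq> I \<Longrightarrow> sat (H N1) b1 \<phi> \<Longrightarrow> sat (H N2) b2 \<phi>"
  shows "same K0 I b1 N1 b2 N2"
proof -
  obtain \<gamma> where g: "\<gamma> < \<kappa>" "|{..<\<gamma>}| =o |I|" using small_cardinal[OF cardinal_kappa assms(1)] by blast
  obtain e where e: "bij_betw e {..<\<gamma>} I" using g(2) card_of_ordIso by metis
  have eI: "e i \<in> I" if "i < \<gamma>" for i using e that by (auto simp: bij_betw_def)
  define a where "a b = (\<lambda>i. if i < \<gamma> then Some (b (e i)) else None)" for b :: "_ \<Rightarrow> 'u"
  have d: "dom (a b) = {..<\<gamma>}" for b by (auto simp: a_def dom_def)
  have ra: "ran (a b) = b ` I" for b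
    using bij_betw_imp_surj_on[OF e] by (force simp: a_def ran_def)
  have s: "a b1 \<in> seqs \<gamma> (univ N1)" "a b2 \<in> seqs \<gamma> (univ N2)" using assms(4,5) d ra by (auto simp: seqs_def)
  let ?p = "gtp K (a b1) {} N1"
  let ?ts = "\<lambda>i. if i < \<gamma> then Some (Var (e i)) else None"
  let ?\<phi> = "Rel (Inr ?p) ?ts"
  have m: "mapseq (tval M b) ?ts = a b" for M and b :: "_ \<Rightarrow> 'u" by (auto simp: mapseq_def a_def)
  have "fvars ?\<phi> \<subseteq> I" using eI by (auto split: if_splits)
  moreover have "wfq ?\<phi>"
  proof (rule wf_fm.intros(2)[OF rel_ar_type[OF g(1) assms(2) s(1)]])
    show "dom ?ts = {..<\<gamma>}" by (auto simp: dom_def)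
  qed (auto split: if_splits intro: wf_tm.intros)
  ultimately have "qf ?\<phi>" unfolding qf_formula_def
    using ordLeq_ordLess_trans[OF card_of_mono1 assms(1)] by blast
  moreover have "sat (H N1) b1 ?\<phi>" using s(1) g(1) unfolding sat.simps m rel_hat_Inr by blast
  ultimately have "sat (H N2) b2 ?\<phi>" using imp \<open>fvars ?\<phi> \<subseteq> I\<close> by blast
  hence "gtp K (a b1) {} N1 = gtp K (a b2) {} N2" unfolding sat.simps m rel_hat_Inr by auto
  hence "same K0 (idx {..<\<gamma>} {}) (asg (a b1)) N1 (asg (a b2)) N2"
    using gtp_K_eq_iff[OF assms(2) _ _ assms(3), of "{}" "a b1" "a b2"] d ra assms(4,5) by simp
  hence S: "same K0 I (asg (a b1) \<circ> (Inl \<circ> inv_into {..<\<gamma>} e)) N1 (asg (a b2) \<circ> (Inl \<circ> inv_into {..<\<gamma>} e)) N2"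
  proof (rule same_reindex)
    show "(Inl \<circ> inv_into {..<\<gamma>} e) ` I \<subseteq> idx {..<\<gamma>} {}"
      using bij_betw_imp_surj_on[OF e] inv_into_into[of _ e "{..<\<gamma>}"] by (auto simp: idx_def)
  qed
  have X: "(asg (a b) \<circ> (Inl \<circ> inv_into {..<\<gamma>} e)) i = b i" if "i \<in> I" for i b
  proof -
    have "inv_into {..<\<gamma>} e i < \<gamma>" "e (inv_into {..<\<gamma>} e i) = i"
      using bij_betw_imp_surj_on[OF e] inv_into_into[of i e "{..<\<gamma>}"] f_inv_into_f[of i e "{..<\<gamma>}"] that by auto
    thus ?thesis by (simp add: a_def)
  qed
  show ?thesis by (rule same_cong[OF S X X])
qed

end

subsection \<open>Coheir without stability hypotheses\<close>

text \<open>To read a formula as \<phi>(x, y), the set X declares which of its variables count as x;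
  these are evaluated by a and the others by b. The same formula can thus be split in several
  ways.\<close>

definition comb :: "'v set \<Rightarrow> ('v \<Rightarrow> 'u) \<Rightarrow> ('v \<Rightarrow> 'u) \<Rightarrow> 'v \<Rightarrow> 'u" where
  "comb X a b = (\<lambda>z. if z \<in> X then a z else b z)"

lemma comb_compl: "comb (- X) b a = comb X a b"
  by (auto simp: comb_def)

abbreviation with_params :: "('u \<Rightarrow> 'u) \<Rightarrow> 'u + 'u \<Rightarrow> 'u" where
  "with_params c \<equiv> case_sum c (\<lambda>e. e)"

context saturated_setup begin

abbreviation realized :: "('s, 'u) struct \<Rightarrow> ('s, 'u) struct \<Rightarrow> ('s + ('s, 'u) gtype, 'u) pfm \<Rightarrow> bool" where
  "realized M N \<phi> \<equiv> \<exists>d. (\<forall>i. Inl i \<in> fvars \<phi> \<longrightarrow> d i \<in> univ M) \<and> sat (H N) (with_params d) \<phi>"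

lemma ex_enumeration:
  assumes "|A| <o |UNIV :: 'u set|" shows "\<exists>\<gamma>::'u. \<exists>a \<in> seqs \<gamma> A. ran a = A"
proof -
  obtain \<gamma> :: 'u where "|{..<\<gamma>}| =o |A|" using small_ordinal[OF assms] by blast
  then obtain h where h: "bij_betw h {..<\<gamma>} A" using card_of_ordIso by metis
  let ?a = "\<lambda>i. if i < \<gamma> then Some (h i) else None"
  have "ran ?a = A" using bij_betw_imp_surj_on[OF h] by (force simp: ran_def)
  moreover have "dom ?a = {..<\<gamma>}" by (auto simp: dom_def)
  ultimately have "?a \<in> seqs \<gamma> A" by (simp add: seqs_def)
  thus ?thesis using \<open>ran ?a = A\<close> by blast
qed

text \<open>Enumerations disappear: the free variables may take arbitrary values in A, since
  renaming each variable to a position where its value is enumerated turns the formula into a member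
  of the type. In particular the enumeration chosen in \<open>indep\<close> does not matter.\<close>

lemma indep_iff:
  "indep' M N A B \<longleftrightarrow> leq K M N \<and> A \<subseteq> univ N \<and> B \<subseteq> univ N \<and>
    (\<forall>\<phi> c. qf \<phi> \<and> (\<forall>i. Inl i \<in> fvars \<phi> \<longrightarrow> c i \<in> A) \<and> (\<forall>e. Inr e \<in> fvars \<phi> \<longrightarrow> e \<in> univ M \<union> B) \<and>
       sat (H N) (with_params c) \<phi> \<longrightarrow>
       (realized M N \<phi>))"
  (is "?L \<longleftrightarrow> ?R")
proof
  assume L: ?L
  then obtain \<gamma> a where a: "a \<in> seqs \<gamma> (univ N)" "ran a = A"
    and coh: "coheir (H N) (univ M) (tp a (univ M \<union> B) (H N))" unfolding indep_def by blast
  have main: "realized M N \<phi>"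
    if q: "qf \<phi>" and c: "\<And>i. Inl i \<in> fvars \<phi> \<Longrightarrow> c i \<in> A"
      and e: "\<And>e. Inr e \<in> fvars \<phi> \<Longrightarrow> e \<in> univ M \<union> B" and s: "sat (H N) (with_params c) \<phi>" for \<phi> c
  proof -
    have "\<exists>j. j \<in> dom a \<and> the (a j) = c i" if i: "Inl i \<in> fvars \<phi>" for i
    proof -
      have "c i \<in> ran a" using c[OF i] a(2) by simp
      then obtain j where "a j = Some (c i)" by (auto simp: ran_def)
      thus ?thesis by (intro exI[of _ j]) auto
    qed
    then obtain h where h: "\<And>i. Inl i \<in> fvars \<phi> \<Longrightarrow> h i \<in> dom a \<and> the (a (h i)) = c i" by metis
    let ?\<psi> = "map_fm (map_sum h id) \<phi>"
    have fv: "fvars ?\<psi> = map_sum h id ` fvars \<phi>" by (rule fm.set_map)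
    have "sat (H N) (asg a) ?\<psi> \<longleftrightarrow> sat (H N) (with_params c) \<phi>" unfolding sat_map
    proof (rule sat_cong)
      fix x assume "x \<in> fvars \<phi>"
      thus "(asg a \<circ> map_sum h id) x = with_params c x" using h by (cases x rule: sum.exhaust) auto
    qed
    moreover have "fvars ?\<psi> \<subseteq> Inl ` dom a \<union> Inr ` (univ M \<union> B)"
    proof
      fix y assume "y \<in> fvars ?\<psi>"
      then obtain x where "x \<in> fvars \<phi>" "y = map_sum h id x" unfolding fv by blast
      thus "y \<in> Inl ` dom a \<union> Inr ` (univ M \<union> B)" using h e by (cases x rule: sum.exhaust) auto
    qed
    ultimately have "?\<psi> \<in> tp a (univ M \<union> B) (H N)"
      using s qf_formula_map[OF q] by (simp add: tp_qf_def)
    then obtain e' where e': "dom e' = {i. Inl i \<in> fvars ?\<psi>}" "ran e' \<subseteq> univ M" "sat (H N) (asg e') ?\<psi>"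
      using coh unfolding coheir_def by blast
    let ?d = "\<lambda>i. the (e' (h i))"
    have "?d i \<in> univ M" if "Inl i \<in> fvars \<phi>" for i
    proof -
      have "map_sum h id (Inl i) \<in> fvars ?\<psi>" unfolding fv using that by blast
      hence "h i \<in> dom e'" using e'(1) by simp
      thus ?thesis using e'(2) by (force simp: ran_def)
    qed
    moreover have "sat (H N) (with_params ?d) \<phi>"
    proof -
      have "sat (H N) (with_params ?d) \<phi> \<longleftrightarrow> sat (H N) (asg e' \<circ> map_sum h id) \<phi>"
      proof (rule sat_cong)
        fix x show "with_params ?d x = (asg e' \<circ> map_sum h id) x" by (cases x rule: sum.exhaust) auto
      qed
      thus ?thesis using e'(3) unfolding sat_map by simp
    qed
    ultimately show ?thesis by (intro exI[of _ ?d]) simp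
  qed
  show ?R
  proof (intro conjI allI impI)
    show "leq K M N" "A \<subseteq> univ N" "B \<subseteq> univ N" using L by (auto simp: indep_def)
    fix \<phi> c assume "qf \<phi> \<and> (\<forall>i. Inl i \<in> fvars \<phi> \<longrightarrow> c i \<in> A) \<and>
      (\<forall>e. Inr e \<in> fvars \<phi> \<longrightarrow> e \<in> univ M \<union> B) \<and> sat (H N) (with_params c) \<phi>"
    thus "realized M N \<phi>"
      by (elim conjE) (rule main, auto)
  qed
next
  assume R: ?R
  hence MN: "M \<in> mods K" "N \<in> mods K" by (auto simp: leq_K)
  have "A \<subseteq> univ N" using R by blast
  hence sA: "|A| <o |UNIV :: 'u set|" by (rule small_subset) (rule univ_small[OF mods_K_K0[OF MN(2)]])
  obtain \<gamma> :: 'u and a where a: "a \<in> seqs \<gamma> A" "ran a = A" using ex_enumeration[OF sA] by blast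
  have "coheir (H N) (univ M) (tp a (univ M \<union> B) (H N))"
    unfolding coheir_def
  proof
    fix \<phi> assume "\<phi> \<in> tp a (univ M \<union> B) (H N)"
    hence q: "qf \<phi>" and f: "fvars \<phi> \<subseteq> Inl ` dom a \<union> Inr ` (univ M \<union> B)" and s: "sat (H N) (asg a) \<phi>"
      by (auto simp: tp_qf_def)
    let ?c = "\<lambda>i. the (a i)"
    have "?c i \<in> A" if "Inl i \<in> fvars \<phi>" for i
    proof -
      have "i \<in> dom a" using f that by auto
      thus ?thesis using a(2) by (force simp: ran_def)
    qed
    moreover have "e \<in> univ M \<union> B" if "Inr e \<in> fvars \<phi>" for e using f that by auto
    moreover have "sat (H N) (with_params ?c) \<phi>" using s by (simp add: asg_def)
    ultimately have "qf \<phi> \<and> (\<forall>i. Inl i \<in> fvars \<phi> \<longrightarrow> ?c i \<in> A) \<and>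
      (\<forall>e. Inr e \<in> fvars \<phi> \<longrightarrow> e \<in> univ M \<union> B) \<and> sat (H N) (with_params ?c) \<phi>" using q by simp
    from R[THEN conjunct2, THEN conjunct2, THEN conjunct2, THEN spec, THEN spec, THEN mp, OF this]
    obtain d where d: "\<forall>i. Inl i \<in> fvars \<phi> \<longrightarrow> d i \<in> univ M" "sat (H N) (with_params d) \<phi>" by (elim exE conjE)
    let ?e = "\<lambda>i. if Inl i \<in> fvars \<phi> then Some (d i) else None"
    have "sat (H N) (asg ?e) \<phi> \<longleftrightarrow> sat (H N) (with_params d) \<phi>"
    proof (rule sat_cong)
      fix x assume "x \<in> fvars \<phi>"
      thus "asg ?e x = with_params d x" by (cases x rule: sum.exhaust) auto
    qed
    moreover have "dom ?e = {i. Inl i \<in> fvars \<phi>}" by (auto simp: dom_def)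
    moreover have "ran ?e \<subseteq> univ M" using d(1) by (auto simp: ran_def)
    ultimately show "\<exists>e. dom e = {i. Inl i \<in> fvars \<phi>} \<and> ran e \<subseteq> univ M \<and> sat (H N) (asg e) \<phi>"
      using d(2) by (intro exI[of _ ?e]) simp
  qed
  moreover have "a \<in> seqs \<gamma> (univ N)" using seqs_mono[OF a(1)] R by blast
  ultimately have "\<exists>\<gamma>. \<exists>a\<in>seqs \<gamma> (univ N). ran a = A \<and>
    coheir (H N) (univ M) (tp a (univ M \<union> B) (H N))" using a(2) by blast
  thus ?L unfolding indep_def using R MN by simp
qed

lemma indepI:
  assumes "leq K M N" "A \<subseteq> univ N" "B \<subseteq> univ N"
    "\<And>\<phi> c. qf \<phi> \<Longrightarrow> (\<And>i. Inl i \<in> fvars \<phi> \<Longrightarrow> c i \<in> A) \<Longrightarrow>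
       (\<And>e. Inr e \<in> fvars \<phi> \<Longrightarrow> e \<in> univ M \<union> B) \<Longrightarrow> sat (H N) (with_params c) \<phi> \<Longrightarrow>
       realized M N \<phi>"
  shows "indep' M N A B"
  unfolding indep_iff
proof (intro conjI allI impI)
  fix \<phi> c assume "qf \<phi> \<and> (\<forall>i. Inl i \<in> fvars \<phi> \<longrightarrow> c i \<in> A) \<and>
    (\<forall>e. Inr e \<in> fvars \<phi> \<longrightarrow> e \<in> univ M \<union> B) \<and> sat (H N) (with_params c) \<phi>"
  thus "realized M N \<phi>"
    by (elim conjE) (rule assms(4), auto)
qed (rule assms)+

lemma indepD:
  assumes "indep' M N A B" "qf \<phi>" "\<And>i. Inl i \<in> fvars \<phi> \<Longrightarrow> c i \<in> A"
    "\<And>e. Inr e \<in> fvars \<phi> \<Longrightarrow> e \<in> univ M \<union> B" "sat (H N) (with_params c) \<phi>"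
  shows "realized M N \<phi>"
proof -
  have "\<forall>\<phi> c. qf \<phi> \<and> (\<forall>i. Inl i \<in> fvars \<phi> \<longrightarrow> c i \<in> A) \<and> (\<forall>e. Inr e \<in> fvars \<phi> \<longrightarrow> e \<in> univ M \<union> B) \<and>
       sat (H N) (with_params c) \<phi> \<longrightarrow>
       (realized M N \<phi>)"
    using assms(1) unfolding indep_iff by (elim conjE)
  from this[THEN spec, THEN spec, THEN mp, of \<phi> c] assms(2-5) show ?thesis by simp
qed

lemma indep_basic:
  assumes "indep' M N A B"
  shows "leq K M N" "A \<subseteq> univ N" "B \<subseteq> univ N" "M \<in> mods K" "N \<in> mods K" "leq K0 M N" "univ M \<subseteq> univ N"
proof -
  show *: "leq K M N" "A \<subseteq> univ N" "B \<subseteq> univ N" using assms by (auto simp: indep_def)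
  thus "M \<in> mods K" "N \<in> mods K" "leq K0 M N" by (auto simp: leq_K)
  thus "univ M \<subseteq> univ N" using leq_univ by blast
qed

text \<open>One tuple in M imitates a against all b in S at once. The coheir property is applied to
  the conjunction, over b in S, of \<phi>(x, b) or its negation, whichever a satisfies.\<close>

lemma indep_simul:
  fixes \<phi> :: "('s + ('s, 'u) gtype, 'u, 'v) fm" and S :: "('v \<Rightarrow> 'u) set"
  assumes ind: "indep' M N A B" and q: "qf \<phi>" and a: "\<And>z. z \<in> fvars \<phi> \<inter> X \<Longrightarrow> a z \<in> A"
    and S: "few S" and b: "\<And>b z. b \<in> S \<Longrightarrow> z \<in> fvars \<phi> - X \<Longrightarrow> b z \<in> univ M \<union> B"
  shows "\<exists>a'. (\<forall>z\<in>fvars \<phi> \<inter> X. a' z \<in> univ M) \<and>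
     (\<forall>b\<in>S. sat (H N) (comb X a b) \<phi> \<longleftrightarrow> sat (H N) (comb X a' b) \<phi>)"
proof -
  have fv: "few (fvars \<phi>)" and wf: "wfq \<phi>" using q by (auto simp: qf_formula_def)
  obtain k :: "'v \<Rightarrow> 'u" where k: "inj_on k (fvars \<phi>)"
    using ordLess_imp_ordLeq[OF fv] unfolding card_of_ordLeq[symmetric] by blast
  \<comment> \<open>Variables in X become free variables \<open>Inl\<close>, numbered by k; the
    others are replaced by their values under b, as parameters.\<close>
  define g where "g b = (\<lambda>z. if z \<in> X then Inl (k z) else Inr (b z))" for b :: "'v \<Rightarrow> 'u"
  define \<psi> where "\<psi> b = map_fm (g b) \<phi>" for b
  have sat_psi: "sat (H N) (with_params c) (\<psi> b) \<longleftrightarrow> sat (H N) (comb X (c \<circ> k) b) \<phi>" for c b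
    unfolding \<psi>_def sat_map by (rule sat_cong) (auto simp: g_def comb_def)
  define \<chi> where "\<chi> b = (if sat (H N) (comb X a b) \<phi> then \<psi> b else Neg (\<psi> b))" for b
  have fchi: "fvars (\<chi> b) = g b ` fvars \<phi>" for b by (simp add: \<chi>_def \<psi>_def fm.set_map)
  have wfchi: "wfq (\<chi> b)" for b
    unfolding \<chi>_def \<psi>_def using wf_fm_map[OF wf, of "g b"] by (auto intro: wf_fm.intros)
  have cS: "few (\<chi> ` S)" by (rule ordLeq_ordLess_trans[OF card_of_image S])
  have wfS: "\<And>\<phi>. \<phi> \<in> \<chi> ` S \<Longrightarrow> wfq \<phi>" using wfchi by auto
  have "\<exists>\<theta>. wfq \<theta> \<and> fvars \<theta> = (\<Union>\<phi>\<in>\<chi> ` S. fvars \<phi>) \<and>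
    (\<forall>M v. sat M v \<theta> \<longleftrightarrow> (\<forall>\<phi>\<in>\<chi> ` S. sat M v \<phi>))"
    by (rule ex_conjunction[OF cS]) (rule wfS)
  then obtain \<theta> where t: "wfq \<theta>" "fvars \<theta> = (\<Union>\<phi>\<in>\<chi> ` S. fvars \<phi>)"
    "\<forall>M v. sat M v \<theta> \<longleftrightarrow> (\<forall>\<phi>\<in>\<chi> ` S. sat M v \<phi>)" by (elim exE conjE)
  have ft: "fvars \<theta> = (\<lambda>(b, z). g b z) ` (S \<times> fvars \<phi>)" unfolding t(2) using fchi by auto
  \<comment> \<open>All conjuncts are instances of the one formula \<phi>, so their variables come
    from a product of two small sets. This bounds the conjunction even for singular
    \<kappa>.\<close>
  have "few (S \<times> fvars \<phi>)" by (rule card_Times_less[OF infinite_kappa S fv])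
  hence "few (fvars \<theta>)" unfolding ft by (rule ordLeq_ordLess_trans[OF card_of_image])
  hence qt: "qf \<theta>" using t(1) by (simp add: qf_formula_def)
  let ?c = "a \<circ> inv_into (fvars \<phi>) k"
  have ck: "sat (H N) (comb X (?c \<circ> k) b) \<phi> \<longleftrightarrow> sat (H N) (comb X a b) \<phi>" for b
    by (rule sat_cong) (use k in \<open>auto simp: comb_def\<close>)
  have "\<exists>d. (\<forall>i. Inl i \<in> fvars \<theta> \<longrightarrow> d i \<in> univ M) \<and> sat (H N) (with_params d) \<theta>"
  proof (rule indepD[OF ind qt])
    fix i assume "Inl i \<in> fvars \<theta>"
    then obtain z where "z \<in> fvars \<phi> \<inter> X" "i = k z" unfolding ft by (auto simp: g_def split: if_splits)
    thus "?c i \<in> A" using a k by simp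
  next
    fix e assume "Inr e \<in> fvars \<theta>"
    then obtain b z where "b \<in> S" "z \<in> fvars \<phi> - X" "e = b z" unfolding ft by (auto simp: g_def split: if_splits)
    thus "e \<in> univ M \<union> B" using b by blast
  next
    have "sat (H N) (with_params ?c) (\<chi> b)" for b
      unfolding \<chi>_def using sat_psi[of ?c b] ck[of b] by simp
    thus "sat (H N) (with_params ?c) \<theta>" using t(3) by blast
  qed
  then obtain d where d: "\<forall>i. Inl i \<in> fvars \<theta> \<longrightarrow> d i \<in> univ M" "sat (H N) (with_params d) \<theta>" by blast
  show ?thesis
  proof (cases "S = {}")
    case True
    \<comment> \<open>With S empty the conjunction has no variables and yields no tuple in M, so an
      arbitrary element of M is taken.\<close>
    obtain m where "m \<in> univ M" using univ_nonempty[OF mods_K_K0[OF indep_basic(4)[OF ind]]] by blast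
    thus ?thesis using True by (intro exI[of _ "\<lambda>_. m"]) simp
  next
    case False
    then obtain b0 where b0: "b0 \<in> S" by blast
    have "(d \<circ> k) z \<in> univ M" if "z \<in> fvars \<phi> \<inter> X" for z
    proof -
      have "g b0 z \<in> fvars \<theta>" unfolding ft using b0 that by force
      thus ?thesis using d(1) that by (simp add: g_def)
    qed
    moreover have "sat (H N) (comb X a b) \<phi> \<longleftrightarrow> sat (H N) (comb X (d \<circ> k) b) \<phi>" if "b \<in> S" for b
    proof -
      have "sat (H N) (with_params d) (\<chi> b)" using d(2) t(3) that by blast
      thus ?thesis unfolding \<chi>_def using sat_psi[of d b] by (auto split: if_splits)
    qed
    ultimately show ?thesis by (intro exI[of _ "d \<circ> k"]) blast
  qed
qed

text \<open>The parameters of a formula over the image are renamed along the inverse of f, and the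
  witness found in M is pushed forward.\<close>

lemma indep_invariance:
  assumes iso: "iso (voc K0) f N N'" and ind: "indep' M N A B"
  shows "indep' (image_struct (voc K0) f M) N' (f ` A) (f ` B)"
proof (rule indepI)
  note b = indep_basic[OF ind]
  let ?M = "image_struct (voc K0) f M" and ?g = "inv_into (univ N) f"
  have bij: "inj_on f (univ N)" "univ N' = f ` univ N" using iso by (auto simp: iso_def bij_betw_def)
  have N': "N' \<in> mods K" using mods_K_iso[OF b(5) iso] .
  have "inj_on f (univ M)" using bij(1) b(7) by (rule inj_on_subset)
  hence M': "?M \<in> mods K" using mods_K_iso[OF b(4)] iso_image_struct mods_struct mods_K_K0 b(4) by blast
  show "leq K ?M N'" using M' N' leq_iso[OF b(6) iso] by (simp add: leq_K)
  show "f ` A \<subseteq> univ N'" "f ` B \<subseteq> univ N'" using b(2,3) bij by auto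
  have ef: "embedding K0 f N N'" using embedding_iso[OF mods_K_K0[OF b(5)] iso] .
  fix \<phi> c assume q: "qf \<phi>" and c: "\<And>i. Inl i \<in> fvars \<phi> \<Longrightarrow> c i \<in> f ` A"
    and e: "\<And>e. Inr e \<in> fvars \<phi> \<Longrightarrow> e \<in> univ ?M \<union> f ` B" and s: "sat (H N') (with_params c) \<phi>"
  have wf: "wfq \<phi>" using q by (simp add: qf_formula_def)
  have gin: "?g y \<in> X \<and> f (?g y) = y" if "y \<in> f ` X" "X \<subseteq> univ N" for y X
    using that bij(1) by (auto simp: inv_into_f_f subset_iff)
  let ?\<psi> = "map_fm (map_sum id ?g) \<phi>"
  have gc: "?g (c i) \<in> A \<and> f (?g (c i)) = c i" if "Inl i \<in> fvars \<phi>" for i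
    using gin[OF c[OF that] b(2)] .
  have ge: "?g y \<in> univ M \<union> B \<and> f (?g y) = y" if "Inr y \<in> fvars \<phi>" for y
    using gin[of y "univ M \<union> B"] e[OF that] b(3,7) by auto
  have geN: "?g y \<in> univ N \<and> f (?g y) = y" if "Inr y \<in> fvars \<phi>" for y using ge[OF that] b(3,7) by blast
  have fv: "fvars ?\<psi> = map_sum id ?g ` fvars \<phi>" by (rule fm.set_map)
  have vN: "with_params (?g \<circ> c) (map_sum id ?g x) \<in> univ N \<and> f (with_params (?g \<circ> c) (map_sum id ?g x)) = with_params c x"
    if "x \<in> fvars \<phi>" for x
    using that gc geN b(2) by (cases x rule: sum.exhaust) auto
  have "sat (H N') (f \<circ> (with_params (?g \<circ> c) \<circ> map_sum id ?g)) \<phi>"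
    using s vN sat_cong[of \<phi> "with_params c" "f \<circ> (with_params (?g \<circ> c) \<circ> map_sum id ?g)" "H N'"] by simp
  hence s': "sat (H N) (with_params (?g \<circ> c)) ?\<psi>" unfolding sat_map
    using sat_embedding[OF ef b(5) N' wf, of "with_params (?g \<circ> c) \<circ> map_sum id ?g"] vN by auto
  obtain d where d: "\<forall>i. Inl i \<in> fvars ?\<psi> \<longrightarrow> d i \<in> univ M" "sat (H N) (with_params d) ?\<psi>"
  proof (atomize_elim, rule indepD[OF ind qf_formula_map[OF q] _ _ s'])
    fix i assume "Inl i \<in> fvars ?\<psi>"
    hence "Inl i \<in> fvars \<phi>" unfolding fv by (auto simp: map_sum_def split: sum.splits)
    thus "(?g \<circ> c) i \<in> A" using gc by simp
  next
    fix y assume "Inr y \<in> fvars ?\<psi>"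
    then obtain x where "Inr x \<in> fvars \<phi>" "y = ?g x" unfolding fv by (auto simp: map_sum_def split: sum.splits)
    thus "y \<in> univ M \<union> B" using ge by simp
  qed
  have dM: "d i \<in> univ M" if "Inl i \<in> fvars \<phi>" for i
  proof -
    have "map_sum id ?g (Inl i) \<in> fvars ?\<psi>" unfolding fv using that by blast
    thus ?thesis using d(1) by simp
  qed
  have wN: "(with_params d \<circ> map_sum id ?g) x \<in> univ N \<and> f ((with_params d \<circ> map_sum id ?g) x) = with_params (f \<circ> d) x"
    if "x \<in> fvars \<phi>" for x
    using that dM geN b(7) by (cases x rule: sum.exhaust) auto
  have "sat (H N') (f \<circ> (with_params d \<circ> map_sum id ?g)) \<phi>"
    using sat_embedding[OF ef b(5) N' wf, of "with_params d \<circ> map_sum id ?g"] wN d(2) unfolding sat_map by auto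
  hence "sat (H N') (with_params (f \<circ> d)) \<phi>"
    using wN sat_cong[of \<phi> "with_params (f \<circ> d)" "f \<circ> (with_params d \<circ> map_sum id ?g)" "H N'"] by simp
  thus "realized ?M N' \<phi>"
    using dM by (intro exI[of _ "f \<circ> d"]) auto
qed

text \<open>Quantifier-free truth is the same in N0 and N, so a formula is passed up and its
  witness, which lies in M, is passed down. Parameters from M' are allowed because they lie in
  B.\<close>

lemma indep_monotonicity:
  assumes ind: "indep' M N A B" and l: "leq K M M'" "leq K M' N0" "leq K N0 N"
    and sub: "A0 \<subseteq> A" "B0 \<subseteq> B" "univ M' \<subseteq> B" "A0 \<union> B0 \<subseteq> univ N0"
  shows "indep' M' N0 A0 B0"
proof (rule indepI)
  have u: "univ M \<subseteq> univ M'" "univ M' \<subseteq> univ N0" using l leq_univ by (auto simp: leq_K)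
  show "leq K M' N0" "A0 \<subseteq> univ N0" "B0 \<subseteq> univ N0" using l sub by auto
  fix \<phi> c assume q: "qf \<phi>" and c: "\<And>i. Inl i \<in> fvars \<phi> \<Longrightarrow> c i \<in> A0"
    and e: "\<And>e. Inr e \<in> fvars \<phi> \<Longrightarrow> e \<in> univ M' \<union> B0" and s: "sat (H N0) (with_params c) \<phi>"
  have wf: "wfq \<phi>" using q by (simp add: qf_formula_def)
  have e0: "e \<in> univ N0" if "Inr e \<in> fvars \<phi>" for e using e[OF that] u(2) sub(4) by blast
  have in0: "with_params c' ` fvars \<phi> \<subseteq> univ N0" if "\<And>i. Inl i \<in> fvars \<phi> \<Longrightarrow> c' i \<in> univ N0" for c'
  proof
    fix y assume "y \<in> with_params c' ` fvars \<phi>"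
    then obtain x where "x \<in> fvars \<phi>" "y = with_params c' x" by blast
    thus "y \<in> univ N0" using that e0 by (cases x rule: sum.exhaust) auto
  qed
  have "with_params c ` fvars \<phi> \<subseteq> univ N0" using c sub(4) by (intro in0) auto
  hence s': "sat (H N) (with_params c) \<phi>" using s sat_leq[OF l(3) wf] by blast
  obtain d where d: "\<forall>i. Inl i \<in> fvars \<phi> \<longrightarrow> d i \<in> univ M" "sat (H N) (with_params d) \<phi>"
    using indepD[OF ind q _ _ s'] c e sub by (metis (no_types, lifting) UnE UnI2 subsetD)
  have "with_params d ` fvars \<phi> \<subseteq> univ N0" using d(1) u by (intro in0) auto
  hence "sat (H N0) (with_params d) \<phi>" using d(2) sat_leq[OF l(3) wf] by blast
  thus "realized M' N0 \<phi>" using d(1) u(1) by blast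
qed

lemma indep_normality:
  assumes ind: "indep' M N A B" shows "indep' M N (A \<union> univ M) (B \<union> univ M)"
proof (rule indepI)
  note b = indep_basic[OF ind]
  show "leq K M N" "A \<union> univ M \<subseteq> univ N" "B \<union> univ M \<subseteq> univ N" using b by auto
  fix \<phi> c assume q: "qf \<phi>" and c: "\<And>i. Inl i \<in> fvars \<phi> \<Longrightarrow> c i \<in> A \<union> univ M"
    and e: "\<And>e. Inr e \<in> fvars \<phi> \<Longrightarrow> e \<in> univ M \<union> (B \<union> univ M)" and s: "sat (H N) (with_params c) \<phi>"
  \<comment> \<open>Only the variables with value in A have to be moved; those with value in M play
    the part of parameters.\<close>
  let ?X = "{Inl i |i. c i \<in> A}"
  have "\<exists>a'. (\<forall>z\<in>fvars \<phi> \<inter> ?X. a' z \<in> univ M) \<and>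
     (\<forall>b\<in>{with_params c}. sat (H N) (comb ?X (with_params c) b) \<phi> \<longleftrightarrow> sat (H N) (comb ?X a' b) \<phi>)"
  proof (rule indep_simul[OF ind q])
    show "few {with_params c}" by (rule card_finite_less[OF infinite_kappa]) simp
    fix b z assume "b \<in> {with_params c}" "z \<in> fvars \<phi> - ?X"
    thus "b z \<in> univ M \<union> B" using c e by (cases z rule: sum.exhaust) auto
  qed auto
  then obtain a' where a': "\<forall>z\<in>fvars \<phi> \<inter> ?X. a' z \<in> univ M"
    "sat (H N) (comb ?X (with_params c) (with_params c)) \<phi> \<longleftrightarrow> sat (H N) (comb ?X a' (with_params c)) \<phi>" by blast
  have "comb ?X (with_params c) (with_params c) = with_params c" by (auto simp: comb_def)
  hence s': "sat (H N) (comb ?X a' (with_params c)) \<phi>" using a'(2) s by simp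
  let ?d = "\<lambda>i. comb ?X a' (with_params c) (Inl i)"
  have "with_params ?d = comb ?X a' (with_params c)" by (rule ext, case_tac x) (auto simp: comb_def)
  hence "sat (H N) (with_params ?d) \<phi>" using s' by simp
  moreover have "?d i \<in> univ M" if "Inl i \<in> fvars \<phi>" for i
    using a'(1) c[OF that] that by (auto simp: comb_def)
  ultimately show "realized M N \<phi>"
    by (intro exI[of _ ?d] conjI allI impI)
qed

text \<open>For x in both sets, the formula v = x with parameter x has a solution in A, hence one in
  M, and x is its only solution.\<close>

lemma indep_disjointness:
  assumes ind: "indep' M N A B" shows "A \<inter> B \<subseteq> univ M"
proof
  fix x assume x: "x \<in> A \<inter> B"
  let ?\<phi> = "Equ (Var (Inl x)) (Var (Inr x)) :: ('s + ('s, 'u) gtype, 'u) pfm"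
  have "qf ?\<phi>" unfolding qf_formula_def
    using card_finite_less[OF infinite_kappa, of "fvars ?\<phi>"] by (auto intro: wf_fm.intros wf_tm.intros)
  from indepD[OF ind this, of "\<lambda>_. x"] obtain d where "d x \<in> univ M" "d x = x" using x by auto
  thus "x \<in> univ M" by simp
qed

lemma right_existence:
  assumes "leq K M N" "B \<subseteq> univ N" shows "indep' M N (univ M) B"
proof (rule indepI)
  show "leq K M N" "univ M \<subseteq> univ N" "B \<subseteq> univ N" using assms leq_univ by (auto simp: leq_K)
qed blast

text \<open>A formula mentions fewer than \<kappa> variables and parameters, so it suffices to find
  in M copies of small tuples from A over small subsets of M \<union> B. Left existence and local
  character obtain the coheir property in this form.\<close>

lemma indep_of_same:
  assumes MN: "leq K M N" and A: "A \<subseteq> univ N" and B: "B \<subseteq> univ N"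
    and real: "\<And>D \<gamma> b. D \<subseteq> univ M \<union> B \<Longrightarrow> few D \<Longrightarrow> \<gamma> < \<kappa> \<Longrightarrow> b \<in> seqs \<gamma> A \<Longrightarrow>
      \<exists>c\<in>seqs \<gamma> (univ M). same K0 (idx {..<\<gamma>} D) (asg b) N (asg c) N"
  shows "indep' M N A B"
proof (rule indepI[OF MN A B])
  have u: "univ M \<subseteq> univ N" "N \<in> mods K" using MN leq_univ by (auto simp: leq_K)
  fix \<phi> c assume q: "qf \<phi>" and c: "\<And>i. Inl i \<in> fvars \<phi> \<Longrightarrow> c i \<in> A"
    and e: "\<And>e. Inr e \<in> fvars \<phi> \<Longrightarrow> e \<in> univ M \<union> B" and s: "sat (H N) (with_params c) \<phi>"
  have wf: "wfq \<phi>" and fv: "few (fvars \<phi>)" using q by (auto simp: qf_formula_def)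
  let ?I = "{i. Inl i \<in> fvars \<phi>}" and ?E = "{e. Inr e \<in> fvars \<phi>}"
  have "|?I| \<le>o |fvars \<phi>|" by (rule card_of_ordLeqI[of Inl]) auto
  hence cI: "few ?I" using fv by (rule ordLeq_ordLess_trans)
  have "|?E| \<le>o |fvars \<phi>|" by (rule card_of_ordLeqI[of Inr]) auto
  hence cE: "few ?E" using fv by (rule ordLeq_ordLess_trans)
  obtain \<gamma> where g: "\<gamma> < \<kappa>" "|{..<\<gamma>}| =o |?I|" using small_cardinal[OF cardinal_kappa cI] by blast
  obtain h where h: "bij_betw h {..<\<gamma>} ?I" using g(2) card_of_ordIso by metis
  have hI: "h j \<in> ?I" if "j < \<gamma>" for j using h that by (auto simp: bij_betw_def)
  have inv: "inv_into {..<\<gamma>} h i < \<gamma> \<and> h (inv_into {..<\<gamma>} h i) = i" if "i \<in> ?I" for i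
    using bij_betw_imp_surj_on[OF h] inv_into_into[of i h "{..<\<gamma>}"] f_inv_into_f[of i h "{..<\<gamma>}"] that by auto
  let ?b = "\<lambda>j. if j < \<gamma> then Some (c (h j)) else None"
  have b: "?b \<in> seqs \<gamma> A"
  proof -
    have "c (h j) \<in> A" if "j < \<gamma>" for j using hI[OF that] c by auto
    thus ?thesis by (auto simp: seqs_def ran_def dom_def)
  qed
  have E: "?E \<subseteq> univ M \<union> B" using e by auto
  have EN: "x \<in> univ N" if "Inr x \<in> fvars \<phi>" for x using e[OF that] u(1) B by blast
  obtain d where d: "d \<in> seqs \<gamma> (univ M)" "same K0 (idx {..<\<gamma>} ?E) (asg ?b) N (asg d) N"
    using real[OF E cE g(1) b] by (elim bexE)
  let ?r = "map_sum (inv_into {..<\<gamma>} h) id"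
  have r: "?r ` fvars \<phi> \<subseteq> idx {..<\<gamma>} ?E"
  proof
    fix y assume "y \<in> ?r ` fvars \<phi>"
    then obtain x where "x \<in> fvars \<phi>" "y = ?r x" by blast
    thus "y \<in> idx {..<\<gamma>} ?E" using inv by (cases x rule: sum.exhaust) (auto simp: idx_def)
  qed
  have same: "same K0 (fvars \<phi>) (asg ?b \<circ> ?r) N (asg d \<circ> ?r) N" by (rule same_reindex[OF d(2) r])
  let ?d = "\<lambda>i. the (d (inv_into {..<\<gamma>} h i))"
  have dM: "?d i \<in> univ M" if "Inl i \<in> fvars \<phi>" for i
  proof -
    have "inv_into {..<\<gamma>} h i \<in> dom d" using inv[of i] that d(1) by (simp add: seqs_def)
    thus ?thesis using d(1) by (force simp: seqs_def ran_def)
  qed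
  have rd: "(asg d \<circ> ?r) x = with_params ?d x" for x by (cases x rule: sum.exhaust) auto
  have rb: "(asg ?b \<circ> ?r) x = with_params c x" if "x \<in> fvars \<phi>" for x
    using that inv by (cases x rule: sum.exhaust) auto
  have dV: "with_params ?d x \<in> univ N" if "x \<in> fvars \<phi>" for x
    using that subsetD[OF u(1) dM] EN by (cases x rule: sum.exhaust) auto
  have cV: "with_params c x \<in> univ N" if "x \<in> fvars \<phi>" for x
    using that subsetD[OF A c] EN by (cases x rule: sum.exhaust) auto
  have "sat (H N) (with_params c) \<phi> \<longleftrightarrow> sat (H N) (asg ?b \<circ> ?r) \<phi>" by (rule sat_cong) (use rb in simp)
  moreover have "sat (H N) (asg ?b \<circ> ?r) \<phi> \<longleftrightarrow> sat (H N) (asg d \<circ> ?r) \<phi>"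
  proof (rule sat_same[OF same u(2,2) _ _ wf subset_refl])
    show "(asg d \<circ> ?r) ` fvars \<phi> \<subseteq> univ N" using rd dV by (intro image_subsetI) simp
    show "(asg ?b \<circ> ?r) ` fvars \<phi> \<subseteq> univ N" using rb cV by (intro image_subsetI) (simp del: comp_apply)
  qed
  moreover have "sat (H N) (asg d \<circ> ?r) \<phi> \<longleftrightarrow> sat (H N) (with_params ?d) \<phi>" by (rule sat_cong) (rule rd)
  ultimately have "sat (H N) (with_params ?d) \<phi>" using s by blast
  thus "realized M N \<phi>"
    using dM by (intro exI[of _ ?d] conjI allI impI)
qed

lemma asg_seqs: "b \<in> seqs \<gamma> X \<Longrightarrow> D \<subseteq> X \<Longrightarrow> asg b ` idx {..<\<gamma>} D \<subseteq> X"
  using asg_idx[of b X D] by (simp add: seqs_def)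

text \<open>Here all parameters lie in M, so the required copies are given by the saturation of
  M.\<close>

lemma left_existence:
  assumes MN: "leq K M N" and A: "A \<subseteq> univ N" shows "indep' M N A (univ M)"
proof (rule indep_of_same[OF MN A])
  have u: "univ M \<subseteq> univ N" "leq K0 M N" "M \<in> mods K" using MN leq_univ by (auto simp: leq_K)
  show "univ M \<subseteq> univ N" by fact
  fix D \<gamma> b assume D: "D \<subseteq> univ M \<union> univ M" "few D" and g: "\<gamma> < \<kappa>" and b: "b \<in> seqs \<gamma> A"
  have DM: "D \<subseteq> univ M" using D(1) by blast
  have b': "b \<in> seqs \<gamma> (univ N)" by (rule seqs_mono[OF b A])
  have "leq K0 M N \<and> D \<subseteq> univ M \<and> few D \<and> \<gamma> < \<kappa> \<and> b \<in> seqs \<gamma> (univ N)"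
    using u(2) DM D(2) g b' by simp
  then obtain c where c: "c \<in> seqs \<gamma> (univ M)" "same K0 (idx {..<\<gamma>} D) (asg c) M (asg b) N"
    using u(3)[unfolded mods_K saturated_iff] by metis
  have "same K0 (idx {..<\<gamma>} D) (asg b) N (asg c) N"
    using same_trans[OF same_sym[OF c(2)] same_leq[OF u(2)] asg_seqs[OF c(1) DM]] .
  thus "\<exists>c\<in>seqs \<gamma> (univ M). same K0 (idx {..<\<gamma>} D) (asg b) N (asg c) N" using c(1) by (intro bexI)
qed

lemma indep_subset:
  assumes "indep' M N A B" "A0 \<subseteq> A" "B0 \<subseteq> B" shows "indep' M N A0 B0"
proof (rule indepI)
  show "leq K M N" "A0 \<subseteq> univ N" "B0 \<subseteq> univ N" using indep_basic[OF assms(1)] assms(2,3) by auto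
  fix \<phi> c assume "qf \<phi>" "\<And>i. Inl i \<in> fvars \<phi> \<Longrightarrow> c i \<in> A0"
    "\<And>e. Inr e \<in> fvars \<phi> \<Longrightarrow> e \<in> univ M \<union> B0" "sat (H N) (with_params c) \<phi>"
  thus "realized M N \<phi>"
    using assms(2,3) by (intro indepD[OF assms(1)]) blast+
qed

lemma indep_set_witness:
  "indep' M N A B \<longleftrightarrow>
     (\<forall>A0 B0. A0 \<subseteq> A \<and> B0 \<subseteq> B \<and> few A0 \<and> few B0 \<longrightarrow> indep' M N A0 B0)"
  (is "?L \<longleftrightarrow> ?R")
proof
  assume ?L
  thus ?R using indep_subset by blast
next
  assume R: ?R
  have fin: "few F" if "finite F" for F :: "'u set" using card_finite_less[OF infinite_kappa that] .
  \<comment> \<open>Finite sets are small, and singletons already show that A and B lie in N. Only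
    the coheir clause needs the sets mentioned by a formula.\<close>
  have pt: "indep' M N F G" if "finite F" "finite G" "F \<subseteq> A" "G \<subseteq> B" for F G
    using R that fin by blast
  show ?L
  proof (rule indepI)
    show "leq K M N" using indep_basic(1)[OF pt[of "{}" "{}"]] by simp
    show "A \<subseteq> univ N" using indep_basic(2)[OF pt[of "{x}" "{}" for x]] by auto
    show "B \<subseteq> univ N" using indep_basic(3)[OF pt[of "{}" "{x}" for x]] by auto
    fix \<phi> c assume q: "qf \<phi>" and c: "\<And>i. Inl i \<in> fvars \<phi> \<Longrightarrow> c i \<in> A"
      and e: "\<And>e. Inr e \<in> fvars \<phi> \<Longrightarrow> e \<in> univ M \<union> B" and s: "sat (H N) (with_params c) \<phi>"
    have fv: "few (fvars \<phi>)" using q by (simp add: qf_formula_def)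
    let ?A = "c ` {i. Inl i \<in> fvars \<phi>}" and ?B = "{e. Inr e \<in> fvars \<phi>} \<inter> B"
    have "|{i. Inl i \<in> fvars \<phi>}| \<le>o |fvars \<phi>|" by (rule card_of_ordLeqI[of Inl]) auto
    hence "|?A| \<le>o |fvars \<phi>|" by (rule ordLeq_transitive[OF card_of_image])
    hence cA: "few ?A" using fv by (rule ordLeq_ordLess_trans)
    have "|?B| \<le>o |fvars \<phi>|" by (rule card_of_ordLeqI[of Inr]) auto
    hence cB: "few ?B" using fv by (rule ordLeq_ordLess_trans)
    have sub: "?A \<subseteq> A" "?B \<subseteq> B" using c by auto
    have "indep' M N ?A ?B" using R cA cB sub by blast
    thus "realized M N \<phi>"
      using e by (intro indepD[OF _ q _ _ s]) blast+
  qed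
qed

text \<open>The independence of A from B over M1 gives a witness in M1, which the independence of M1
  from B over M0 moves into M0; the parameters stay the same.\<close>

lemma strong_left_transitivity:
  assumes "leq K M0 M1" "indep' M0 N (univ M1) B" "indep' M1 N A B"
  shows "indep' M0 N A B"
proof (rule indepI)
  show "leq K M0 N" "A \<subseteq> univ N" "B \<subseteq> univ N" using indep_basic[OF assms(2)] indep_basic[OF assms(3)] by auto
  have u: "univ M0 \<subseteq> univ M1" using assms(1) leq_univ by (auto simp: leq_K)
  fix \<phi> c assume q: "qf \<phi>" and c: "\<And>i. Inl i \<in> fvars \<phi> \<Longrightarrow> c i \<in> A"
    and e: "\<And>e. Inr e \<in> fvars \<phi> \<Longrightarrow> e \<in> univ M0 \<union> B" and s: "sat (H N) (with_params c) \<phi>"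
  obtain d where d: "\<forall>i. Inl i \<in> fvars \<phi> \<longrightarrow> d i \<in> univ M1" "sat (H N) (with_params d) \<phi>"
    using indepD[OF assms(3) q c _ s] e u by blast
  thus "realized M0 N \<phi>"
    using indepD[OF assms(2) q _ e d(2)] by blast
qed

end

subsection \<open>Symmetry and uniqueness\<close>

context saturated_setup begin

text \<open>Along an ordering of length \<open>\<kappa>\<close> choose \<open>a\<^sub>i\<close>, \<open>d\<^sub>i\<close> in \<open>M\<close> so that \<open>\<phi>(a\<^sub>j, d\<^sub>i)\<close> holds iff \<open>j \<le> i\<close>:
  \<open>a\<^sub>i\<close> satisfies \<open>\<phi>(x, b)\<close> and refutes all earlier instances, \<open>d\<^sub>i\<close> imitates \<open>b\<close> over \<open>a\<^sub>j\<close>, \<open>j \<le> i\<close>.\<close>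

lemma order_property_criterion:
  fixes \<phi> :: "('s + ('s, 'u) gtype, 'u, 'v) fm" and Q :: "('v \<Rightarrow> 'u) set"
  assumes MN: "leq K M N" and q: "qf \<phi>"
    and Q: "\<And>d z. d \<in> Q \<Longrightarrow> z \<in> fvars \<phi> - X \<Longrightarrow> d z \<in> univ M"
    and i1: "\<And>B. B \<subseteq> Q \<Longrightarrow> few B \<Longrightarrow> \<exists>a. (\<forall>z\<in>fvars \<phi> \<inter> X. a z \<in> univ M) \<and>
       sat (H N) (comb X a b) \<phi> \<and> (\<forall>d\<in>B. \<not> sat (H N) (comb X a d) \<phi>)"
    and i2: "\<And>F. few F \<Longrightarrow> \<forall>a\<in>F. (\<forall>z\<in>fvars \<phi> \<inter> X. a z \<in> univ M) \<and> sat (H N) (comb X a b) \<phi> \<Longrightarrow>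
       \<exists>d\<in>Q. \<forall>a\<in>F. sat (H N) (comb X a d) \<phi>"
  shows "syntactic_order_property \<kappa> K"
proof -
  let ?good = "\<lambda>a. \<forall>z\<in>fvars \<phi> \<inter> X. a z \<in> univ M"
  let ?s = "\<lambda>a d. sat (H N) (comb X a d) \<phi>"
  \<comment> \<open>The pair r consists of \<open>a\<^sub>i\<close> and \<open>d\<^sub>i\<close>.
    That \<open>a\<^sub>i\<close> satisfies \<phi>(x, b) is carried along because \<open>i2\<close>
    asks it of all earlier choices; the last clause settles the diagonal.\<close>
  let ?P = "\<lambda>f i r. i < \<kappa> \<longrightarrow> ?good (fst r) \<and> ?s (fst r) b \<and> (\<forall>j<i. \<not> ?s (fst r) (snd (f j))) \<and>
     snd r \<in> Q \<and> (\<forall>j<i. ?s (fst (f j)) (snd r)) \<and> ?s (fst r) (snd r)"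
  have "\<exists>f. \<forall>i. ?P f i (f i)"
  proof (rule dependent_wellorder_choice)
    fix r :: "('v \<Rightarrow> 'u) \<times> ('v \<Rightarrow> 'u)" and f g :: "'u \<Rightarrow> ('v \<Rightarrow> 'u) \<times> ('v \<Rightarrow> 'u)" and i :: 'u
    assume "\<And>j. j < i \<Longrightarrow> f j = g j"
    thus "?P f i r = ?P g i r" by simp
  next
    fix i :: 'u and f :: "'u \<Rightarrow> ('v \<Rightarrow> 'u) \<times> ('v \<Rightarrow> 'u)"
    assume *: "\<And>j. j < i \<Longrightarrow> ?P f j (f j)"
    show "\<exists>r. ?P f i r"
    proof (cases "i < \<kappa>")
      case True
      have ji: "?P f j (f j)" "j < \<kappa>" if "j < i" for j using *[OF that] that True by auto
      have ci: "few {..<i}" using True cardinal_kappa by (simp add: is_cardinal_less_iff)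
      have cB: "few ((\<lambda>j. snd (f j)) ` {..<i})" by (rule ordLeq_ordLess_trans[OF card_of_image ci])
      have BQ: "(\<lambda>j. snd (f j)) ` {..<i} \<subseteq> Q" using ji by auto
      obtain a where a: "?good a" "?s a b" "\<forall>d\<in>(\<lambda>j. snd (f j)) ` {..<i}. \<not> ?s a d"
        using i1[OF BQ cB] by (elim exE conjE)
      let ?F = "insert a ((\<lambda>j. fst (f j)) ` {..<i})"
      have "few ((\<lambda>j. fst (f j)) ` {..<i})" by (rule ordLeq_ordLess_trans[OF card_of_image ci])
      hence "few ({a} \<union> (\<lambda>j. fst (f j)) ` {..<i})"
        using card_of_Un_ordLess_infinite[OF infinite_kappa card_finite_less[OF infinite_kappa, of "{a}"]] by simp
      hence cF: "few ?F" by simp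
      have F: "\<forall>a\<in>?F. ?good a \<and> ?s a b" using a ji by auto
      obtain d where d: "d \<in> Q" "\<forall>a\<in>?F. ?s a d" using i2[OF cF F] by (elim bexE)
      have "?P f i (a, d)" using a d by simp
      thus ?thesis by (intro exI[of _ "(a, d)"])
    qed simp
  qed
  then obtain f where f: "\<forall>i. ?P f i (f i)" by (elim exE)
  let ?a = "\<lambda>i. fst (f i)" and ?d = "\<lambda>i. snd (f i)"
  have good: "?good (?a i)" and dQ: "?d i \<in> Q" if "i < \<kappa>" for i using f[rule_format, of i] that by auto
  have ord: "?s (?a j) (?d i) \<longleftrightarrow> j \<le> i" if "i < \<kappa>" "j < \<kappa>" for i j
  proof (cases j i rule: linorder_cases)
    case less
    thus ?thesis using f[rule_format, of i] that by auto
  next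
    case equal
    thus ?thesis using f[rule_format, of i] that by auto
  next
    case greater
    thus ?thesis using f[rule_format, of j] that by auto
  qed
  have fv: "few (fvars \<phi>)" and wf: "wfq \<phi>" using q by (auto simp: qf_formula_def)
  obtain \<gamma> where g: "\<gamma> < \<kappa>" "is_cardinal \<gamma>" "|{..<\<gamma>}| =o |fvars \<phi>|" using small_cardinal[OF cardinal_kappa fv] by blast
  obtain e where e: "bij_betw e {..<\<gamma>} (fvars \<phi>)" using g(3) card_of_ordIso by metis
  let ?e = "inv_into {..<\<gamma>} e"
  have ein: "e k \<in> fvars \<phi>" if "k < \<gamma>" for k using e that by (auto simp: bij_betw_def)
  have inv: "?e z < \<gamma> \<and> e (?e z) = z" if "z \<in> fvars \<phi>" for z
    using bij_betw_imp_surj_on[OF e] inv_into_into[of z e "{..<\<gamma>}"] f_inv_into_f[of z e "{..<\<gamma>}"] that by auto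
  \<comment> \<open>Each tuple carries both \<open>a\<^sub>i\<close> and \<open>d\<^sub>i\<close>,
    laid out along an enumeration e of the variables of \<phi>.\<close>
  define s where "s i = (\<lambda>k. if k < \<gamma> then Some (comb X (?a i) (?d i) (e k)) else None)" for i
  have cM: "comb X (?a j) (?d i) z \<in> univ M" if "i < \<kappa>" "j < \<kappa>" "z \<in> fvars \<phi>" for i j z
    using good[OF that(2)] Q[OF dQ[OF that(1)]] that(3) by (auto simp: comb_def)
  have seq: "s i \<in> seqs \<gamma> (univ M)" if "i < \<kappa>" for i
    using cM[OF that that] ein by (auto simp: s_def seqs_def ran_def dom_def)
  \<comment> \<open>X-variables read the second tuple and the others the first, so the renamed
    formula says \<phi>(\<open>a\<^sub>j\<close>, \<open>d\<^sub>i\<close>); its negation turns j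
    \<le> i into i < j.\<close>
  let ?r = "\<lambda>z. if z \<in> X then Inr (?e z) else Inl (?e z)"
  let ?\<psi> = "Neg (map_fm ?r \<phi>)"
  have "qf ?\<psi>" by (intro qf_formula_Neg qf_formula_map q)
  moreover have "fvars ?\<psi> \<subseteq> Inl ` {..<\<gamma>} \<union> Inr ` {..<\<gamma>}"
    using inv by (auto simp: fm.set_map)
  moreover have "sat (H M) (case_sum (\<lambda>k. the (s i k)) (\<lambda>k. the (s j k))) ?\<psi> \<longleftrightarrow> i < j" if ij: "i < \<kappa>" "j < \<kappa>" for i j
  proof -
    have "sat (H M) (case_sum (\<lambda>k. the (s i k)) (\<lambda>k. the (s j k))) (map_fm ?r \<phi>) \<longleftrightarrow> sat (H M) (comb X (?a j) (?d i)) \<phi>"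
      unfolding sat_map by (rule sat_cong) (use inv in \<open>auto simp: s_def comb_def\<close>)
    also have "\<dots> \<longleftrightarrow> ?s (?a j) (?d i)"
      using sat_leq[OF MN wf, of "comb X (?a j) (?d i)"] cM[OF ij] by auto
    also have "\<dots> \<longleftrightarrow> j \<le> i" by (rule ord[OF ij])
    finally show ?thesis by auto
  qed
  moreover have "M \<in> mods K" using MN by (simp add: leq_K)
  ultimately show ?thesis unfolding syntactic_order_property_def using g seq
    by (intro bexI[of _ M] exI[of _ \<gamma>] conjI exI[of _ s] exI[of _ ?\<psi>]) auto
qed

text \<open>Suppose \<phi>(a, b) holds with a from A and b from B, but no tuple of M can replace b.
  Then \<phi>(a, d) fails for every d in M. The coheir assumption gives \<open>a\<^sub>i\<close> in
  M imitating a over b and the earlier \<open>d\<^sub>j\<close>; left existence gives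
  \<open>d\<^sub>i\<close> imitating b over the chosen \<open>a\<^sub>j\<close>.\<close>

lemma indep_sym:
  assumes nop: "\<not> syntactic_order_property \<kappa> K" and ind: "indep' M N A B"
  shows "indep' M N B A"
proof (rule indepI)
  note b = indep_basic[OF ind]
  show "leq K M N" "B \<subseteq> univ N" "A \<subseteq> univ N" using b by auto
  fix \<phi> c assume q: "qf \<phi>" and c: "\<And>i. Inl i \<in> fvars \<phi> \<Longrightarrow> c i \<in> B"
    and e: "\<And>e. Inr e \<in> fvars \<phi> \<Longrightarrow> e \<in> univ M \<union> A" and s: "sat (H N) (with_params c) \<phi>"
  show "realized M N \<phi>"
  proof (rule ccontr)
    assume none: "\<not> ?thesis"
    \<comment> \<open>Parameters of \<phi> outside M belong to A and are to be moved. Those in M are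
      kept, which is why \<open>Q\<close> makes d leave them unchanged.\<close>
    let ?X = "{Inr e |e. e \<notin> univ M} :: ('u + 'u) set"
    let ?Y = "range Inl :: ('u + 'u) set"
    let ?b = "with_params c"
    define Q where "Q = {d. (\<forall>z\<in>fvars \<phi> - ?X. d z \<in> univ M) \<and> (\<forall>e. Inr e \<in> fvars \<phi> \<and> e \<in> univ M \<longrightarrow> d (Inr e) = e)}"
    have aA: "?b z \<in> A" if "z \<in> fvars \<phi> \<inter> ?X" for z using that e by fastforce
    have bB: "?b z \<in> univ M \<union> B" if "z \<in> fvars \<phi> - ?X" for z using that c by (cases z rule: sum.exhaust) auto
    have bb: "comb ?X ?b ?b = ?b" by (auto simp: comb_def)
    have neg: "\<not> sat (H N) (comb ?X ?b d) \<phi>" if d: "d \<in> Q" for d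
    proof
      assume st: "sat (H N) (comb ?X ?b d) \<phi>"
      have "sat (H N) (with_params (\<lambda>i. d (Inl i))) \<phi> \<longleftrightarrow> sat (H N) (comb ?X ?b d) \<phi>"
      proof (rule sat_cong)
        fix x assume "x \<in> fvars \<phi>"
        thus "with_params (\<lambda>i. d (Inl i)) x = comb ?X ?b d x"
          using d by (cases x rule: sum.exhaust) (auto simp: comb_def Q_def)
      qed
      moreover have "\<forall>i. Inl i \<in> fvars \<phi> \<longrightarrow> d (Inl i) \<in> univ M" using d by (auto simp: Q_def)
      ultimately show False using none st by (metis (no_types, lifting))
    qed
    have "syntactic_order_property \<kappa> K"
    proof (rule order_property_criterion[OF b(1) q])
      show "d z \<in> univ M" if "d \<in> Q" "z \<in> fvars \<phi> - ?X" for d z using that by (auto simp: Q_def)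
    next
      fix D assume D: "D \<subseteq> Q" "few D"
      have cS: "few ({?b} \<union> D)"
        by (intro card_of_Un_ordLess_infinite[OF infinite_kappa] card_finite_less[OF infinite_kappa] D(2)) simp
      have "\<exists>a'. (\<forall>z\<in>fvars \<phi> \<inter> ?X. a' z \<in> univ M) \<and>
        (\<forall>d\<in>{?b} \<union> D. sat (H N) (comb ?X ?b d) \<phi> \<longleftrightarrow> sat (H N) (comb ?X a' d) \<phi>)"
      proof (rule indep_simul[OF ind q aA cS])
        fix d z assume "d \<in> {?b} \<union> D" "z \<in> fvars \<phi> - ?X"
        thus "d z \<in> univ M \<union> B" using bB D(1) by (auto simp: Q_def)
      qed
      then obtain a' where a': "\<forall>z\<in>fvars \<phi> \<inter> ?X. a' z \<in> univ M"
        "\<forall>d\<in>{?b} \<union> D. sat (H N) (comb ?X ?b d) \<phi> \<longleftrightarrow> sat (H N) (comb ?X a' d) \<phi>" by (elim exE conjE)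
      have "sat (H N) (comb ?X a' ?b) \<phi>" using a'(2) s bb by simp
      moreover have "\<forall>d\<in>D. \<not> sat (H N) (comb ?X a' d) \<phi>" using a'(2) neg D(1) by blast
      ultimately show "\<exists>a. (\<forall>z\<in>fvars \<phi> \<inter> ?X. a z \<in> univ M) \<and> sat (H N) (comb ?X a ?b) \<phi> \<and>
        (\<forall>d\<in>D. \<not> sat (H N) (comb ?X a d) \<phi>)" using a'(1) by (intro exI[of _ a'] conjI)
    next
      fix F assume cF: "few F" and F: "\<forall>a\<in>F. (\<forall>z\<in>fvars \<phi> \<inter> ?X. a z \<in> univ M) \<and> sat (H N) (comb ?X a ?b) \<phi>"
      have cS: "few ((\<lambda>a. comb ?X a ?b) ` F)" by (rule ordLeq_ordLess_trans[OF card_of_image cF])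
      have "\<exists>a'. (\<forall>z\<in>fvars \<phi> \<inter> ?Y. a' z \<in> univ M) \<and>
        (\<forall>d\<in>(\<lambda>a. comb ?X a ?b) ` F. sat (H N) (comb ?Y ?b d) \<phi> \<longleftrightarrow> sat (H N) (comb ?Y a' d) \<phi>)"
      \<comment> \<open>The roles change: now the values in B are moved into M, while the tuples of
        F, already in M, serve as parameters.\<close>
      proof (rule indep_simul[OF left_existence[OF b(1) b(3)] q _ cS])
        show "?b z \<in> B" if "z \<in> fvars \<phi> \<inter> ?Y" for z using that c by auto
        fix d z assume "d \<in> (\<lambda>a. comb ?X a ?b) ` F" and z: "z \<in> fvars \<phi> - ?Y"
        then obtain a where a: "a \<in> F" "d = comb ?X a ?b" by blast
        show "d z \<in> univ M \<union> univ M" using z a F by (cases z rule: sum.exhaust) (auto simp: comb_def)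
      qed
      then obtain a' where a': "\<forall>z\<in>fvars \<phi> \<inter> ?Y. a' z \<in> univ M"
        "\<forall>d\<in>(\<lambda>a. comb ?X a ?b) ` F. sat (H N) (comb ?Y ?b d) \<phi> \<longleftrightarrow> sat (H N) (comb ?Y a' d) \<phi>" by (elim exE conjE)
      let ?d = "comb ?Y a' ?b"
      have dQ: "?d \<in> Q" unfolding Q_def
      proof (intro CollectI conjI ballI allI impI)
        fix z assume "z \<in> fvars \<phi> - ?X"
        thus "?d z \<in> univ M" using a'(1) by (cases z rule: sum.exhaust) (auto simp: comb_def)
      qed (auto simp: comb_def)
      moreover have "sat (H N) (comb ?X a ?d) \<phi>" if a: "a \<in> F" for a
      proof -
        have 1: "comb ?Y ?b (comb ?X a ?b) = comb ?X a ?b" by (rule ext) (auto simp: comb_def)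
        have 2: "comb ?Y a' (comb ?X a ?b) = comb ?X a ?d" by (rule ext) (auto simp: comb_def)
        have "sat (H N) (comb ?Y ?b (comb ?X a ?b)) \<phi> \<longleftrightarrow> sat (H N) (comb ?Y a' (comb ?X a ?b)) \<phi>"
          using a'(2) a by blast
        thus ?thesis unfolding 1 2 using F a by blast
      qed
      ultimately show "\<exists>d\<in>Q. \<forall>a\<in>F. sat (H N) (comb ?X a d) \<phi>" by (intro bexI[of _ ?d] ballI)
    qed
    thus False using nop by blast
  qed
qed

lemma strong_right_transitivity:
  assumes nop: "\<not> syntactic_order_property \<kappa> K" and "leq K M0 M1" "indep' M0 N A (univ M1)" "indep' M1 N A B"
  shows "indep' M0 N A B"
  using indep_sym[OF nop strong_left_transitivity[OF assms(2) indep_sym[OF nop assms(3)] indep_sym[OF nop assms(4)]]] .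

text \<open>Suppose \<phi>(\<open>c\<^sub>1\<close>, b) holds and \<phi>(\<open>c\<^sub>2\<close>,
  b) fails, with b from B. Symmetry gives \<open>d\<^sub>i\<close> in M0 imitating b over
  \<open>c\<^sub>1\<close> and the chosen \<open>a\<^sub>j\<close>. By agreement over M0,
  \<phi>(\<open>c\<^sub>2\<close>, \<open>d\<^sub>i\<close>) holds as well, so the coheir assumption
  on \<open>c\<^sub>2\<close> gives a later \<open>a\<^sub>j\<close> with
  \<phi>(\<open>a\<^sub>j\<close>, \<open>d\<^sub>i\<close>) but not
  \<phi>(\<open>a\<^sub>j\<close>, b). The negation of \<phi> is thereby ordered.\<close>

lemma type_inclusion:
  assumes nop: "\<not> syntactic_order_property \<kappa> K"
    and ind1: "indep' M0 N1 (ran c1) B" and ind2: "indep' M0 N2 (ran c2) B"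
    and M: "leq K M N1" "leq K M N2" "univ M0 \<subseteq> B" "B \<subseteq> univ M" and dom: "dom c1 = dom c2"
    and eq: "\<And>\<psi>. qf \<psi> \<Longrightarrow> fvars \<psi> \<subseteq> idx (dom c1) (univ M0) \<Longrightarrow>
        sat (H N1) (asg c1) \<psi> \<Longrightarrow> sat (H N2) (asg c2) \<psi>"
    and q: "qf \<phi>" "fvars \<phi> \<subseteq> idx (dom c1) B" "sat (H N1) (asg c1) \<phi>"
  shows "sat (H N2) (asg c2) \<phi>"
proof (rule ccontr)
  assume neg: "\<not> sat (H N2) (asg c2) \<phi>"
  note b1 = indep_basic[OF ind1] and b2 = indep_basic[OF ind2]
  have wf: "wfq \<phi>" using q(1) by (simp add: qf_formula_def)
  let ?X = "range Inl :: ('u + 'u) set" and ?b = "asg c2"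
  have bz: "?b z \<in> B \<and> asg c1 z = ?b z" if "z \<in> fvars \<phi> - ?X" for z
    using that q(2) by (cases z rule: sum.exhaust) (auto simp: idx_def)
  have cz: "asg c1 z \<in> ran c1" "asg c2 z \<in> ran c2" if z: "z \<in> fvars \<phi> \<inter> ?X" for z
  proof -
    obtain i where i: "z = Inl i" using z by blast
    hence "Inl i \<in> idx (dom c1) B" using z q(2) by blast
    hence "i \<in> dom c1" "i \<in> dom c2" using dom by (auto simp: idx_def)
    with i show "asg c1 z \<in> ran c1" "asg c2 z \<in> ran c2" by (auto intro: ranI)
  qed
  have comb1: "comb ?X (asg c1) ?b z = asg c1 z" if "z \<in> fvars \<phi>" for z using bz that by (auto simp: comb_def)
  \<comment> \<open>Membership is a statement about \<open>c1\<close>, which is what symmetry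
    produces; agreement over M0 transfers it to \<open>c2\<close>, where it is used.\<close>
  define Q where "Q = {d. (\<forall>z\<in>fvars \<phi> - ?X. d z \<in> univ M0) \<and> sat (H N1) (comb ?X (asg c1) d) \<phi>}"
  have Q2: "sat (H N2) (comb ?X (asg c2) d) \<phi>" if d: "d \<in> Q" for d
  proof -
    let ?r = "\<lambda>z. if z \<in> ?X then z else Inr (d z)"
    have r: "sat S (asg c) (map_fm ?r \<phi>) \<longleftrightarrow> sat S (comb ?X (asg c) d) \<phi>" for S c
      unfolding sat_map by (rule sat_cong) (auto simp: comb_def)
    have "fvars (map_fm ?r \<phi>) \<subseteq> idx (dom c1) (univ M0)"
    proof
      fix y assume "y \<in> fvars (map_fm ?r \<phi>)"
      then obtain z where z: "z \<in> fvars \<phi>" "y = ?r z" unfolding fm.set_map by blast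
      show "y \<in> idx (dom c1) (univ M0)"
      proof (cases "z \<in> ?X")
        case True
        thus ?thesis using z q(2) by (auto simp: idx_def)
      next
        case False
        thus ?thesis using z d by (auto simp: idx_def Q_def)
      qed
    qed
    from eq[OF qf_formula_map[OF q(1)] this] show ?thesis using r d by (auto simp: Q_def)
  qed
  have "syntactic_order_property \<kappa> K"
  proof (rule order_property_criterion[OF b2(1) qf_formula_Neg[OF q(1)]])
    show "d z \<in> univ M0" if "d \<in> Q" "z \<in> fvars (Neg \<phi>) - ?X" for d z using that by (simp add: Q_def)
  next
    fix D assume D: "D \<subseteq> Q" "few D"
    have cS: "few ({?b} \<union> D)"
      by (intro card_of_Un_ordLess_infinite[OF infinite_kappa] card_finite_less[OF infinite_kappa] D(2)) simp
    have "\<exists>a'. (\<forall>z\<in>fvars \<phi> \<inter> ?X. a' z \<in> univ M0) \<and>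
      (\<forall>d\<in>{?b} \<union> D. sat (H N2) (comb ?X (asg c2) d) \<phi> \<longleftrightarrow> sat (H N2) (comb ?X a' d) \<phi>)"
    proof (rule indep_simul[OF ind2 q(1) cz(2) cS])
      fix d z assume "d \<in> {?b} \<union> D" "z \<in> fvars \<phi> - ?X"
      thus "d z \<in> univ M0 \<union> B" using bz D(1) by (auto simp: Q_def)
    qed
    then obtain a' where a': "\<forall>z\<in>fvars \<phi> \<inter> ?X. a' z \<in> univ M0"
      "\<forall>d\<in>{?b} \<union> D. sat (H N2) (comb ?X (asg c2) d) \<phi> \<longleftrightarrow> sat (H N2) (comb ?X a' d) \<phi>" by (elim exE conjE)
    have "comb ?X (asg c2) ?b = asg c2" by (auto simp: comb_def)
    hence "\<not> sat (H N2) (comb ?X a' ?b) \<phi>" using a'(2) neg by simp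
    moreover have "\<forall>d\<in>D. sat (H N2) (comb ?X a' d) \<phi>" using a'(2) Q2 D(1) by blast
    ultimately show "\<exists>a. (\<forall>z\<in>fvars (Neg \<phi>) \<inter> ?X. a z \<in> univ M0) \<and> sat (H N2) (comb ?X a ?b) (Neg \<phi>) \<and>
      (\<forall>d\<in>D. \<not> sat (H N2) (comb ?X a d) (Neg \<phi>))" using a'(1) by (intro exI[of _ a']) simp
  next
    fix F assume cF: "few F"
      and F: "\<forall>a\<in>F. (\<forall>z\<in>fvars (Neg \<phi>) \<inter> ?X. a z \<in> univ M0) \<and> sat (H N2) (comb ?X a ?b) (Neg \<phi>)"
    have cS: "few ({asg c1} \<union> F)"
      by (intro card_of_Un_ordLess_infinite[OF infinite_kappa] card_finite_less[OF infinite_kappa] cF) simp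
    have "\<exists>d. (\<forall>z\<in>fvars \<phi> \<inter> - ?X. d z \<in> univ M0) \<and>
      (\<forall>s\<in>{asg c1} \<union> F. sat (H N1) (comb (- ?X) ?b s) \<phi> \<longleftrightarrow> sat (H N1) (comb (- ?X) d s) \<phi>)"
    proof (rule indep_simul[OF indep_sym[OF nop ind1] q(1) _ cS])
      show "?b z \<in> B" if "z \<in> fvars \<phi> \<inter> - ?X" for z using that bz by blast
      show "s z \<in> univ M0 \<union> ran c1" if "s \<in> {asg c1} \<union> F" "z \<in> fvars \<phi> - - ?X" for s z
        using that cz(1) F by auto
    qed
    then obtain d where d: "\<forall>z\<in>fvars \<phi> \<inter> - ?X. d z \<in> univ M0"
      "\<forall>s\<in>{asg c1} \<union> F. sat (H N1) (comb ?X s ?b) \<phi> \<longleftrightarrow> sat (H N1) (comb ?X s d) \<phi>"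
      unfolding comb_compl by (elim exE conjE)
    have "sat (H N1) (comb ?X (asg c1) ?b) \<phi> \<longleftrightarrow> sat (H N1) (asg c1) \<phi>" by (rule sat_cong) (rule comb1)
    hence "d \<in> Q" unfolding Q_def using d q(3) by auto
    moreover have "\<not> sat (H N2) (comb ?X a d) \<phi>" if a: "a \<in> F" for a
    proof -
      have aM: "a z \<in> univ M0" if "z \<in> fvars \<phi> \<inter> ?X" for z using F a that by auto
      have v: "comb ?X a ?b ` fvars \<phi> \<subseteq> univ M"
        using aM bz M(3,4) by (auto simp: comb_def)
      \<comment> \<open>The values of a and b lie in M, which is a strong submodel of both N1 and
        N2, so \<phi>(a, b) has the same truth value in both.\<close>
      have "sat (H N1) (comb ?X a ?b) \<phi> \<longleftrightarrow> sat (H N2) (comb ?X a ?b) \<phi>"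
        using sat_leq[OF M(1) wf v] sat_leq[OF M(2) wf v] by simp
      hence "\<not> sat (H N1) (comb ?X a d) \<phi>" using d(2) F a by auto
      moreover have w: "comb ?X a d ` fvars \<phi> \<subseteq> univ M0" using aM d(1) by (auto simp: comb_def)
      ultimately show ?thesis using sat_leq[OF b1(1) wf w] sat_leq[OF b2(1) wf w] by simp
    qed
    ultimately show "\<exists>d\<in>Q. \<forall>a\<in>F. sat (H N2) (comb ?X a d) (Neg \<phi>)" by (intro bexI[of _ d] ballI) auto
  qed
  thus False using nop by blast
qed

lemma indep_of_coheir:
  assumes "leq K M0 N" "univ M0 \<subseteq> B" "B \<subseteq> univ N" "c \<in> seqs \<gamma> (univ N)" "coheir (H N) (univ M0) (tp c B (H N))"
  shows "indep' M0 N (ran c) B"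
proof -
  have "univ M0 \<union> B = B" using assms(2) by blast
  thus ?thesis unfolding indep_def using assms by (auto simp: leq_K seqs_def)
qed

lemma tp_qf_eqI:
  assumes nop: "\<not> syntactic_order_property \<kappa> K"
    and ind: "indep' M0 N1 (ran c1) B" "indep' M0 N2 (ran c2) B"
    and M: "leq K M N1" "leq K M N2" "univ M0 \<subseteq> B" "B \<subseteq> univ M" and dom: "dom c1 = dom c2"
    and eq: "\<And>\<psi>. qf \<psi> \<Longrightarrow> fvars \<psi> \<subseteq> idx (dom c1) (univ M0) \<Longrightarrow>
        sat (H N1) (asg c1) \<psi> \<longleftrightarrow> sat (H N2) (asg c2) \<psi>"
  shows "tp c1 B (H N1) = tp c2 B (H N2)"
proof -
  have "sat (H N1) (asg c1) \<phi> \<longleftrightarrow> sat (H N2) (asg c2) \<phi>"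
    if q: "qf \<phi>" and f: "fvars \<phi> \<subseteq> idx (dom c1) B" for \<phi>
  proof
    assume "sat (H N1) (asg c1) \<phi>"
    thus "sat (H N2) (asg c2) \<phi>" using eq by (intro type_inclusion[OF nop ind M dom _ q f]) auto
  next
    assume "sat (H N2) (asg c2) \<phi>"
    thus "sat (H N1) (asg c1) \<phi>" using eq f dom
      by (intro type_inclusion[OF nop ind(2,1) M(2,1,3,4) dom[symmetric] _ q]) auto
  qed
  thus ?thesis unfolding tp_qf_def idx_def[symmetric] dom by auto
qed

lemma syntactic_uniqueness:
  assumes nop: "\<not> syntactic_order_property \<kappa> K"
    and l: "leq K M0 M" "leq K M N1" "leq K M N2" "univ M0 \<subseteq> B" "B \<subseteq> univ M"
    and q1: "q1 \<in> S_qf \<kappa> V B (H N1)" and q2: "q2 \<in> S_qf \<kappa> V B (H N2)"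
    and r: "qf_restrict q1 (univ M0) = qf_restrict q2 (univ M0)"
    and coh: "coheir (H N1) (univ M0) q1" "coheir (H N2) (univ M0) q2"
  shows "q1 = q2"
proof -
  obtain c1 \<gamma>1 where c1: "q1 = tp c1 B (H N1)" "c1 \<in> seqs \<gamma>1 (univ N1)" using q1 by (auto simp: S_qf_def)
  obtain c2 \<gamma>2 where c2: "q2 = tp c2 B (H N2)" "c2 \<in> seqs \<gamma>2 (univ N2)" using q2 by (auto simp: S_qf_def)
  have m: "leq K M0 N1" "leq K M0 N2" "univ M \<subseteq> univ N1" "univ M \<subseteq> univ N2"
    using l leq_trans leq_univ by (auto simp: leq_K)
  have ind: "indep' M0 N1 (ran c1) B" "indep' M0 N2 (ran c2) B"
    using indep_of_coheir[OF m(1) l(4) _ c1(2)] indep_of_coheir[OF m(2) l(4) _ c2(2)] coh c1(1) c2(1) l(5) m(3,4) by auto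
  have rs: "qf_restrict (tp c B (H N)) (univ M0) =
      {\<psi>. qf \<psi> \<and> fvars \<psi> \<subseteq> idx (dom c) (univ M0) \<and> sat (H N) (asg c) \<psi>}" for c N
    unfolding qf_restrict_def tp_qf_def idx_def using l(4) by blast
  have r': "{\<psi>. qf \<psi> \<and> fvars \<psi> \<subseteq> idx (dom c1) (univ M0) \<and> sat (H N1) (asg c1) \<psi>} =
    {\<psi>. qf \<psi> \<and> fvars \<psi> \<subseteq> idx (dom c2) (univ M0) \<and> sat (H N2) (asg c2) \<psi>}"
    using r unfolding c1(1) c2(1) rs .
  \<comment> \<open>The index set is read off the restrictions: the formula saying that the i-th
    variable equals itself belongs to a type iff i is one of its indices.\<close>
  have dom: "dom c1 = dom c2"
  proof -
    have d: "i \<in> dom c \<longleftrightarrow> Equ (Var (Inl i)) (Var (Inl i)) \<in>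
      {\<psi>. qf \<psi> \<and> fvars \<psi> \<subseteq> idx (dom c) (univ M0) \<and> sat (H N) (asg c) \<psi>}" for i c N
    proof -
      have "qf (Equ (Var (Inl i)) (Var (Inl i)))" unfolding qf_formula_def
        using card_finite_less[OF infinite_kappa, of "{Inl i}"] by (auto intro: wf_fm.intros wf_tm.intros)
      thus ?thesis by (auto simp: idx_def)
    qed
    show ?thesis by (rule set_eqI) (simp only: d[of _ c1 N1] d[of _ c2 N2] r')
  qed
  have "sat (H N1) (asg c1) \<psi> \<longleftrightarrow> sat (H N2) (asg c2) \<psi>"
    if "qf \<psi>" "fvars \<psi> \<subseteq> idx (dom c1) (univ M0)" for \<psi>
    using eqset_imp_iff[OF r', of \<psi>] that dom by simp
  from tp_qf_eqI[OF nop ind l(2,3,4,5) dom this] show ?thesis unfolding c1(1) c2(1) .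
qed

end

subsection \<open>The cardinal \<open>(\<alpha> + 2)\<close> to the power below \<open>\<kappa>\<^sub>r\<close>\<close>

lemma card_Func_mono_dom:
  assumes "|A| \<le>o |B|" "X \<noteq> {}" shows "|Func A X| \<le>o |Func B X|"
proof -
  obtain h where h: "inj_on h A" "h ` A \<subseteq> B" using assms(1) card_of_ordLeq by metis
  obtain x where x: "x \<in> X" using assms(2) by blast
  show ?thesis
  proof (rule card_of_ordLeqI)
    let ?F = "\<lambda>f b. if b \<in> B then if b \<in> h ` A then f (inv_into A h b) else x else undefined"
    show "inj_on ?F (Func A X)"
    proof (rule inj_onI)
      fix f g assume f: "f \<in> Func A X" and g: "g \<in> Func A X" and e: "?F f = ?F g"
      show "f = g"
      proof
        fix a show "f a = g a"
        proof (cases "a \<in> A")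
          case True
          thus ?thesis using fun_cong[OF e, of "h a"] h by (auto simp: image_subset_iff)
        next
          case False
          thus ?thesis using f g by (simp add: Func_def)
        qed
      qed
    qed
    show "?F f \<in> Func B X" if "f \<in> Func A X" for f
      using that x h(1) by (auto simp: Func_def)
  qed
qed

context inaccessible begin

context
  fixes \<kappa> \<alpha> :: 'u
  assumes \<kappa>: "is_cardinal \<kappa>" "infinite {..<\<kappa>}"
begin

text \<open>\<open>base\<close> has \<alpha> + 2 elements, and \<open>bounded_funs\<close> is the
  disjoint sum of its powers with exponent below \<open>\<kappa>\<^sub>r\<close>. The sum shows that
  the \<open>LEAST\<close> defining \<open>mu\<close> is attained and bounds it from above.\<close>

abbreviation (input) "base \<equiv> {..<\<alpha>} <+> (UNIV :: bool set)"
abbreviation (input) "bounded_funs \<equiv> SIGMA x:{..<least_regular \<kappa>}. Func {..<x} base"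

lemmas kr = least_regular_props[OF \<kappa>]

lemma mu_exists: "\<exists>z::'u. |{..<z}| =o |bounded_funs| \<and> (\<forall>x<least_regular \<kappa>. |Func {..<x} base| \<le>o |{..<z}| )"
proof -
  have base: "|base| <o |UNIV :: 'u set|"
    by (rule card_of_Plus_ordLess_infinite[OF infinite_universe small_lessThan small_finite]) simp
  have "|bounded_funs| <o |UNIV :: 'u set|"
    by (rule small_Sigma[OF small_lessThan]) (rule small_Func[OF small_lessThan base])
  then obtain z :: 'u where z: "|{..<z}| =o |bounded_funs|" using small_ordinal by blast
  have "|Func {..<x} base| \<le>o |bounded_funs|" if "x < least_regular \<kappa>" for x
    by (rule card_of_ordLeqI[of "Pair x"]) (use that in \<open>auto simp: inj_on_def\<close>)
  hence "\<forall>x<least_regular \<kappa>. |Func {..<x} base| \<le>o |{..<z}|" using z ordLeq_ordIso_trans ordIso_symmetric by metis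
  thus ?thesis using z by blast
qed

lemma mu_least: "mu \<kappa> \<alpha> = (LEAST z. \<forall>x<least_regular \<kappa>. |Func {..<x} base| \<le>o |{..<z}| )"
  unfolding mu_def weak_power_def cexp_def csum_def ctwo_def by (simp add: Field_card_of)

lemma mu_ge_Func_lessThan: "x < least_regular \<kappa> \<Longrightarrow> |Func {..<x} base| \<le>o |{..<mu \<kappa> \<alpha>}|"
proof -
  obtain z :: 'u where "\<forall>x<least_regular \<kappa>. |Func {..<x} base| \<le>o |{..<z}|" using mu_exists by blast
  hence "\<forall>x<least_regular \<kappa>. |Func {..<x} base| \<le>o |{..<mu \<kappa> \<alpha>}|" unfolding mu_least by (rule LeastI)
  thus "x < least_regular \<kappa> \<Longrightarrow> |Func {..<x} base| \<le>o |{..<mu \<kappa> \<alpha>}|" by blast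
qed

lemma mu_le_bounded_funs: "|{..<mu \<kappa> \<alpha>}| \<le>o |bounded_funs|"
proof -
  obtain z :: 'u where z: "|{..<z}| =o |bounded_funs|" "\<forall>x<least_regular \<kappa>. |Func {..<x} base| \<le>o |{..<z}|" using mu_exists by blast
  have "mu \<kappa> \<alpha> \<le> z" unfolding mu_least using z(2) by (rule Least_le)
  hence "|{..<mu \<kappa> \<alpha>}| \<le>o |{..<z}|" by (rule card_of_lessThan_mono)
  thus ?thesis using z(1) by (rule ordLeq_ordIso_trans)
qed

lemma mu_ge_Func:
  assumes "|Y| <o |{..<least_regular \<kappa>}|" shows "|Func Y base| \<le>o |{..<mu \<kappa> \<alpha>}|"
proof -
  obtain x where x: "x < least_regular \<kappa>" "|{..<x}| =o |Y|" using small_cardinal[OF kr(2) assms] by blast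
  have "|Func Y base| =o |Func {..<x} base|" by (rule card_Func_cong[OF ordIso_symmetric[OF x(2)]])
  thus ?thesis using mu_ge_Func_lessThan[OF x(1)] by (rule ordIso_ordLeq_trans)
qed

lemma Pow_le_Func_base: "|Pow Y| \<le>o |Func Y base|"
proof -
  have "|Func Y (UNIV :: bool set)| \<le>o |Func Y base|" by (rule card_Func_mono[OF card_of_Plus2])
  thus ?thesis by (rule ordIso_ordLeq_trans[OF card_of_Pow_Func])
qed

lemma mu_ge_Pow:
  assumes "|Y| <o |{..<least_regular \<kappa>}|" shows "|Pow Y| \<le>o |{..<mu \<kappa> \<alpha>}|"
  by (rule ordLeq_transitive[OF Pow_le_Func_base mu_ge_Func[OF assms]])

text \<open>Otherwise \<open>mu\<close> would be an exponent below \<open>\<kappa>\<^sub>r\<close>,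
  and 2 to the power \<open>mu\<close> would be at most \<open>mu\<close>, against Cantor. The
  summand 2 in the base makes this work for every \<alpha>.\<close>

lemma mu_ge_kr: "|{..<least_regular \<kappa>}| \<le>o |{..<mu \<kappa> \<alpha>}|"
proof (rule ccontr)
  assume "\<not> |{..<least_regular \<kappa>}| \<le>o |{..<mu \<kappa> \<alpha>}|"
  hence "|{..<mu \<kappa> \<alpha>}| <o |{..<least_regular \<kappa>}|" using not_ordLess_ordLeq_card by blast
  hence "|Pow {..<mu \<kappa> \<alpha>}| \<le>o |{..<mu \<kappa> \<alpha>}|" by (rule mu_ge_Pow)
  thus False using card_of_Pow[of "{..<mu \<kappa> \<alpha>}"] not_ordLess_ordLeq by blast
qed

lemma mu_ge_kappa: "|{..<\<kappa>}| \<le>o |{..<mu \<kappa> \<alpha>}|"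
  by (rule ordLeq_transitive[OF card_of_lessThan_mono[OF kr(1)] mu_ge_kr])

lemma infinite_mu: "infinite {..<mu \<kappa> \<alpha>}"
  by (rule card_of_ordLeq_infinite[OF mu_ge_kappa \<kappa>(2)])

text \<open>The power with exponent 1 contains a copy of the base.\<close>

lemma mu_ge_alpha: "|{..<\<alpha>}| \<le>o |{..<mu \<kappa> \<alpha>}|"
proof -
  have "|{()}| <o |{..<least_regular \<kappa>}|" by (rule card_finite_less[OF kr(3)]) simp
  hence 1: "|Func {()} base| \<le>o |{..<mu \<kappa> \<alpha>}|" by (rule mu_ge_Func)
  have "|base| \<le>o |Func {()} base|"
    by (rule card_of_ordLeqI[of "\<lambda>w _. w"]) (auto simp: inj_on_def Func_def fun_eq_iff)
  thus ?thesis using 1 ordLeq_transitive card_of_Plus1 by metis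
qed

text \<open>By regularity of \<open>\<kappa>\<^sub>r\<close>, fewer than \<open>\<kappa>\<^sub>r\<close> bounded functions have a common bound \<open>\<delta>\<close>; coding
  \<open>undefined\<close> by an off-diagonal pair turns them into one function on \<open>Y \<times> \<delta>\<close>.\<close>

lemma mu_power_less:
  assumes Y: "|Y| <o |{..<least_regular \<kappa>}|" shows "|Func Y {..<mu \<kappa> \<alpha>}| \<le>o |{..<mu \<kappa> \<alpha>}|"
proof -
  let ?W = base
  define \<delta> where "\<delta> f = (SOME x. x < least_regular \<kappa> \<and> (\<forall>y\<in>Y. fst (f y) < x))" for f :: "'a \<Rightarrow> 'u \<times> ('u \<Rightarrow> 'u + bool)"
  have \<delta>: "\<delta> f < least_regular \<kappa> \<and> (\<forall>y\<in>Y. fst (f y) < \<delta> f)" if f: "f \<in> Func Y bounded_funs" for f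
  proof -
    have "(\<lambda>y. fst (f y)) ` Y \<subseteq> {..<least_regular \<kappa>}" using f unfolding Func_def by fastforce
    from regular_bounded[OF kr(2,3,4) Y this] show ?thesis unfolding \<delta>_def by (rule someI_ex)
  qed
  define code where "code f = (\<lambda>(y, \<eta>). if y \<in> Y \<and> \<eta> < \<delta> f then
     if \<eta> < fst (f y) then (snd (f y) \<eta>, snd (f y) \<eta>) else (Inr True, Inr False) else undefined)" for f
  have "|Func Y bounded_funs| \<le>o |SIGMA x:{..<least_regular \<kappa>}. Func (Y \<times> {..<x}) (?W \<times> ?W)|"
  proof (rule card_of_ordLeqI)
    show "inj_on (\<lambda>f. (\<delta> f, code f)) (Func Y bounded_funs)"
    proof (rule inj_onI)
      fix f g assume f: "f \<in> Func Y bounded_funs" and g: "g \<in> Func Y bounded_funs"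
        and e: "(\<delta> f, code f) = (\<delta> g, code g)"
      have d: "\<delta> f = \<delta> g" and c: "\<And>y \<eta>. code f (y, \<eta>) = code g (y, \<eta>)" using e by auto
      show "f = g"
      proof
        fix y show "f y = g y"
        proof (cases "y \<in> Y")
          case True
          have fy: "snd (f y) \<in> Func {..<fst (f y)} ?W" and gy: "snd (g y) \<in> Func {..<fst (g y)} ?W"
            using f g True unfolding Func_def by fastforce+
          have bd: "fst (f y) < \<delta> f" "fst (g y) < \<delta> f" using \<delta>[OF f] \<delta>[OF g] True d by auto
          have iff: "\<eta> < fst (f y) \<longleftrightarrow> \<eta> < fst (g y)" if "\<eta> < \<delta> f" for \<eta>
            using c[of y \<eta>] True that d unfolding code_def by (auto split: if_splits) (metis Inr_inject)
          have fst: "fst (f y) = fst (g y)" using iff[OF bd(1)] iff[OF bd(2)] by auto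
          have "snd (f y) \<eta> = snd (g y) \<eta>" for \<eta>
          proof (cases "\<eta> < fst (f y)")
            case t: True
            hence "\<eta> < \<delta> f" using bd by simp
            thus ?thesis using c[of y \<eta>] True t fst d unfolding code_def by auto
          next
            case False
            thus ?thesis using fy gy fst unfolding Func_def by simp
          qed
          hence "snd (f y) = snd (g y)" by blast
          thus ?thesis using fst by (simp add: prod_eq_iff)
        next
          case False
          thus ?thesis using f g by (simp add: Func_def)
        qed
      qed
    qed
  next
    fix f assume f: "f \<in> Func Y bounded_funs"
    have "snd (f y) \<eta> \<in> ?W" if "y \<in> Y" "\<eta> < fst (f y)" for y \<eta>
    proof -
      have "snd (f y) \<in> Func {..<fst (f y)} ?W" using f that(1) unfolding Func_def by fastforce
      thus ?thesis using that(2) unfolding Func_def by blast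
    qed
    hence "code f \<in> Func (Y \<times> {..<\<delta> f}) (?W \<times> ?W)" unfolding Func_def code_def by auto
    thus "(\<delta> f, code f) \<in> (SIGMA x:{..<least_regular \<kappa>}. Func (Y \<times> {..<x}) (?W \<times> ?W))" using \<delta>[OF f] by simp
  qed
  \<comment> \<open>There are \<open>\<kappa>\<^sub>r\<close> choices of the bound x, and each
    exponent \<open>Y \<times> {..<x}\<close> is still smaller than \<open>\<kappa>\<^sub>r\<close>,
    so every summand is at most \<open>mu\<close>.\<close>
  moreover have "|SIGMA x:{..<least_regular \<kappa>}. Func (Y \<times> {..<x}) (?W \<times> ?W)| \<le>o |{..<mu \<kappa> \<alpha>}|"
  proof (rule card_of_Sigma_ordLeq_infinite[OF infinite_mu mu_ge_kr], rule ballI)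
    fix x assume "x \<in> {..<least_regular \<kappa>}"
    hence "|{..<x}| <o |{..<least_regular \<kappa>}|" using kr(2) by (simp add: is_cardinal_less_iff)
    hence "|Y \<times> {..<x}| <o |{..<least_regular \<kappa>}|" by (rule card_Times_less[OF kr(3) Y])
    hence F: "|Func (Y \<times> {..<x}) ?W| \<le>o |{..<mu \<kappa> \<alpha>}|" by (rule mu_ge_Func)
    have "|Func (Y \<times> {..<x}) ?W \<times> Func (Y \<times> {..<x}) ?W| \<le>o |{..<mu \<kappa> \<alpha>}|"
      by (rule card_Times_leq[OF infinite_mu F F])
    thus "|Func (Y \<times> {..<x}) (?W \<times> ?W)| \<le>o |{..<mu \<kappa> \<alpha>}|"
      by (rule ordIso_ordLeq_trans[OF Func_Times_Range])
  qed
  ultimately have "|Func Y bounded_funs| \<le>o |{..<mu \<kappa> \<alpha>}|" by (rule ordLeq_transitive)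
  thus ?thesis by (rule ordLeq_transitive[OF card_Func_mono[OF mu_le_bounded_funs]])
qed

end

end

section \<open>Closing a set under realizations of small types\<close>

context saturated_setup begin

abbreviation "kr \<equiv> least_regular \<kappa>"

lemmas kr_props = least_regular_props[OF cardinal_kappa infinite_kappa]

lemma less_kr: "few Y \<Longrightarrow> |Y| <o |{..<kr}|"
  by (rule ordLess_ordLeq_trans[OF _ card_of_lessThan_mono[OF kr_props(1)]])

lemma less_kappa: "x < \<kappa> \<Longrightarrow> few {..<x}"
  using cardinal_kappa by (simp add: is_cardinal_less_iff)

text \<open>A small subset is the range of a function on some \<gamma> < \<kappa>, and there are at
  most |Z| choices for \<gamma> and for the function.\<close>

lemma card_small_subsets:
  fixes Z :: "'z set"
  assumes A: "|A| \<le>o |Z|" and Z: "|{..<\<kappa>}| \<le>o |Z|"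
    and F: "\<And>\<gamma>. \<gamma> < \<kappa> \<Longrightarrow> |Func {..<\<gamma>} Z| \<le>o |Z|"
  shows "|{D. D \<subseteq> A \<and> few D }| \<le>o |Z|"
proof -
  have inf: "infinite Z" using card_of_ordLeq_infinite[OF Z infinite_kappa] .
  have "{D. D \<subseteq> A \<and> few D } \<subseteq> (\<Union>\<gamma>\<in>{..<\<kappa>}. (\<lambda>f. f ` {..<\<gamma>}) ` Func {..<\<gamma>} A)"
  proof
    fix D assume "D \<in> {D. D \<subseteq> A \<and> few D }"
    hence D: "D \<subseteq> A" "few D" by auto
    obtain \<gamma> where g: "\<gamma> < \<kappa>" "|{..<\<gamma>}| =o |D|" using small_cardinal[OF cardinal_kappa D(2)] by blast
    obtain h where h: "bij_betw h {..<\<gamma>} D" using g(2) card_of_ordIso by metis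
    let ?h = "\<lambda>i. if i \<in> {..<\<gamma>} then h i else undefined"
    have im: "h ` {..<\<gamma>} = D" using bij_betw_imp_surj_on[OF h] .
    have "D = ?h ` {..<\<gamma>}" using im by (force simp: image_iff)
    moreover have "?h \<in> Func {..<\<gamma>} A" using im D(1) by (auto simp: Func_def)
    ultimately show "D \<in> (\<Union>\<gamma>\<in>{..<\<kappa>}. (\<lambda>f. f ` {..<\<gamma>}) ` Func {..<\<gamma>} A)" using g(1) by blast
  qed
  hence "|{D. D \<subseteq> A \<and> few D }| \<le>o |\<Union>\<gamma>\<in>{..<\<kappa>}. (\<lambda>f. f ` {..<\<gamma>}) ` Func {..<\<gamma>} A|"
    by (rule card_of_mono1)
  moreover have "|\<Union>\<gamma>\<in>{..<\<kappa>}. (\<lambda>f. f ` {..<\<gamma>}) ` Func {..<\<gamma>} A| \<le>o |Z|"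
  proof (rule card_UNION_leq[OF inf Z])
    fix \<gamma> assume "\<gamma> \<in> {..<\<kappa>}"
    hence "|Func {..<\<gamma>} Z| \<le>o |Z|" using F by simp
    hence "|Func {..<\<gamma>} A| \<le>o |Z|" by (rule ordLeq_transitive[OF card_Func_mono[OF A]])
    thus "|(\<lambda>f. f ` {..<\<gamma>}) ` Func {..<\<gamma>} A| \<le>o |Z|" by (rule ordLeq_transitive[OF card_of_image])
  qed
  ultimately show ?thesis by (rule ordLeq_transitive)
qed

lemma card_idx_less:
  assumes "\<gamma> < \<kappa>" "few D" shows "few (idx {..<\<gamma>} D)"
  unfolding idx_def
proof (rule card_of_Un_ordLess_infinite[OF infinite_kappa])
  show "few (Inl ` {..<\<gamma>})" by (rule ordLeq_ordLess_trans[OF card_of_image less_kappa[OF assms(1)]])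
  show "few (Inr ` D)" by (rule ordLeq_ordLess_trans[OF card_of_image assms(2)])
qed

text \<open>Codes can be placed on a set of size x < \<kappa> depending on the length and on D. This
  keeps the number of types over D at 2^x; codes on \<open>{..<\<kappa>}\<close> would cost
  2^\<kappa>, which need not be below \<open>\<mu>\<^sub>\<alpha>\<close>.\<close>

lemma ex_code_bound:
  assumes "\<gamma> < \<kappa>" "few D"
  shows "\<exists>x<\<kappa>. |ls| \<le>o |{..<x}| \<and> |idx {..<\<gamma>} D| \<le>o |{..<x}|"
proof -
  have "few (ls <+> idx {..<\<gamma>} D)"
    by (rule card_of_Plus_ordLess_infinite[OF infinite_kappa less_kappa[OF LS_less] card_idx_less[OF assms]])
  from small_cardinal[OF cardinal_kappa this]
  obtain x where x: "x < \<kappa>" "|{..<x}| =o |ls <+> idx {..<\<gamma>} D|" by blast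
  have "|ls| \<le>o |{..<x}|" by (rule ordLeq_ordIso_trans[OF card_of_Plus1 ordIso_symmetric[OF x(2)]])
  moreover have "|idx {..<\<gamma>} D| \<le>o |{..<x}|" by (rule ordLeq_ordIso_trans[OF card_of_Plus2 ordIso_symmetric[OF x(2)]])
  ultimately show ?thesis using x(1) by blast
qed

text \<open>For each code over a small subset of A \<union> R that has a realization in M, one
  realization is chosen. R may lie outside M; through it enters the sequence whose local character
  is sought. The size assumptions allow Z to be \<open>\<mu>\<^sub>\<alpha>\<close> as well as the
  cardinal l of a stability statement.\<close>

lemma closure_step:
  fixes Z :: "'z set"
  assumes MN: "leq K M N" and A: "A \<subseteq> univ M" "|A| \<le>o |Z|" and R: "R \<subseteq> univ N" "|R| \<le>o |Z|"
    and ZF: "\<And>\<gamma>. \<gamma> < \<kappa> \<Longrightarrow> |Func {..<\<gamma>} Z| \<le>o |Z|" and ZP: "\<And>x. x < \<kappa> \<Longrightarrow> |Pow {..<x}| \<le>o |Z|"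
    and Zk: "|{..<\<kappa>}| \<le>o |Z|"
  shows "\<exists>A'. A' \<subseteq> univ M \<and> |A'| \<le>o |Z| \<and> (\<forall>D \<gamma> c. D \<subseteq> A \<union> R \<and> few D \<and> \<gamma> < \<kappa> \<and> c \<in> seqs \<gamma> (univ M) \<longrightarrow>
     (\<exists>c'\<in>seqs \<gamma> A'. same K0 (idx {..<\<gamma>} D) (asg c) N (asg c') N))"
proof -
  have inf: "infinite Z" using card_of_ordLeq_infinite[OF Zk infinite_kappa] .
  have m: "N \<in> mods K0" "univ M \<subseteq> univ N" using MN leq_univ mods_K_K0 by (auto simp: leq_K)
  define bd where "bd \<gamma> D = (SOME x. x < \<kappa> \<and> |ls| \<le>o |{..<x}| \<and> |idx {..<\<gamma>} D| \<le>o |{..<x}| )" for \<gamma> :: 'u and D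
  have bd: "bd \<gamma> D < \<kappa> \<and> |ls| \<le>o |{..<bd \<gamma> D}| \<and> |idx {..<\<gamma>} D| \<le>o |{..<bd \<gamma> D}|" if "\<gamma> < \<kappa>" "few D" for \<gamma> D
    unfolding bd_def using ex_code_bound[OF that] by (rule someI_ex)
  let ?Ds = "{D. D \<subseteq> A \<union> R \<and> few D }"
  define Prob where "Prob = (SIGMA \<gamma>:{..<\<kappa>}. SIGMA D:?Ds. reps (idx {..<\<gamma>} D) {..<bd \<gamma> D})"
  define ok where "ok p c \<longleftrightarrow> (case p of (\<gamma>, D, b', N') \<Rightarrow> c \<in> seqs \<gamma> (univ M) \<and> same K0 (idx {..<\<gamma>} D) (asg c) N b' N')" for p c
  define w where "w p = (SOME c. ok p c)" for p
  define A' where "A' = (\<Union>p\<in>{p \<in> Prob. \<exists>c. ok p c}. ran (w p))"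
  have w: "ok p (w p)" if "\<exists>c. ok p c" for p unfolding w_def using that by (rule someI_ex)
  have cP: "|Prob| \<le>o |Z|"
    unfolding Prob_def
  proof (rule card_of_Sigma_ordLeq_infinite[OF inf Zk], rule ballI, rule card_of_Sigma_ordLeq_infinite[OF inf], rule_tac [2] ballI)
    fix \<gamma> assume g: "\<gamma> \<in> {..<\<kappa>}"
    show "|?Ds| \<le>o |Z|" by (rule card_small_subsets[OF card_Un_leq[OF inf A(2) R(2)] Zk ZF])
    fix D assume "D \<in> ?Ds"
    hence b: "bd \<gamma> D < \<kappa> \<and> |ls| \<le>o |{..<bd \<gamma> D}| \<and> |idx {..<\<gamma>} D| \<le>o |{..<bd \<gamma> D}|" using bd g by simp
    hence "|reps (idx {..<\<gamma>} D) {..<bd \<gamma> D}| \<le>o |Pow {..<bd \<gamma> D}|" by (intro card_reps) auto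
    thus "|reps (idx {..<\<gamma>} D) {..<bd \<gamma> D}| \<le>o |Z|" using ZP b ordLeq_transitive by metis
  qed
  have "A' \<subseteq> univ M"
  proof
    fix x assume "x \<in> A'"
    then obtain p where p: "\<exists>c. ok p c" "x \<in> ran (w p)" unfolding A'_def by blast
    show "x \<in> univ M" using w[OF p(1)] p(2) unfolding ok_def seqs_def by (auto split: prod.splits)
  qed
  moreover have "|A'| \<le>o |Z|" unfolding A'_def
  proof (rule card_UNION_leq[OF inf])
    show "|{p \<in> Prob. \<exists>c. ok p c}| \<le>o |Z|" by (rule ordLeq_transitive[OF card_of_mono1 cP]) auto
    fix p assume p: "p \<in> {p \<in> Prob. \<exists>c. ok p c}"
    obtain \<gamma> D b' N' where pe: "p = (\<gamma>, D, b', N')" by (metis prod_cases4)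
    have "ok p (w p)" using w[of p] p by simp
    hence "w p \<in> seqs \<gamma> (univ M)" unfolding pe ok_def by simp
    hence "dom (w p) = {..<\<gamma>}" by (simp add: seqs_def)
    hence "ran (w p) \<subseteq> (\<lambda>i. the (w p i)) ` {..<\<gamma>}" by (force simp: ran_def)
    hence "|ran (w p)| \<le>o |{..<\<gamma>}|" by (rule surj_imp_ordLeq)
    moreover have "|{..<\<gamma>}| \<le>o |{..<\<kappa>}|" using p pe by (intro card_of_lessThan_mono) (auto simp: Prob_def)
    ultimately show "|ran (w p)| \<le>o |Z|" using Zk ordLeq_transitive by metis
  qed
  moreover have "\<exists>c'\<in>seqs \<gamma> A'. same K0 (idx {..<\<gamma>} D) (asg c) N (asg c') N"
    if D: "D \<subseteq> A \<union> R" "few D" and g: "\<gamma> < \<kappa>" and c: "c \<in> seqs \<gamma> (univ M)" for D \<gamma> c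
  proof -
    let ?I = "idx {..<\<gamma>} D"
    have DN: "D \<subseteq> univ N" using D(1) A(1) R(1) m(2) by blast
    have ci: "asg c ` ?I \<subseteq> univ N" by (rule asg_seqs[OF seqs_mono[OF c m(2)] DN])
    have b: "|ls| \<le>o |{..<bd \<gamma> D}|" "|?I| \<le>o |{..<bd \<gamma> D}|" using bd[OF g D(2)] by auto
    obtain b' N' where rep: "(b', N') \<in> reps ?I {..<bd \<gamma> D}" "same K0 ?I (asg c) N b' N'"
      using ex_rep[OF b m(1) ci] by blast
    let ?p = "(\<gamma>, D, b', N')"
    have P: "?p \<in> Prob" using rep(1) g D by (simp add: Prob_def)
    have ex: "\<exists>c. ok ?p c" using c rep(2) by (intro exI[of _ c]) (simp add: ok_def)
    have wp: "w ?p \<in> seqs \<gamma> (univ M)" "same K0 ?I (asg (w ?p)) N b' N'" using w[OF ex] by (auto simp: ok_def)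
    have "ran (w ?p) \<subseteq> A'" unfolding A'_def using P ex by blast
    hence s: "w ?p \<in> seqs \<gamma> A'" using wp(1) by (simp add: seqs_def)
    have "b' ` ?I \<subseteq> univ N'" using rep(1) by (simp add: reps_def)
    from same_trans[OF rep(2) same_sym[OF wp(2)] this] s show ?thesis by (rule bexI)
  qed
  ultimately show ?thesis by (intro exI[of _ A'] conjI allI impI) auto
qed

end

subsection \<open>Local character\<close>

lemma card_image_factor:
  assumes "\<And>c c'. c \<in> S \<Longrightarrow> c' \<in> S \<Longrightarrow> key c = key c' \<Longrightarrow> F c = F c'"
  shows "|F ` S| \<le>o |key ` S|"
proof -
  let ?g = "\<lambda>k. F (SOME c. c \<in> S \<and> key c = k)"
  have "F c = ?g (key c)" if "c \<in> S" for c
  proof -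
    have "(SOME c'. c' \<in> S \<and> key c' = key c) \<in> S \<and> key (SOME c'. c' \<in> S \<and> key c' = key c) = key c"
      by (rule someI[of _ c]) (use that in simp)
    thus ?thesis using assms that by metis
  qed
  hence "F ` S \<subseteq> ?g ` key ` S" by auto
  thus ?thesis by (rule surj_imp_ordLeq)
qed

context saturated_setup begin

text \<open>W is the union of a chain of length \<open>kr\<close>; each stage realizes the types,
  realized in M, over small subsets of the earlier stages and R. The closure gives both conclusions:
  W is saturated, and small tuples of M have copies in W over W \<union> R, which makes the type of
  M a coheir.\<close>

lemma closed_submodel:
  fixes Z :: "'z set"
  assumes MN: "leq K M N" and C: "C \<subseteq> univ M" "|C| \<le>o |Z|" and R: "R \<subseteq> univ N" "|R| \<le>o |Z|"
    and ZF: "\<And>\<gamma>. \<gamma> < \<kappa> \<Longrightarrow> |Func {..<\<gamma>} Z| \<le>o |Z|" and ZP: "\<And>x. x < \<kappa> \<Longrightarrow> |Pow {..<x}| \<le>o |Z|"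
    and Zr: "|{..<kr}| \<le>o |Z|"
  shows "\<exists>W. leq K W M \<and> C \<subseteq> univ W \<and> |univ W| \<le>o |Z| \<and> indep' W N (univ M) R"
proof -
  have Zk: "|{..<\<kappa>}| \<le>o |Z|" by (rule ordLeq_transitive[OF card_of_lessThan_mono[OF kr_props(1)] Zr])
  have inf: "infinite Z" using card_of_ordLeq_infinite[OF Zk infinite_kappa] .
  have lsZ: "|ls| \<le>o |Z|" by (rule ordLeq_transitive[OF ls_le_kappa Zk])
  have m: "M \<in> mods K0" "leq K0 M N" "univ M \<subseteq> univ N" "M \<in> mods K" "N \<in> mods K" using MN leq_univ mods_K_K0 by (auto simp: leq_K)
  have "|{..<\<kappa>}| \<le>o |univ M|" using m(4) by (simp add: mods_K)
  \<comment> \<open>Models of K have size at least \<kappa>; putting G into every stage secures this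
    for W.\<close>
  then obtain G where G: "G \<subseteq> univ M" "|{..<\<kappa>}| =o |G|" using internalize_card_of_ordLeq2 by metis
  have cG: "|G| \<le>o |Z|" by (rule ordIso_ordLeq_trans[OF ordIso_symmetric[OF G(2)] Zk])
  define closed where "closed A A' \<longleftrightarrow> (\<forall>D \<gamma> c. D \<subseteq> A \<union> R \<and> few D \<and> \<gamma> < \<kappa> \<and> c \<in> seqs \<gamma> (univ M) \<longrightarrow>
     (\<exists>c'\<in>seqs \<gamma> A'. same K0 (idx {..<\<gamma>} D) (asg c) N (asg c') N))" for A A'
  let ?P = "\<lambda>f i r. i < kr \<longrightarrow> leq K0 r M \<and> |univ r| \<le>o |Z| \<and> C \<union> G \<subseteq> univ r \<and> (\<forall>j<i. univ (f j) \<subseteq> univ r) \<and>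
     closed (\<Union>j<i. univ (f j)) (univ r)"
  have "\<exists>f. \<forall>i. ?P f i (f i)"
  proof (rule dependent_wellorder_choice)
    fix r and f g :: "'u \<Rightarrow> ('s, 'u) struct" and i :: 'u assume e: "\<And>j. j < i \<Longrightarrow> f j = g j"
    have "(\<Union>j<i. univ (f j)) = (\<Union>j<i. univ (g j))" using e by auto
    thus "?P f i r = ?P g i r" using e by simp
  next
    fix i :: 'u and f :: "'u \<Rightarrow> ('s, 'u) struct" assume *: "\<And>j. j < i \<Longrightarrow> ?P f j (f j)"
    show "\<exists>r. ?P f i r"
    proof (cases "i < kr")
      case True
      have ji: "leq K0 (f j) M" "|univ (f j)| \<le>o |Z|" if "j < i" for j
        using *[OF that] order.strict_trans[OF that True] by blast+
      let ?A = "\<Union>j\<in>{..<i}. univ (f j)"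
      have "|{..<i}| \<le>o |{..<kr}|" using True by (intro card_of_lessThan_mono) simp
      hence "|{..<i}| \<le>o |Z|" by (rule ordLeq_transitive[OF _ Zr])
      hence cA: "|?A| \<le>o |Z|" by (rule card_UNION_leq[OF inf]) (use ji in simp)
      have A: "?A \<subseteq> univ M" using leq_univ[OF ji(1)] by blast
      have "\<exists>A'. A' \<subseteq> univ M \<and> |A'| \<le>o |Z| \<and> closed ?A A'" unfolding closed_def
        by (rule closure_step[OF MN A cA R _ _ Zk]) (erule ZF, erule ZP)
      then obtain A' where A': "A' \<subseteq> univ M" "|A'| \<le>o |Z|" "closed ?A A'" by (elim exE conjE)
      let ?B = "?A \<union> (A' \<union> (C \<union> G))"
      have B: "?B \<subseteq> univ M" using A A'(1) C(1) G(1) by blast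
      have cB: "|?B| \<le>o |Z|"
        by (rule card_Un_leq[OF inf cA card_Un_leq[OF inf A'(2) card_Un_leq[OF inf C(2) cG]]])
      obtain r where r: "leq K0 r M" "?B \<subseteq> univ r" "|univ r| \<le>o |Z|"
        using downward_LS[OF m(1) B cB lsZ] by (elim exE conjE)
      have "closed ?A (univ r)" unfolding closed_def
      proof (intro allI impI)
        fix D \<gamma> c assume "D \<subseteq> ?A \<union> R \<and> few D \<and> \<gamma> < \<kappa> \<and> c \<in> seqs \<gamma> (univ M)"
        from A'(3)[unfolded closed_def, rule_format, OF this]
        obtain c' where c': "c' \<in> seqs \<gamma> A'" "same K0 (idx {..<\<gamma>} D) (asg c) N (asg c') N" by (elim bexE)
        have "c' \<in> seqs \<gamma> (univ r)" using seqs_mono[OF c'(1)] r(2) by blast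
        with c'(2) show "\<exists>c'\<in>seqs \<gamma> (univ r). same K0 (idx {..<\<gamma>} D) (asg c) N (asg c') N" by (rule bexI)
      qed
      hence "?P f i r" using r by auto
      thus ?thesis by (intro exI[of _ r])
    qed simp
  qed
  then obtain f where f: "\<forall>i. ?P f i (f i)" by (elim exE)
  have fM: "leq K0 (f i) M" and cf: "|univ (f i)| \<le>o |Z|" and fC: "C \<union> G \<subseteq> univ (f i)"
    and fcl: "closed (\<Union>j<i. univ (f j)) (univ (f i))" if "i < kr" for i using f[rule_format, of i] that by auto
  have lim: "limit_ordinal kr" by (rule infinite_cardinal_limit[OF kr_props(2,3)])
  have chain: "leq K0 (f i) (f j)" if "i < j" "j < kr" for i j
    using leq_of_subset[OF fM[of i] fM[OF that(2)]] f[rule_format, of j] that by auto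
  obtain W where W: "W \<in> mods K0" "univ W = (\<Union>i<kr. univ (f i))"
    "\<And>N. N \<in> mods K0 \<Longrightarrow> (\<And>i. i < kr \<Longrightarrow> leq K0 (f i) N) \<Longrightarrow> leq K0 W N"
    using chain_union[of kr f] lim chain by metis
  have WM: "leq K0 W M" using W(3)[OF m(1)] fM by blast
  have WN: "leq K0 W N" by (rule leq_trans[OF WM m(2)])
  obtain i0 where "i0 < kr" using lim by (auto simp: limit_ordinal_def)
  hence CW: "C \<union> G \<subseteq> univ W" using fC[of i0] W(2) by blast
  have cW: "|univ W| \<le>o |Z|" unfolding W(2) by (rule card_UNION_leq[OF inf Zr]) (use cf in simp)
  \<comment> \<open>By regularity of \<open>kr\<close>, the part of D in W appears before one stage
    x, which then realizes the type. The part of D in R is available at every stage.\<close>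
  have cl: "\<exists>c'\<in>seqs \<gamma> (univ W). same K0 (idx {..<\<gamma>} D) (asg c) N (asg c') N"
    if D: "D \<subseteq> univ W \<union> R" "few D" and g: "\<gamma> < \<kappa>" and c: "c \<in> seqs \<gamma> (univ M)" for D \<gamma> c
  proof -
    have "\<forall>a\<in>D \<inter> univ W. \<exists>i<kr. a \<in> univ (f i)" using W(2) by blast
    then obtain st where st: "\<forall>a\<in>D \<inter> univ W. st a < kr \<and> a \<in> univ (f (st a))" by metis
    have "|D \<inter> univ W| \<le>o |D|" by (rule card_of_mono1) simp
    hence "|D \<inter> univ W| <o |{..<kr}|" using less_kr[OF D(2)] by (rule ordLeq_ordLess_trans)
    from regular_bounded[OF kr_props(2,3,4) this, of st]
    obtain x where x: "x < kr" "\<forall>a\<in>D \<inter> univ W. st a < x" using st by auto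
    have "D \<subseteq> (\<Union>j<x. univ (f j)) \<union> R" using D(1) st x(2) by blast
    hence "D \<subseteq> (\<Union>j<x. univ (f j)) \<union> R \<and> few D \<and> \<gamma> < \<kappa> \<and> c \<in> seqs \<gamma> (univ M)" using D(2) g c by simp
    from fcl[OF x(1), unfolded closed_def, rule_format, OF this]
    obtain c' where c': "c' \<in> seqs \<gamma> (univ (f x))" "same K0 (idx {..<\<gamma>} D) (asg c) N (asg c') N" by (elim bexE)
    have "c' \<in> seqs \<gamma> (univ W)" using seqs_mono[OF c'(1)] W(2) x(1) by blast
    with c'(2) show ?thesis by (rule bexI)
  qed
  have "saturated \<kappa> K0 W" unfolding saturated_iff
  proof (intro conjI allI impI)
    show "W \<in> mods K0" by (rule W(1))
    fix P D \<gamma> b assume "leq K0 W P \<and> D \<subseteq> univ W \<and> few D \<and> \<gamma> < \<kappa> \<and> b \<in> seqs \<gamma> (univ P)"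
    hence P: "leq K0 W P" and D: "D \<subseteq> univ W" "few D" and g: "\<gamma> < \<kappa>" and b: "b \<in> seqs \<gamma> (univ P)" by auto
    let ?I = "idx {..<\<gamma>} D"
    \<comment> \<open>The type in P over W is moved to an extension of M, realized in M because M is
      saturated, and brought into W by the closure.\<close>
    obtain Q h where Q: "leq K0 M Q" "embedding K0 h P Q" "\<forall>x\<in>univ W. h x = x" using extend_over[OF P WM] by metis
    have hb: "mapseq h b \<in> seqs \<gamma> (univ Q)" by (rule mapseq_seqs[OF b embedding_univ[OF Q(2)]])
    have DM: "D \<subseteq> univ M" using D(1) leq_univ[OF WM] by blast
    have "leq K0 M Q \<and> D \<subseteq> univ M \<and> few D \<and> \<gamma> < \<kappa> \<and> mapseq h b \<in> seqs \<gamma> (univ Q)" using Q(1) DM D(2) g hb by simp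
    then obtain c where c: "c \<in> seqs \<gamma> (univ M)" "same K0 ?I (asg c) M (asg (mapseq h b)) Q"
      using m(4)[unfolded mods_K saturated_iff] by metis
    have "D \<subseteq> univ W \<union> R" using D(1) by blast
    from cl[OF this D(2) g c(1)] obtain c' where c': "c' \<in> seqs \<gamma> (univ W)" "same K0 ?I (asg c) N (asg c') N" by (elim bexE)
    have db: "dom b = {..<\<gamma>}" using b by (simp add: seqs_def)
    have s1: "same K0 ?I (asg b) P (asg (mapseq h b)) Q"
      by (rule same_embedding[OF Q(2)]) (use Q(3) D(1) the_mapseq[of _ b h] db in \<open>auto simp: idx_def\<close>)
    have DQ: "D \<subseteq> univ Q" using DM leq_univ[OF Q(1)] by blast
    have s2: "same K0 ?I (asg c) M (asg b) P" by (rule same_trans[OF c(2) same_sym[OF s1] asg_seqs[OF hb DQ]])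
    have s3: "same K0 ?I (asg c) N (asg b) P" by (rule same_trans[OF same_sym[OF same_leq[OF m(2)]] s2 asg_seqs[OF c(1) DM]])
    have DN: "D \<subseteq> univ N" using DM m(3) by blast
    have s4: "same K0 ?I (asg c') N (asg b) P"
      by (rule same_trans[OF same_sym[OF c'(2)] s3 asg_seqs[OF seqs_mono[OF c(1) m(3)] DN]])
    have "same K0 ?I (asg c') W (asg b) P"
      by (rule same_trans[OF same_leq[OF WN] s4 asg_seqs[OF seqs_mono[OF c'(1) leq_univ[OF WN]] DN]])
    thus "\<exists>c\<in>seqs \<gamma> (univ W). same K0 ?I (asg c) W (asg b) P" using c'(1) by (rule bexI)
  qed
  moreover have "|{..<\<kappa>}| \<le>o |univ W|" by (rule ordIso_ordLeq_trans[OF G(2) card_of_mono1]) (use CW in blast)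
  ultimately have WK: "W \<in> mods K" by (simp add: mods_K)
  have WN': "leq K W N" using WK WN m by (simp add: leq_K)
  have "indep' W N (univ M) R" by (rule indep_of_same[OF WN' m(3) R(1)]) (rule cl)
  thus ?thesis using WK WM m(4) cW CW by (intro exI[of _ W]) (auto simp: leq_K)
qed

lemmas mu_facts = mu_ge_Pow[OF cardinal_kappa infinite_kappa] mu_ge_kr[OF cardinal_kappa infinite_kappa]
  infinite_mu[OF cardinal_kappa infinite_kappa] mu_ge_alpha[OF cardinal_kappa infinite_kappa]
  mu_power_less[OF cardinal_kappa infinite_kappa] mu_ge_kappa[OF cardinal_kappa infinite_kappa]

text \<open>The arithmetic of \<open>mu\<close> supplies the size assumptions of
  \<open>closed_submodel\<close>; symmetry then exchanges M and R.\<close>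

lemma local_character:
  assumes nop: "\<not> syntactic_order_property \<kappa> K" and MN: "leq K M N"
    and R: "R \<subseteq> univ N" "|R| \<le>o |{..<mu \<kappa> \<alpha>}|"
  shows "\<exists>M0. leq K M0 M \<and> |univ M0| \<le>o |{..<mu \<kappa> \<alpha>}| \<and> indep' M0 N R (univ M)"
proof -
  have "\<exists>W. leq K W M \<and> {} \<subseteq> univ W \<and> |univ W| \<le>o |{..<mu \<kappa> \<alpha>}| \<and> indep' W N (univ M) R"
  proof (rule closed_submodel[OF MN _ _ R])
    fix \<gamma> assume g: "\<gamma> < \<kappa>"
    show "|Func {..<\<gamma>} {..<mu \<kappa> \<alpha>}| \<le>o |{..<mu \<kappa> \<alpha>}|" by (rule mu_facts(5)[OF less_kr[OF less_kappa[OF g]]])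
    show "|Pow {..<\<gamma>}| \<le>o |{..<mu \<kappa> \<alpha>}|" by (rule mu_facts(1)[OF less_kr[OF less_kappa[OF g]]])
  qed (auto simp: mu_facts card_of_empty)
  then obtain W where "leq K W M" "|univ W| \<le>o |{..<mu \<kappa> \<alpha>}|" "indep' W N (univ M) R" by (elim exE conjE)
  thus ?thesis using indep_sym[OF nop] by (intro exI[of _ W]) simp
qed

lemma card_ran_seq:
  assumes "c \<in> seqs \<gamma> X" "\<gamma> \<le> \<alpha>" shows "|ran c| \<le>o |{..<\<alpha>}|"
proof -
  have "dom c = {..<\<gamma>}" using assms by (simp add: seqs_def)
  hence "ran c \<subseteq> (\<lambda>i. the (c i)) ` {..<\<gamma>}" by (force simp: ran_def)
  hence "|ran c| \<le>o |{..<\<gamma>}|" by (rule surj_imp_ordLeq)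
  thus ?thesis by (rule ordLeq_transitive[OF _ card_of_lessThan_mono[OF assms(2)]])
qed

lemma set_local_character:
  assumes nop: "\<not> syntactic_order_property \<kappa> K" and "p \<in> gS K \<alpha> M"
  shows "\<exists>M0. leq K M0 M \<and> |univ M0| \<le>o |{..<mu \<kappa> \<alpha>}| \<and> gtp_coheir \<kappa> K M0 p"
proof -
  obtain a N where a: "p = gtp K a (univ M) N" "leq K M N" "a \<in> seqs \<alpha> (univ N)" using assms(2) by (auto simp: gS_def)
  have r: "ran a \<subseteq> univ N" using a(3) by (simp add: seqs_def)
  have "|ran a| \<le>o |{..<mu \<kappa> \<alpha>}|" by (rule ordLeq_transitive[OF card_ran_seq[OF a(3) order_refl] mu_facts(4)])
  from local_character[OF nop a(2) r this] obtain M0 where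
    M0: "leq K M0 M" "|univ M0| \<le>o |{..<mu \<kappa> \<alpha>}|" "indep' M0 N (ran a) (univ M)" by (elim exE conjE)
  have m: "N \<in> mods K" "univ M \<subseteq> univ N" using a(2) leq_univ by (auto simp: leq_K)
  have "(a, univ M, N) \<in> p" unfolding a(1) gtp_K using E_at_refl[OF mods_K_K0[OF m(1)] m(2) r] m(1) by (simp add: E_at_K)
  hence "gtp_coheir \<kappa> K M0 p" unfolding gtp_coheir_def using M0(3) by blast
  thus ?thesis using M0 by (intro exI[of _ M0]) simp
qed

text \<open>A strong submodel of M is determined by its universe, so submodels can be counted as
  subsets.\<close>

lemma leq_antisym_univ:
  assumes "leq K0 M0 M" "leq K0 M1 M" "univ M0 = univ M1" shows "M0 = M1"
proof -
  have "leq K0 M0 M1" by (rule leq_of_subset[OF assms(1,2)]) (simp add: assms(3))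
  moreover have "leq K0 M1 M0" by (rule leq_of_subset[OF assms(2,1)]) (simp add: assms(3))
  ultimately have "leq K0 M0 M1 \<and> leq K0 M1 M0" ..
  thus ?thesis
    by (rule aec[unfolded aec_def, THEN conjunct2, THEN conjunct2, THEN conjunct2, THEN conjunct2,
      THEN conjunct2, THEN conjunct1, THEN spec, THEN spec, THEN mp])
qed

end

subsection \<open>Stability and tameness\<close>

context saturated_setup begin

text \<open>Since l has at least two elements, \<open>l^m = l\<close> gives 2^m \<le> l, and Cantor
  gives m \<le> l; the bound on \<alpha> goes through m.\<close>

lemma power_bounds:
  fixes l \<alpha> :: 'u
  defines "m \<equiv> {..<mu \<kappa> \<alpha>}"
  assumes "LS K0 \<le> l" and pow: "|{..<l}| ^c |m| =o |{..<l}|"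
  shows "infinite {..<l}" "|Func m {..<l}| \<le>o |{..<l}|" "|Pow m| \<le>o |{..<l}|" "|m| \<le>o |{..<l}|" "|{..\<alpha>}| \<le>o |{..<l}|"
proof -
  show infl: "infinite {..<l}" by (rule card_of_ordLeq_infinite[OF card_of_lessThan_mono[OF assms(2)] infinite_ls])
  show F: "|Func m {..<l}| \<le>o |{..<l}|" using pow ordIso_imp_ordLeq unfolding cexp_def Field_card_of by blast
  have "|UNIV :: bool set| \<le>o |{..<l}|" by (rule ordLess_imp_ordLeq[OF card_finite_less[OF infl]]) simp
  hence "|Func m (UNIV :: bool set)| \<le>o |Func m {..<l}|" by (rule card_Func_mono)
  hence "|Func m (UNIV :: bool set)| \<le>o |{..<l}|" using F by (rule ordLeq_transitive)
  thus P: "|Pow m| \<le>o |{..<l}|" by (rule ordIso_ordLeq_trans[OF card_of_Pow_Func])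
  show ml: "|m| \<le>o |{..<l}|" by (rule ordLeq_transitive[OF ordLess_imp_ordLeq[OF card_of_Pow] P])
  have "|{..<\<alpha>} \<union> {\<alpha>}| \<le>o |{..<l}|"
    by (rule card_Un_leq[OF infl ordLeq_transitive[OF mu_facts(4) ml[unfolded m_def]]
      ordLess_imp_ordLeq[OF card_finite_less[OF infl]]]) simp
  moreover have "{..\<alpha>} = {..<\<alpha>} \<union> {\<alpha>}" by auto
  ultimately show "|{..\<alpha>}| \<le>o |{..<l}|" by simp
qed

text \<open>A type over \<open>M\<close> is determined by a small submodel over which it is a coheir together with its
  Galois type over that submodel, so counting these pairs bounds the number of types.\<close>

lemma type_keys:
  assumes nop: "\<not> syntactic_order_property \<kappa> K" and LSl: "LS K0 \<le> l"
    and pow: "|{..<l}| ^c |{..<mu \<kappa> \<alpha>}| =o |{..<l}|" and N: "N \<in> mods K" and C: "C \<subseteq> univ N" "|C| \<le>o |{..<l}|"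
  defines "S \<equiv> {c. \<exists>\<gamma>\<le>\<alpha>. c \<in> seqs \<gamma> (univ N)}"
  shows "\<exists>M (key :: ('u \<rightharpoonup> 'u) \<Rightarrow> 'u \<times> 'u set \<times> (('u + 'u \<Rightarrow> 'u) \<times> ('s, 'u) struct)).
    leq K M N \<and> C \<subseteq> univ M \<and> |key ` S| \<le>o |{..<l}| \<and>
    (\<forall>c\<in>S. \<forall>c'\<in>S. key c = key c' \<longrightarrow> dom c = dom c' \<and> tp c (univ M) (H N) = tp c' (univ M) (H N))"
proof -
  let ?m = "{..<mu \<kappa> \<alpha>}" and ?l = "{..<l}"
  note infl = power_bounds(1)[OF LSl pow] and pow' = power_bounds(2)[OF LSl pow]
    and Pm = power_bounds(3)[OF LSl pow] and ml = power_bounds(4)[OF LSl pow]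
  have l0: "?l \<noteq> {}" using infl by auto
  have lsm: "|ls| \<le>o |?m|" by (rule ordLeq_transitive[OF ls_le_kappa mu_facts(6)])
  have NN: "leq K N N" using N leq_refl[OF mods_K_K0[OF N]] by (simp add: leq_K)
  \<comment> \<open>The parameter set C is enlarged to a model of K of size at most l, because local
    character speaks of types over models. Only the closure matters here, so R is empty.\<close>
  have "\<exists>M. leq K M N \<and> C \<subseteq> univ M \<and> |univ M| \<le>o |?l| \<and> indep' M N (univ N) {}"
  proof (rule closed_submodel[OF NN C])
    fix \<gamma> assume g: "\<gamma> < \<kappa>"
    have "|{..<\<gamma>}| \<le>o |{..<\<kappa>}|" using g by (intro card_of_lessThan_mono) simp
    hence "|{..<\<gamma>}| \<le>o |?m|" using mu_facts(6) by (rule ordLeq_transitive)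
    hence "|Func {..<\<gamma>} ?l| \<le>o |Func ?m ?l|" using l0 by (rule card_Func_mono_dom)
    thus "|Func {..<\<gamma>} ?l| \<le>o |?l|" using pow' by (rule ordLeq_transitive)
    have "|Pow {..<\<gamma>}| \<le>o |?m|" by (rule mu_facts(1)[OF less_kr[OF less_kappa[OF g]]])
    thus "|Pow {..<\<gamma>}| \<le>o |?l|" using ml by (rule ordLeq_transitive)
  next
    show "|{..<kr}| \<le>o |?l|" by (rule ordLeq_transitive[OF mu_facts(2) ml])
  qed (auto simp: card_of_empty)
  then obtain M where M: "leq K M N" "C \<subseteq> univ M" "|univ M| \<le>o |?l|" by (elim exE conjE)
  define sub where "sub c = (SOME M0. leq K M0 M \<and> |univ M0| \<le>o |?m| \<and> indep' M0 N (ran c) (univ M))" for c :: "'u \<rightharpoonup> 'u"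
  have sub: "leq K (sub c) M \<and> |univ (sub c)| \<le>o |?m| \<and> indep' (sub c) N (ran c) (univ M)" if c: "c \<in> S" for c
  proof -
    obtain \<gamma> where g: "\<gamma> \<le> \<alpha>" "c \<in> seqs \<gamma> (univ N)" using c unfolding S_def by blast
    have "ran c \<subseteq> univ N" using g(2) by (simp add: seqs_def)
    moreover have "|ran c| \<le>o |?m|" by (rule ordLeq_transitive[OF card_ran_seq[OF g(2,1)] mu_facts(4)])
    ultimately have "\<exists>M0. leq K M0 M \<and> |univ M0| \<le>o |?m| \<and> indep' M0 N (ran c) (univ M)"
      by (rule local_character[OF nop M(1)])
    thus ?thesis unfolding sub_def by (rule someI_ex)
  qed
  have subM: "univ (sub c) \<subseteq> univ M" if "c \<in> S" for c
    using sub[OF that] leq_univ[of "sub c" M] by (simp add: leq_K)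
  have MN: "univ M \<subseteq> univ N" using M(1) leq_univ[of M N] by (simp add: leq_K)
  let ?I = "\<lambda>c. idx (dom c) (univ (sub c))"
  have Im: "|idx {..<\<gamma>} B| \<le>o |?m|" if "\<gamma> \<le> \<alpha>" "|B| \<le>o |?m|" for \<gamma> B
    unfolding idx_def
  proof (rule card_Un_leq[OF mu_facts(3)])
    have "|{..<\<gamma>}| \<le>o |?m|" by (rule ordLeq_transitive[OF card_of_lessThan_mono[OF that(1)] mu_facts(4)])
    thus "|Inl ` {..<\<gamma>}| \<le>o |?m|" by (rule ordLeq_transitive[OF card_of_image])
    show "|Inr ` B| \<le>o |?m|" by (rule ordLeq_transitive[OF card_of_image that(2)])
  qed
  have ran_S: "\<exists>\<gamma>\<le>\<alpha>. dom c = {..<\<gamma>} \<and> ran c \<subseteq> univ N" if "c \<in> S" for c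
    using that unfolding S_def seqs_def by blast
  have asgN: "asg c ` ?I c \<subseteq> univ N" if "c \<in> S" for c
    using ran_S[OF that] order_trans[OF subM[OF that] MN] asg_idx by blast
  define code where "code c = (SOME z. z \<in> reps (?I c) ?m \<and> same K0 (?I c) (asg c) N (fst z) (snd z))" for c
  have code: "code c \<in> reps (?I c) ?m \<and> same K0 (?I c) (asg c) N (fst (code c)) (snd (code c))" if c: "c \<in> S" for c
  proof -
    obtain \<gamma> where g: "\<gamma> \<le> \<alpha>" "dom c = {..<\<gamma>}" using ran_S[OF c] by blast
    have "|?I c| \<le>o |?m|" unfolding g(2) by (rule Im[OF g(1)]) (use sub[OF c] in simp)
    from ex_rep[OF lsm this mods_K_K0[OF N] asgN[OF c]]
    have "\<exists>z. z \<in> reps (?I c) ?m \<and> same K0 (?I c) (asg c) N (fst z) (snd z)" by force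
    thus ?thesis unfolding code_def by (rule someI_ex)
  qed
  \<comment> \<open>The components are the length, the universe of the chosen submodel and a code of
    the type over it. They range over at most l values each: lengths up to \<alpha>, subsets of M of
    size at most \<mu>, and 2^\<mu> codes.\<close>
  define key where "key c = ((THE \<gamma>. dom c = {..<\<gamma>}), univ (sub c), code c)" for c
  have len: "dom c = {..<(THE \<gamma>. dom c = {..<\<gamma>})} \<and> (THE \<gamma>. dom c = {..<\<gamma>}) \<le> \<alpha>" if c: "c \<in> S" for c
  proof -
    obtain \<gamma> where g: "\<gamma> \<le> \<alpha>" "dom c = {..<\<gamma>}" using ran_S[OF c] by blast
    have "(THE \<gamma>. dom c = {..<\<gamma>}) = \<gamma>" using g(2) by (intro the_equality) (simp_all add: lessThan_eq_iff)
    thus ?thesis using g by simp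
  qed
  let ?Bs = "{B. B \<subseteq> univ M \<and> |B| \<le>o |?m| }"
  have "key ` S \<subseteq> (SIGMA \<gamma>:{..\<alpha>}. SIGMA B:?Bs. reps (idx {..<\<gamma>} B) ?m)"
  proof (rule image_subsetI)
    fix c assume c: "c \<in> S"
    show "key c \<in> (SIGMA \<gamma>:{..\<alpha>}. SIGMA B:?Bs. reps (idx {..<\<gamma>} B) ?m)"
      unfolding key_def using len[OF c] sub[OF c] subM[OF c] code[OF c] by auto
  qed
  hence "|key ` S| \<le>o |SIGMA \<gamma>:{..\<alpha>}. SIGMA B:?Bs. reps (idx {..<\<gamma>} B) ?m|" by (rule card_of_mono1)
  moreover have "|SIGMA \<gamma>:{..\<alpha>}. SIGMA B:?Bs. reps (idx {..<\<gamma>} B) ?m| \<le>o |?l|"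
  proof (rule card_of_Sigma_ordLeq_infinite[OF infl], rule_tac [2] ballI, rule_tac [2] card_of_Sigma_ordLeq_infinite[OF infl], rule_tac [3] ballI)
    show "|{..\<alpha>}| \<le>o |?l|" by (rule power_bounds(5)[OF LSl pow])
  next
    \<comment> \<open>The empty set stands apart because it is not the range of a function on the
      nonempty set \<open>?m\<close>.\<close>
    have "?Bs \<subseteq> {{}} \<union> (\<lambda>f. f ` ?m) ` Func ?m (univ M)"
    proof
      fix B assume "B \<in> ?Bs"
      hence B: "B \<subseteq> univ M" "|B| \<le>o |?m|" by auto
      show "B \<in> {{}} \<union> (\<lambda>f. f ` ?m) ` Func ?m (univ M)"
      proof (cases "B = {}")
        case False
        then obtain g where g: "g ` ?m = B" using card_of_ordLeq2 B(2) by metis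
        let ?g = "\<lambda>i. if i \<in> ?m then g i else undefined"
        have "B = ?g ` ?m" using g by (force simp: image_iff)
        moreover have "?g \<in> Func ?m (univ M)" using g B(1) by (auto simp: Func_def)
        ultimately show ?thesis by blast
      qed simp
    qed
    hence "|?Bs| \<le>o |{{}} \<union> (\<lambda>f. f ` ?m) ` Func ?m (univ M)|" by (rule card_of_mono1)
    moreover have "|{{}} \<union> (\<lambda>f. f ` ?m) ` Func ?m (univ M)| \<le>o |?l|"
    proof (rule card_Un_leq[OF infl])
      show "|{{} :: 'u set}| \<le>o |?l|" by (rule ordLess_imp_ordLeq[OF card_finite_less[OF infl]]) simp
      have "|Func ?m (univ M)| \<le>o |?l|" by (rule ordLeq_transitive[OF card_Func_mono[OF M(3)] pow'])
      thus "|(\<lambda>f. f ` ?m) ` Func ?m (univ M)| \<le>o |?l|" by (rule ordLeq_transitive[OF card_of_image])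
    qed
    ultimately show "|?Bs| \<le>o |?l|" by (rule ordLeq_transitive)
  next
    fix \<gamma> B assume g: "\<gamma> \<in> {..\<alpha>}" and B: "B \<in> ?Bs"
    have "|reps (idx {..<\<gamma>} B) ?m| \<le>o |Pow ?m|" by (rule card_reps[OF lsm Im]) (use g B in auto)
    thus "|reps (idx {..<\<gamma>} B) ?m| \<le>o |?l|" using Pm by (rule ordLeq_transitive)
  qed
  ultimately have ckey: "|key ` S| \<le>o |?l|" by (rule ordLeq_transitive)
  have final: "dom c = dom c' \<and> tp c (univ M) (H N) = tp c' (univ M) (H N)"
    if c: "c \<in> S" "c' \<in> S" and e: "key c = key c'" for c c'
  proof -
    have dom: "dom c = dom c'" using e len[OF c(1)] len[OF c(2)] unfolding key_def by simp
    have us: "univ (sub c) = univ (sub c')" and ce: "code c = code c'" using e unfolding key_def by simp_all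
    have sl: "leq K0 (sub c) M" "leq K0 (sub c') M" using sub[OF c(1)] sub[OF c(2)] by (auto simp: leq_K)
    \<comment> \<open>Equal universes give equal submodels and equal codes give equal types over
      them, so the uniqueness of coheirs can be applied.\<close>
    have se: "sub c = sub c'" by (rule leq_antisym_univ[OF sl us])
    have I: "?I c = ?I c'" using dom se by simp
    have "fst (code c) ` ?I c \<subseteq> univ (snd (code c))" using code[OF c(1)] unfolding reps_def by auto
    moreover have "same K0 (?I c) (asg c') N (fst (code c)) (snd (code c))" using code[OF c(2)] I ce by simp
    ultimately have same: "same K0 (?I c) (asg c) N (asg c') N"
      using same_trans[OF conjunct2[OF code[OF c(1)]] same_sym] by blast
    have "tp c (univ M) (H N) = tp c' (univ M) (H N)"
    proof (rule tp_qf_eqI[OF nop _ _ M(1,1) _ order_refl dom])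
      show "indep' (sub c) N (ran c) (univ M)" using sub[OF c(1)] by blast
      show "indep' (sub c) N (ran c') (univ M)" using sub[OF c(2)] se by simp
      show "univ (sub c) \<subseteq> univ M" by (rule subM[OF c(1)])
      fix \<psi> assume "qf \<psi>" and f: "fvars \<psi> \<subseteq> ?I c"
      hence wf: "wfq \<psi>" by (simp add: qf_formula_def)
      have "asg c' ` ?I c \<subseteq> univ N" using asgN[OF c(2)] I by simp
      from sat_same[OF same N N asgN[OF c(1)] this wf f]
      show "sat (H N) (asg c) \<psi> \<longleftrightarrow> sat (H N) (asg c') \<psi>" .
    qed
    thus ?thesis using dom by simp
  qed
  show ?thesis
  proof (rule exI[of _ M], rule exI[of _ key], intro conjI)
    show "leq K M N" "C \<subseteq> univ M" "|key ` S| \<le>o |?l|" by fact+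
    show "\<forall>c\<in>S. \<forall>c'\<in>S. key c = key c' \<longrightarrow> dom c = dom c' \<and>
      tp c (univ M) (H N) = tp c' (univ M) (H N)"
      by (rule ballI, rule ballI, rule impI, rule final)
  qed
qed

lemma syntactic_stability:
  assumes nop: "\<not> syntactic_order_property \<kappa> K" and LSl: "LS K0 \<le> l"
    and pow: "|{..<l}| ^c |{..<mu \<kappa> \<alpha>}| =o |{..<l}|"
  shows "syntactically_stable \<kappa> K \<alpha> l"
  unfolding syntactically_stable_def
proof (intro ballI allI impI)
  fix N C assume N: "N \<in> mods K" and C: "C \<subseteq> univ N" "|C| \<le>o |{..<l}|"
  let ?S = "{c. \<exists>\<gamma>\<le>\<alpha>. c \<in> seqs \<gamma> (univ N)}"
  from type_keys[OF nop LSl pow N C] obtain M and key :: "('u \<rightharpoonup> 'u) \<Rightarrow> 'u \<times> 'u set \<times> (('u + 'u \<Rightarrow> 'u) \<times> ('s, 'u) struct)"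
    where "leq K M N" and M: "C \<subseteq> univ M" and ck: "|key ` ?S| \<le>o |{..<l}|"
    and key: "\<forall>c\<in>?S. \<forall>c'\<in>?S. key c = key c' \<longrightarrow> dom c = dom c' \<and> tp c (univ M) (H N) = tp c' (univ M) (H N)"
    by (elim exE conjE)
  let ?F = "\<lambda>c. tp c C (H N)"
  \<comment> \<open>A type over C is the part of the type over M whose parameters lie in C, so types
    over M determine those over C.\<close>
  have F: "?F c = {\<phi> \<in> tp c (univ M) (H N). fvars \<phi> \<subseteq> Inl ` dom c \<union> Inr ` C}" for c
  proof -
    have "Inr ` C \<subseteq> Inr ` univ M" using M by (rule image_mono)
    thus ?thesis unfolding tp_qf_def by blast
  qed
  have "|?F ` ?S| \<le>o |key ` ?S|"
  proof (rule card_image_factor)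
    fix c c' assume "c \<in> ?S" "c' \<in> ?S" "key c = key c'"
    hence "dom c = dom c' \<and> tp c (univ M) (H N) = tp c' (univ M) (H N)" using key by blast
    thus "?F c = ?F c'" unfolding F by simp
  qed
  hence "|?F ` ?S| \<le>o |{..<l}|" using ck by (rule ordLeq_transitive)
  moreover have "{?F c |c. \<exists>\<gamma>\<le>\<alpha>. c \<in> seqs \<gamma> (univ N)} = ?F ` ?S" by auto
  ultimately show "|{?F c |c. \<exists>\<gamma>\<le>\<alpha>. c \<in> seqs \<gamma> (univ N)}| \<le>o |{..<l}|" by simp
qed

section \<open>Restrictions of Galois types, tameness and shortness\<close>

lemma same_restrict:
  assumes "same K0 (idx (dom a) A) (asg a) N (asg b) N'" "dom a = dom b" "A0 \<subseteq> A"
  shows "same K0 (idx (dom (a |` I)) A0) (asg (a |` I)) N (asg (b |` I)) N'"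
proof (rule same_cong[OF same_mono[OF assms(1)]])
  show "idx (dom (a |` I)) A0 \<subseteq> idx (dom a) A" using assms(3) by (auto simp: idx_def)
  show "asg a i = asg (a |` I) i" "asg b i = asg (b |` I) i" if "i \<in> idx (dom (a |` I)) A0" for i
    using that by (auto simp: idx_def restrict_map_def split: if_splits)
qed

lemma ran_restrict_subset: "ran (b |` I) \<subseteq> ran b"
  by (auto simp: ran_def restrict_map_def)

lemma gtp_restrict_const:
  assumes "(b0, A', N') \<in> p" "\<And>b A N. (b, A, N) \<in> p \<Longrightarrow> gtp L (b |` I) A0 N = T"
  shows "gtp_restrict L I A0 p = T"
proof (rule subset_antisym)
  show "gtp_restrict L I A0 p \<subseteq> T" unfolding gtp_restrict_def
  proof (rule UN_least)
    fix x assume x: "x \<in> p"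
    obtain b A N where "x = (b, A, N)" by (metis prod_cases3)
    thus "(case x of (b, A, N) \<Rightarrow> gtp L (b |` I) A0 N) \<subseteq> T" using assms(2) x by simp
  qed
  have "(case (b0, A', N') of (b, A, N) \<Rightarrow> gtp L (b |` I) A0 N) \<subseteq> gtp_restrict L I A0 p"
    unfolding gtp_restrict_def by (rule UN_upper[OF assms(1)])
  thus "T \<subseteq> gtp_restrict L I A0 p" using assms(2)[OF assms(1)] by simp
qed

text \<open>\<open>gtp_restrict\<close> is a union over all representatives. Embeddings that
  identify two representatives also identify their restrictions, so all members of the union are the
  same type.\<close>

lemma gtp_restrict_gtp:
  assumes L: "L = K0 \<or> L = K" and N: "N \<in> mods L" "A \<subseteq> univ N" "ran a \<subseteq> univ N" "A0 \<subseteq> A"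
  shows "gtp_restrict L I A0 (gtp L a A N) = gtp L (a |` I) A0 N"
proof -
  have mem: "(b, A', N') \<in> gtp L a A N \<longleftrightarrow> N' \<in> mods L \<and> ((a, A, N), (b, A', N')) \<in> E_at K0" for b A' N'
  proof -
    have "N' \<in> mods K0" if "((a, A, N), (b, A', N')) \<in> E_at K0"
      using that same_mods(2) unfolding E_at_iff by blast
    thus ?thesis using L N(1) by (auto simp: gtp_K0 gtp_K E_at_K)
  qed
  have *: "gtp L (b |` I) A0 N' = gtp L (a |` I) A0 N" if "(b, A', N') \<in> gtp L a A N" for b A' N'
  proof -
    have *: "A \<subseteq> univ N'" "ran b \<subseteq> univ N'" "dom a = dom b" "same K0 (idx (dom a) A) (asg a) N (asg b) N'" "N' \<in> mods L"
      using that unfolding mem by (auto simp: E_at_iff)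
    have "same K0 (idx (dom (a |` I)) A0) (asg (a |` I)) N (asg (b |` I)) N'" by (rule same_restrict[OF *(4,3) N(4)])
    moreover have "ran (a |` I) \<subseteq> univ N" "ran (b |` I) \<subseteq> univ N'" "A0 \<subseteq> univ N" "A0 \<subseteq> univ N'"
      using ran_restrict_subset[of a I] ran_restrict_subset[of b I] N * by auto
    moreover have "dom (a |` I) = dom (b |` I)" using *(3) by simp
    ultimately show ?thesis
      using L N(1) *(5) gtp_eq_iff[of N A0 "a |` I" N' "b |` I"] gtp_K_eq_iff[of N A0 "a |` I" N' "b |` I"] by auto
  qed
  have "N \<in> mods K0" using L N(1) mods_K_K0 by blast
  hence "(a, A, N) \<in> gtp L a A N" unfolding mem using E_at_refl N by blast
  thus ?thesis by (rule gtp_restrict_const) (rule *)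
qed

text \<open>Tameness and shortness turn a difference of Galois types into one on fewer than \<kappa>
  indices and parameters. There the Galois type is decided by quantifier-free formulas, on which the
  sequences agree.\<close>

lemma tame_gtp_eq:
  assumes tame: "tame_and_short \<kappa> \<alpha> K0" and l: "leq K M N1" "leq K M N2" and g: "\<gamma> < \<alpha>"
    and a: "a1 \<in> seqs \<gamma> (univ N1)" "a2 \<in> seqs \<gamma> (univ N2)"
    and tp: "tp a1 (univ M) (H N1) = tp a2 (univ M) (H N2)"
  shows "gtp K0 a1 (univ M) N1 = gtp K0 a2 (univ M) N2"
proof (rule ccontr)
  assume ne: "gtp K0 a1 (univ M) N1 \<noteq> gtp K0 a2 (univ M) N2"
  have m: "M \<in> mods K0" "N1 \<in> mods K0" "N2 \<in> mods K0" "leq K0 M N1" "leq K0 M N2" "univ M \<subseteq> univ N1" "univ M \<subseteq> univ N2"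
    "N1 \<in> mods K" "N2 \<in> mods K"
    using l leq_univ mods_K_K0 by (auto simp: leq_K)
  have d: "dom a1 = {..<\<gamma>}" "dom a2 = {..<\<gamma>}" "ran a1 \<subseteq> univ N1" "ran a2 \<subseteq> univ N2" using a by (auto simp: seqs_def)
  have "gtp K0 a1 (univ M) N1 \<in> gS K0 \<gamma> M" "gtp K0 a2 (univ M) N2 \<in> gS K0 \<gamma> M"
    unfolding gS_def using m(4,5) a by blast+
  then obtain A0 I where A0: "A0 \<subseteq> univ M" "few A0" and I: "I \<subseteq> {..<\<gamma>}" "few I"
    and r: "gtp_restrict K0 I A0 (gtp K0 a1 (univ M) N1) \<noteq> gtp_restrict K0 I A0 (gtp K0 a2 (univ M) N2)"
    using tame[unfolded tame_and_short_def, rule_format, OF m(1) g _ _ ne] by metis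
  have r': "gtp K0 (a1 |` I) A0 N1 \<noteq> gtp K0 (a2 |` I) A0 N2"
    using r gtp_restrict_gtp[OF _ m(2,6) d(3) A0(1)] gtp_restrict_gtp[OF _ m(3,7) d(4) A0(1)] by simp
  have dI: "dom (a1 |` I) = I" "dom (a2 |` I) = I" using d I by auto
  have rI: "ran (a1 |` I) \<subseteq> univ N1" "ran (a2 |` I) \<subseteq> univ N2" "A0 \<subseteq> univ N1" "A0 \<subseteq> univ N2"
    using ran_restrict_subset[of a1 I] ran_restrict_subset[of a2 I] d A0 m by auto
  have asgI: "asg (a |` I) x = asg a x" if "x \<in> idx I A0" for a :: "'u \<rightharpoonup> 'u" and x using that by (auto simp: idx_def)
  have "few (idx I A0)" unfolding idx_def
    by (rule card_of_Un_ordLess_infinite[OF infinite_kappa ordLeq_ordLess_trans[OF card_of_image I(2)] ordLeq_ordLess_trans[OF card_of_image A0(2)]])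
  hence "same K0 (idx I A0) (asg (a1 |` I)) N1 (asg (a2 |` I)) N2"
  proof (rule same_of_sat[OF _ m(8,9)])
    show "asg (a1 |` I) ` idx I A0 \<subseteq> univ N1" using asg_idx[OF rI(1,3)] dI by simp
    show "asg (a2 |` I) ` idx I A0 \<subseteq> univ N2" using asg_idx[OF rI(2,4)] dI by simp
    fix \<phi> assume q: "qf \<phi>" and f: "fvars \<phi> \<subseteq> idx I A0" and s: "sat (H N1) (asg (a1 |` I)) \<phi>"
    have s1: "sat (H N) (asg (a |` I)) \<phi> \<longleftrightarrow> sat (H N) (asg a) \<phi>" for N a
      by (rule sat_cong) (use f asgI in blast)
    have "fvars \<phi> \<subseteq> Inl ` {..<\<gamma>} \<union> Inr ` univ M" using f I(1) A0(1) unfolding idx_def by blast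
    hence "\<phi> \<in> tp a1 (univ M) (H N1)" using q s s1 d(1) by (simp add: tp_qf_def)
    hence "\<phi> \<in> tp a2 (univ M) (H N2)" using tp by simp
    thus "sat (H N2) (asg (a2 |` I)) \<phi>" using s1 by (simp add: tp_qf_def)
  qed
  hence "gtp K0 (a1 |` I) A0 N1 = gtp K0 (a2 |` I) A0 N2"
    using gtp_eq_iff[OF m(2) rI(3,1) m(3) rI(4,2)] dI by simp
  thus False using r' by blast
qed

text \<open>\<open>gtp_coheir\<close> asks for independence in one representative only. A formula is
  carried from N to N' along the common type; the witness found there lies in M0, so all values now
  lie in the common parameter set M and the formula can be carried back.\<close>

lemma indep_transfer:
  assumes ind: "indep' M0 N' (ran b) B" and l: "leq K M0 M" "leq K M N" and a: "ran a \<subseteq> univ N"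
    and p: "((a, univ M, N), (b, B, N')) \<in> E_at K"
  shows "indep' M0 N (ran a) (univ M)"
proof -
  have *: "univ M = B" "univ M \<subseteq> univ N" "univ M \<subseteq> univ N'" "ran b \<subseteq> univ N'" "dom a = dom b"
    "same K0 (idx (dom a) (univ M)) (asg a) N (asg b) N'" "N \<in> mods K" "N' \<in> mods K"
    using p unfolding E_at_K E_at_iff by auto
  have m: "leq K M0 N" "univ M0 \<subseteq> univ M" using l leq_trans leq_univ by (auto simp: leq_K)
  let ?I = "idx (dom a) (univ M)"
  have aI: "asg a ` ?I \<subseteq> univ N" using asg_idx[OF a *(2)] .
  have bI: "asg b ` ?I \<subseteq> univ N'" using asg_idx[OF *(4,3)] *(5) by simp
  show "indep' M0 N (ran a) (univ M)"
  proof (rule indepI[OF m(1) a *(2)])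
    fix \<phi> c assume q: "qf \<phi>" and c: "\<And>i. Inl i \<in> fvars \<phi> \<Longrightarrow> c i \<in> ran a"
      and e: "\<And>e. Inr e \<in> fvars \<phi> \<Longrightarrow> e \<in> univ M0 \<union> univ M" and s: "sat (H N) (with_params c) \<phi>"
    have wf: "wfq \<phi>" using q by (simp add: qf_formula_def)
    have eM: "x \<in> univ M" if "Inr x \<in> fvars \<phi>" for x using e[OF that] m(2) by blast
    have "\<exists>j. j \<in> dom a \<and> the (a j) = c i" if i: "Inl i \<in> fvars \<phi>" for i
    proof -
      obtain j where "a j = Some (c i)" using c[OF i] by (auto simp: ran_def)
      thus ?thesis by (intro exI[of _ j]) auto
    qed
    then obtain h where h: "\<And>i. Inl i \<in> fvars \<phi> \<Longrightarrow> h i \<in> dom a \<and> the (a (h i)) = c i" by metis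
    let ?r = "map_sum h id"
    have r: "?r ` fvars \<phi> \<subseteq> ?I"
    proof (rule image_subsetI)
      fix x assume "x \<in> fvars \<phi>"
      thus "?r x \<in> ?I" using h eM by (cases x rule: sum.exhaust) (auto simp: idx_def)
    qed
    have sm: "same K0 (fvars \<phi>) (asg a \<circ> ?r) N (asg b \<circ> ?r) N'" by (rule same_reindex[OF *(6) r])
    have ra: "(asg a \<circ> ?r) ` fvars \<phi> \<subseteq> univ N" and rb: "(asg b \<circ> ?r) ` fvars \<phi> \<subseteq> univ N'"
      using aI bI r unfolding image_comp[symmetric] by blast+
    let ?c = "\<lambda>i. the (b (h i))"
    have "sat (H N) (with_params c) \<phi> \<longleftrightarrow> sat (H N) (asg a \<circ> ?r) \<phi>"
    proof (rule sat_cong)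
      fix x assume "x \<in> fvars \<phi>"
      thus "with_params c x = (asg a \<circ> ?r) x" using h by (cases x rule: sum.exhaust) auto
    qed
    moreover have "sat (H N) (asg a \<circ> ?r) \<phi> \<longleftrightarrow> sat (H N') (asg b \<circ> ?r) \<phi>"
      by (rule sat_same[OF sm *(7,8) ra rb wf subset_refl])
    moreover have "sat (H N') (asg b \<circ> ?r) \<phi> \<longleftrightarrow> sat (H N') (with_params ?c) \<phi>"
    proof (rule sat_cong)
      fix x show "(asg b \<circ> ?r) x = with_params ?c x" by (cases x rule: sum.exhaust) auto
    qed
    ultimately have s': "sat (H N') (with_params ?c) \<phi>" using s by blast
    have "?c i \<in> ran b" if i: "Inl i \<in> fvars \<phi>" for i
    proof -
      have "h i \<in> dom b" using h[OF i] *(5) by simp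
      thus ?thesis by (auto intro: ranI)
    qed
    moreover have "x \<in> univ M0 \<union> B" if "Inr x \<in> fvars \<phi>" for x using eM[OF that] *(1) by simp
    ultimately obtain d where d: "\<forall>i. Inl i \<in> fvars \<phi> \<longrightarrow> d i \<in> univ M0" "sat (H N') (with_params d) \<phi>"
      using indepD[OF ind q _ _ s'] by metis
    have dM: "with_params d x \<in> univ M" if "x \<in> fvars \<phi>" for x
      using that d(1) m(2) eM by (cases x rule: sum.exhaust) auto
    \<comment> \<open>Every value of \<open>with_params d\<close> is a parameter from M, so it is
      looked up at its own index \<open>Inr\<close>.\<close>
    have "same K0 (fvars \<phi>) (asg a \<circ> (Inr \<circ> with_params d)) N (asg b \<circ> (Inr \<circ> with_params d)) N'"
      by (rule same_reindex[OF *(6)]) (use dM in \<open>auto simp: idx_def\<close>)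
    hence "same K0 (fvars \<phi>) (with_params d) N (with_params d) N'" by (rule same_cong) auto
    moreover have "with_params d ` fvars \<phi> \<subseteq> univ N" "with_params d ` fvars \<phi> \<subseteq> univ N'" using dM *(2,3) by auto
    ultimately have "sat (H N) (with_params d) \<phi>" using sat_same[OF _ *(7,8) _ _ wf subset_refl] d(2) by blast
    thus "realized M0 N \<phi>" using d(1) by (intro exI[of _ d] conjI)
  qed
qed

text \<open>The types are given in K, while tameness is assumed for K0. Equality over M0 gives equal
  quantifier-free types over M0, uniqueness of coheirs lifts this to M, and tameness returns to
  Galois types in K0, whose equality is the same as in K.\<close>

lemma uniqueness:
  assumes nop: "\<not> syntactic_order_property \<kappa> K" and tame: "tame_and_short \<kappa> \<alpha> K0" and M: "leq K M0 M"
    and p: "p \<in> gS_less K \<alpha> M" "gtp_coheir \<kappa> K M0 p" and q: "q \<in> gS_less K \<alpha> M" "gtp_coheir \<kappa> K M0 q"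
    and r: "gtp_restrict K UNIV (univ M0) p = gtp_restrict K UNIV (univ M0) q"
  shows "p = q"
proof -
  obtain g1 a1 N1 where 1: "g1 < \<alpha>" "p = gtp K a1 (univ M) N1" "leq K M N1" "a1 \<in> seqs g1 (univ N1)"
    using p(1) by (auto simp: gS_less_def gS_def)
  obtain g2 a2 N2 where 2: "g2 < \<alpha>" "q = gtp K a2 (univ M) N2" "leq K M N2" "a2 \<in> seqs g2 (univ N2)"
    using q(1) by (auto simp: gS_less_def gS_def)
  have d: "dom a1 = {..<g1}" "dom a2 = {..<g2}" "ran a1 \<subseteq> univ N1" "ran a2 \<subseteq> univ N2" using 1(4) 2(4) by (auto simp: seqs_def)
  have m: "N1 \<in> mods K" "N2 \<in> mods K" "univ M \<subseteq> univ N1" "univ M \<subseteq> univ N2" "univ M0 \<subseteq> univ M"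
    using 1(3) 2(3) M leq_univ by (auto simp: leq_K)
  have ind1: "indep' M0 N1 (ran a1) (univ M)"
  proof -
    obtain b B N' where b: "(b, B, N') \<in> p" "indep' M0 N' (ran b) B" using p(2) unfolding gtp_coheir_def by blast
    have "((a1, univ M, N1), (b, B, N')) \<in> E_at K" using b(1) unfolding 1(2) gtp_K by simp
    from indep_transfer[OF b(2) M 1(3) d(3) this] show ?thesis .
  qed
  have ind2: "indep' M0 N2 (ran a2) (univ M)"
  proof -
    obtain b B N' where b: "(b, B, N') \<in> q" "indep' M0 N' (ran b) B" using q(2) unfolding gtp_coheir_def by blast
    have "((a2, univ M, N2), (b, B, N')) \<in> E_at K" using b(1) unfolding 2(2) gtp_K by simp
    from indep_transfer[OF b(2) M 2(3) d(4) this] show ?thesis .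
  qed
  have u: "univ M0 \<subseteq> univ N1" "univ M0 \<subseteq> univ N2" using m by auto
  have rU: "a |` UNIV = a" for a :: "'u \<rightharpoonup> 'u" by (simp add: restrict_map_def)
  have "gtp K a1 (univ M0) N1 = gtp K a2 (univ M0) N2"
    using r gtp_restrict_gtp[OF _ m(1,3) d(3) m(5), of UNIV] gtp_restrict_gtp[OF _ m(2,4) d(4) m(5), of UNIV] 1(2) 2(2) by (simp add: rU)
  hence same: "dom a1 = dom a2" "same K0 (idx (dom a1) (univ M0)) (asg a1) N1 (asg a2) N2"
    using gtp_K_eq_iff[OF m(1) u(1) d(3) m(2) u(2) d(4)] by auto
  have tp: "tp a1 (univ M) (H N1) = tp a2 (univ M) (H N2)"
  proof (rule tp_qf_eqI[OF nop ind1 ind2 1(3) 2(3) m(5) order_refl same(1)])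
    fix \<psi> assume "qf \<psi>" and f: "fvars \<psi> \<subseteq> idx (dom a1) (univ M0)"
    hence wf: "wfq \<psi>" by (simp add: qf_formula_def)
    have "asg a2 ` idx (dom a1) (univ M0) \<subseteq> univ N2" using asg_idx[OF d(4) u(2)] same(1) by simp
    from sat_same[OF same(2) m(1,2) asg_idx[OF d(3) u(1)] this wf f]
    show "sat (H N1) (asg a1) \<psi> \<longleftrightarrow> sat (H N2) (asg a2) \<psi>" .
  qed
  have "g1 = g2" using same(1) d by (metis lessThan_eq_iff)
  hence "gtp K0 a1 (univ M) N1 = gtp K0 a2 (univ M) N2" using tame_gtp_eq[OF tame 1(3) 2(3) 1(1) 1(4) _ tp] 2(4) by simp
  hence "dom a1 = dom a2 \<and> same K0 (idx (dom a1) (univ M)) (asg a1) N1 (asg a2) N2"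
    using gtp_eq_iff[OF mods_K_K0[OF m(1)] m(3) d(3) mods_K_K0[OF m(2)] m(4) d(4)] by blast
  thus ?thesis unfolding 1(2) 2(2) using gtp_K_eq_iff[OF m(1,3) d(3) m(2,4) d(4)] by blast
qed

text \<open>Types over A in N are counted in a saturated extension W. If W has size at least
  \<kappa> it belongs to K and the keys of types apply; a smaller W leaves so few sequences that
  these can be counted directly.\<close>

lemma galois_stability:
  assumes nop: "\<not> syntactic_order_property \<kappa> K" and tame: "tame_and_short \<kappa> \<alpha> K0" and ba: "\<beta> < \<alpha>"
    and LSl: "LS K0 \<le> l" and pow: "|{..<l}| ^c |{..<mu \<kappa> \<beta>}| =o |{..<l}|"
  shows "galois_stable K0 \<beta> l"
  unfolding galois_stable_def
proof (intro ballI allI impI)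
  fix N A assume N: "N \<in> mods K0" and A: "A \<subseteq> univ N" "|A| \<le>o |{..<l}|"
  let ?S = "{b. \<exists>\<gamma>\<le>\<beta>. b \<in> seqs \<gamma> (univ N)}" and ?F = "\<lambda>b. gtp K0 b A N"
  have eq: "{?F b |b. \<exists>\<gamma>\<le>\<beta>. b \<in> seqs \<gamma> (univ N)} = ?F ` ?S" by auto
  obtain W where W: "leq K0 N W" "saturated \<kappa> K0 W" using ex_saturated_extension[OF N cardinal_kappa ls_le_kappa] by blast
  have NW: "univ N \<subseteq> univ W" by (rule leq_univ[OF W(1)])
  have AW: "A \<subseteq> univ W" using A(1) NW by blast
  have "|?F ` ?S| \<le>o |{..<l}|"
  proof (cases "|{..<\<kappa>}| \<le>o |univ W|")
    case True
    hence WK: "W \<in> mods K" using W(2) by (simp add: mods_K)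
    let ?T = "{c. \<exists>\<gamma>\<le>\<beta>. c \<in> seqs \<gamma> (univ W)}"
    from type_keys[OF nop LSl pow WK AW A(2)] obtain M and key :: "('u \<rightharpoonup> 'u) \<Rightarrow> 'u \<times> 'u set \<times> (('u + 'u \<Rightarrow> 'u) \<times> ('s, 'u) struct)"
      where M: "leq K M W" "A \<subseteq> univ M" and ck: "|key ` ?T| \<le>o |{..<l}|"
      and key: "\<forall>c\<in>?T. \<forall>c'\<in>?T. key c = key c' \<longrightarrow> dom c = dom c' \<and> tp c (univ M) (H W) = tp c' (univ M) (H W)"
      by (elim exE conjE)
    have ST: "?S \<subseteq> ?T" using seqs_mono[OF _ NW] by blast
    have "|?F ` ?S| \<le>o |key ` ?S|"
    proof (rule card_image_factor)
      fix c c' assume c: "c \<in> ?S" "c' \<in> ?S" and k: "key c = key c'"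
      have dt: "dom c = dom c' \<and> tp c (univ M) (H W) = tp c' (univ M) (H W)"
        by (rule key[THEN bspec, THEN bspec, THEN mp, OF subsetD[OF ST c(1)] subsetD[OF ST c(2)] k])
      obtain \<gamma> where g: "\<gamma> \<le> \<beta>" "c \<in> seqs \<gamma> (univ N)" using c(1) by blast
      have g': "c' \<in> seqs \<gamma> (univ N)" using c(2) g(2) dt unfolding seqs_def by auto
      have ga: "\<gamma> < \<alpha>" using g(1) ba by simp
      have rn: "ran c \<subseteq> univ N" "ran c' \<subseteq> univ N" using g(2) g' by (auto simp: seqs_def)
      hence rW: "ran c \<subseteq> univ W" "ran c' \<subseteq> univ W" using NW by auto
      have MW: "univ M \<subseteq> univ W" using M(1) leq_univ by (auto simp: leq_K)
      have "gtp K0 c (univ M) W = gtp K0 c' (univ M) W"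
        using tame_gtp_eq[OF tame M(1,1) ga seqs_mono[OF g(2) NW] seqs_mono[OF g' NW]] dt by simp
      hence "same K0 (idx (dom c) (univ M)) (asg c) W (asg c') W"
        using gtp_eq_iff[OF mods_K_K0[OF WK] MW rW(1) mods_K_K0[OF WK] MW rW(2)] by blast
      hence s: "same K0 (idx (dom c) A) (asg c) W (asg c') W"
        by (rule same_mono) (use M(2) in \<open>auto simp: idx_def\<close>)
      have i: "asg c ` idx (dom c) A \<subseteq> univ W" "asg c' ` idx (dom c) A \<subseteq> univ W"
        using asg_idx[OF rW(1) AW] asg_idx[OF rW(2) AW] dt by simp_all
      have "same K0 (idx (dom c) A) (asg c) N (asg c') N"
        by (rule same_trans[OF same_trans[OF same_leq[OF W(1)] s i(1)] same_sym[OF same_leq[OF W(1)]] i(2)])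
      thus "?F c = ?F c'" using gtp_eq_iff[OF N A(1) rn(1) N A(1) rn(2)] dt by blast
    qed
    also have "|key ` ?S| \<le>o |key ` ?T|" by (rule card_of_mono1[OF image_mono[OF ST]])
    also note ck
    finally show ?thesis .
  next
    case False
    let ?m = "{..<mu \<kappa> \<beta>}" and ?l = "{..<l}"
    note infl = power_bounds(1)[OF LSl pow] and pow' = power_bounds(2)[OF LSl pow] and ml = power_bounds(4)[OF LSl pow]
    \<comment> \<open>Now N has at most \<kappa> \<le> \<mu> \<le> l elements, so each of the at
      most l lengths contributes at most \<open>l^\<mu> = l\<close> sequences.\<close>
    have "|univ W| \<le>o |{..<\<kappa>}|" using False not_ordLess_ordLeq_card ordLess_imp_ordLeq by blast
    hence "|univ W| \<le>o |?l|" using ordLeq_transitive[OF mu_facts(6) ml] by (rule ordLeq_transitive)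
    hence Nl: "|univ N| \<le>o |?l|" by (rule ordLeq_transitive[OF card_of_mono1[OF NW]])
    have "?S = (\<Union>\<gamma>\<in>{..\<beta>}. seqs \<gamma> (univ N))" by auto
    moreover have "|\<Union>\<gamma>\<in>{..\<beta>}. seqs \<gamma> (univ N)| \<le>o |?l|"
    proof (rule card_UNION_leq[OF infl])
      show "|{..\<beta>}| \<le>o |?l|" by (rule power_bounds(5)[OF LSl pow])
      fix \<gamma> assume "\<gamma> \<in> {..\<beta>}"
      hence "|{..<\<gamma>}| \<le>o |{..<\<beta>}|" by (intro card_of_lessThan_mono) simp
      hence gm: "|{..<\<gamma>}| \<le>o |?m|" by (rule ordLeq_transitive[OF _ mu_facts(4)])
      have "|Func {..<\<gamma>} (univ N)| \<le>o |Func ?m (univ N)|" by (rule card_Func_mono_dom[OF gm univ_nonempty[OF N]])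
      moreover have "|Func ?m (univ N)| \<le>o |?l|" by (rule ordLeq_transitive[OF card_Func_mono[OF Nl] pow'])
      ultimately have "|Func {..<\<gamma>} (univ N)| \<le>o |?l|" by (rule ordLeq_transitive)
      thus "|seqs \<gamma> (univ N)| \<le>o |?l|" by (rule ordLeq_transitive[OF card_seqs])
    qed
    ultimately have "|?S| \<le>o |?l|" by simp
    thus ?thesis by (rule ordLeq_transitive[OF card_of_image])
  qed
  thus "|{?F b |b. \<exists>\<gamma>\<le>\<beta>. b \<in> seqs \<gamma> (univ N)}| \<le>o |{..<l}|" unfolding eq .
qed

end

theorem theorem5p15:
  fixes K0 K :: "('s, 'u::wellorder) aclass" and \<kappa> :: 'u
  assumes "inaccessible_universe TYPE('u)"
    and "aec K0" and "amalgamation K0"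
    and "is_cardinal \<kappa>" and "LS K0 < \<kappa>"
    and "K = saturated_class \<kappa> K0"
  shows
    "\<comment> \<open>(1)\<close>
     (\<forall>f N N' M A B. iso (voc K) f N N' \<and> indep \<kappa> K M N A B \<longrightarrow>
        indep \<kappa> K (image_struct (voc K) f M) N' (f ` A) (f ` B)) \<and>
     (\<forall>M M' N0 N A B A0 B0.
        indep \<kappa> K M N A B \<and> leq K M M' \<and> leq K M' N0 \<and> leq K N0 N \<and>
        A0 \<subseteq> A \<and> B0 \<subseteq> B \<and> univ M' \<subseteq> B \<and> A0 \<union> B0 \<subseteq> univ N0 \<longrightarrow>
        indep \<kappa> K M' N0 A0 B0) \<and>
     (\<forall>M N A B. indep \<kappa> K M N A B \<longrightarrow> indep \<kappa> K M N (A \<union> univ M) (B \<union> univ M)) \<and>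
     (\<forall>M N A B. indep \<kappa> K M N A B \<longrightarrow> A \<inter> B \<subseteq> univ M) \<and>
     (\<forall>M N A B. leq K M N \<and> A \<subseteq> univ N \<and> B \<subseteq> univ N \<longrightarrow>
        indep \<kappa> K M N A (univ M) \<and> indep \<kappa> K M N (univ M) B) \<and>
     (\<forall>M N A B. indep \<kappa> K M N A B \<longleftrightarrow>
        (\<forall>A0 B0. A0 \<subseteq> A \<and> B0 \<subseteq> B \<and> |A0| <o |{..<\<kappa>}| \<and> |B0| <o |{..<\<kappa>}| \<longrightarrow>
           indep \<kappa> K M N A0 B0)) \<and>
     (\<forall>M0 M1 N A B. leq K M0 M1 \<and> indep \<kappa> K M0 N (univ M1) B \<and> indep \<kappa> K M1 N A B \<longrightarrow>
        indep \<kappa> K M0 N A B) \<and>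
     \<comment> \<open>(2)\<close>
     (\<not> syntactic_order_property \<kappa> K \<longrightarrow>
        (\<forall>M N A B. indep \<kappa> K M N A B \<longleftrightarrow> indep \<kappa> K M N B A) \<and>
        (\<forall>M0 M1 N A B. leq K M0 M1 \<and> indep \<kappa> K M0 N A (univ M1) \<and> indep \<kappa> K M1 N A B \<longrightarrow>
           indep \<kappa> K M0 N A B) \<and>
        (\<forall>\<alpha> M p. is_cardinal \<alpha> \<and> M \<in> mods K \<and> p \<in> gS K \<alpha> M \<longrightarrow>
           (\<exists>M0. leq K M0 M \<and> |univ M0| \<le>o |{..<mu \<kappa> \<alpha>}| \<and> gtp_coheir \<kappa> K M0 p)) \<and>
        (\<forall>M0 M N1 N2 B q1 q2.
           leq K M0 M \<and> leq K M N1 \<and> leq K M N2 \<and> univ M0 \<subseteq> B \<and> B \<subseteq> univ M \<and>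
           q1 \<in> S_qf \<kappa> (hat_voc \<kappa> K) B (hat \<kappa> K N1) \<and>
           q2 \<in> S_qf \<kappa> (hat_voc \<kappa> K) B (hat \<kappa> K N2) \<and>
           qf_restrict q1 (univ M0) = qf_restrict q2 (univ M0) \<and>
           coheir (hat \<kappa> K N1) (univ M0) q1 \<and> coheir (hat \<kappa> K N2) (univ M0) q2 \<longrightarrow>
           q1 = q2) \<and>
        (\<forall>\<alpha> l. is_cardinal \<alpha> \<and> is_cardinal l \<and> LS K0 \<le> l \<and>
           |{..<l}| ^c |{..<mu \<kappa> \<alpha>}| =o |{..<l}| \<longrightarrow>
           syntactically_stable \<kappa> K \<alpha> l)) \<and>
     \<comment> \<open>(3)\<close>
     (\<forall>\<alpha>. \<not> syntactic_order_property \<kappa> K \<and> tame_and_short \<kappa> \<alpha> K0 \<longrightarrow>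
        (\<forall>M0 M p q.
           leq K M0 M \<and> p \<in> gS_less K \<alpha> M \<and> q \<in> gS_less K \<alpha> M \<and>
           gtp_coheir \<kappa> K M0 p \<and> gtp_coheir \<kappa> K M0 q \<and>
           gtp_restrict K UNIV (univ M0) p = gtp_restrict K UNIV (univ M0) q \<longrightarrow>
           p = q) \<and>
        (\<forall>\<beta> l. \<beta> < \<alpha> \<and> is_cardinal \<beta> \<and> is_cardinal l \<and> LS K0 \<le> l \<and>
           |{..<l}| ^c |{..<mu \<kappa> \<beta>}| =o |{..<l}| \<longrightarrow>
           galois_stable K0 \<beta> l))"
proof -
  interpret saturated_setup "TYPE('u)" K0 \<kappa>
    using assms(1-5) by unfold_locales
  have K: "K = saturated_class \<kappa> K0" by (rule assms(6))
  show ?thesis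
    unfolding K voc_K
  proof (intro conjI allI impI, goal_cases)
    case 1 thus ?case using indep_invariance by blast
  next
    case 2 thus ?case by (elim conjE) (rule indep_monotonicity)
  next
    case 3 thus ?case by (rule indep_normality)
  next
    case 4 thus ?case by (rule indep_disjointness)
  next
    case 5 thus ?case using left_existence by blast
  next
    case 6 thus ?case using right_existence by blast
  next
    case 7 show ?case by (rule indep_set_witness)
  next
    case 8 thus ?case using strong_left_transitivity by blast
  next
    case 9 thus ?case using indep_sym by blast
  next
    case 10 thus ?case using strong_right_transitivity by blast
  next
    case 11 thus ?case using set_local_character by blast
  next
    case 12 thus ?case by (elim conjE) (rule syntactic_uniqueness)
  next
    case 13 thus ?case using syntactic_stability by blast
  next
    case 14 thus ?case by (elim conjE) (rule uniqueness)
  next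
    case 15 thus ?case by (elim conjE) (rule galois_stability)
  qed
qed

end
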